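(* Let $R$ be a (not necessarily commutative) ring with $|R|<\infty$. Then the category $\mathbf{OVI}(R)$ is quasi-Gröbner. In particular, the category $\mathrm{Rep}_{\mathbf{k}}(\mathbf{OVI}(R))$ is locally noetherian when $\mathbf{k}$ is a noetherian commutative ring.
   Context: Rings are associative and unital with $1\ne 0$. $\mathbf{OVI}(R)$ is the following category. Objects are pairs $(V,\{v_i\}_{i\in I})$ where $V$ is a finite rank free left $R$-module and $\{v_i\}$ is a basis indexed by a totally ordered set $I$. A morphism $(V,\{v_i\}_{i \in I}) \to (W,\{w_j\}_{j\in J})$ is a pair $(f,f_0)$ with $f\colon V \to W$ an $R$-linear map and $f_0\colon I \to J$ an order-preserving injection such that $f(v_i) = w_{f_0(i)} + \sum_{j<f_0(i)} a_{i,j} w_j$ for some scalars $a_{i,j}\in R$. A functor $\Phi\colon\mathcal{C}\to\mathcal{D}$ satisfies property (F) if for every $y\in\mathcal{D}$ there exist finitely many objects $x_1,\dots,x_n\in\mathcal{C}$ and morphisms $f_i\colon y\to\Phi(x_i)$ in $\mathcal{D}$ such that for any $x\in\mathcal{C}$ and any morphism $f\colon y\to\Phi(x)$ there exist an $i$ and a morphism $g\colon x_i\to x$ in $\mathcal{C}$ with $f=\Phi(g)\circ f_i$. Let $\mathcal{C}$ be an essentially small category and let $I$ be a set containing a unique representative of each isomorphism class of $\mathcal{C}$. For $x\in\mathcal{C}$, let $|S_x|=\coprod_{y\in I}\mathrm{Hom}(x,y)$, ordered by $f\preceq g$ if there is a morphism $h$ with $g=hf$. $\mathcal{C}$ is Gröbner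 if for every $x\in\mathcal{C}$: (i) $(|S_x|,\preceq)$ is noetherian (i.e. for every infinite sequence $f_1,f_2,\dots$ in $|S_x|$ there exist $i<j$ with $f_i\preceq f_j$); and (ii) $|S_x|$ admits a total ordering $\leq$ that is compatible with left composition ($f\leq g$ implies $hf\leq hg$) and whose restriction to each $\mathrm{Hom}(x,y)$ is a well-ordering. $\mathcal{C}$ is quasi-Gröbner if there exist a Gröbner category $\mathcal{C}'$ and an essentially surjective functor $\mathcal{C}'\to\mathcal{C}$ satisfying property (F). $\mathrm{Rep}_{\mathbf{k}}(\mathcal{C})$ is the category of $\mathcal{C}$-modules over $\mathbf{k}$, i.e. functors $\mathcal{C}\to\mathrm{Mod}_{\mathbf{k}}$. A $\mathcal{C}$-module is finitely generated if it is a quotient of a finite direct sum of modules $P_x$, where $(P_x)_y=\mathbf{k}[\mathrm{Hom}_{\mathcal{C}}(x,y)]$. $\mathrm{Rep}_{\mathbf{k}}(\mathcal{C})$ is locally noetherian if every submodule of a finitely generated $\mathcal{C}$-module is finitely generated. *)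

theory Defs
  imports "HOL-Algebra.Module" "HOL-Algebra.Ring_Divisibility"
begin

section \<open>Categories and functors\<close>

record ('o, 'm) category =
  Obj :: "'o set"
  Arr :: "'m set"
  Dom :: "'m \<Rightarrow> 'o"
  Cod :: "'m \<Rightarrow> 'o"
  Id :: "'o \<Rightarrow> 'm"
  Comp :: "'m \<Rightarrow> 'm \<Rightarrow> 'm"  \<comment> \<open>\<open>Comp C g f\<close> is \<open>g\<close> after \<open>f\<close>\<close>

definition Hom :: "('o, 'm) category \<Rightarrow> 'o \<Rightarrow> 'o \<Rightarrow> 'm set" where
  "Hom C x y = {f \<in> Arr C. Dom C f = x \<and> Cod C f = y}"

locale category =
  fixes C :: "('o, 'm) category"
  assumes Dom_closed: "f \<in> Arr C \<Longrightarrow> Dom C f \<in> Obj C"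
    and Cod_closed: "f \<in> Arr C \<Longrightarrow> Cod C f \<in> Obj C"
    and Id_closed: "x \<in> Obj C \<Longrightarrow> Id C x \<in> Hom C x x"
    and Comp_closed: "f \<in> Hom C x y \<Longrightarrow> g \<in> Hom C y z \<Longrightarrow> Comp C g f \<in> Hom C x z"
    and Comp_Id_right: "f \<in> Hom C x y \<Longrightarrow> Comp C f (Id C x) = f"
    and Comp_Id_left: "f \<in> Hom C x y \<Longrightarrow> Comp C (Id C y) f = f"
    and Comp_assoc: "f \<in> Hom C w x \<Longrightarrow> g \<in> Hom C x y \<Longrightarrow> h \<in> Hom C y z \<Longrightarrow>
      Comp C h (Comp C g f) = Comp C (Comp C h g) f"

definition isomorphic :: "('o, 'm) category \<Rightarrow> 'o \<Rightarrow> 'o \<Rightarrow> bool" where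
  "isomorphic C x y \<longleftrightarrow>
    (\<exists>f \<in> Hom C x y. \<exists>g \<in> Hom C y x. Comp C g f = Id C x \<and> Comp C f g = Id C y)"

locale cat_functor = source: category C + target: category D
  for C :: "('o, 'm) category" and D :: "('p, 'n) category" +
  fixes FO :: "'o \<Rightarrow> 'p" and FM :: "'m \<Rightarrow> 'n"
  assumes FO_closed: "x \<in> Obj C \<Longrightarrow> FO x \<in> Obj D"
    and FM_closed: "f \<in> Hom C x y \<Longrightarrow> FM f \<in> Hom D (FO x) (FO y)"
    and FM_Id: "x \<in> Obj C \<Longrightarrow> FM (Id C x) = Id D (FO x)"
    and FM_Comp: "f \<in> Hom C x y \<Longrightarrow> g \<in> Hom C y z \<Longrightarrow> FM (Comp C g f) = Comp D (FM g) (FM f)"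

definition essentially_surjective ::
    "('o, 'm) category \<Rightarrow> ('p, 'n) category \<Rightarrow> ('o \<Rightarrow> 'p) \<Rightarrow> bool" where
  "essentially_surjective C D FO \<longleftrightarrow> (\<forall>y \<in> Obj D. \<exists>x \<in> Obj C. isomorphic D (FO x) y)"

text \<open>The finite set \<open>S\<close> consists of the pairs \<open>(x\<^sub>i, f\<^sub>i)\<close>.\<close>

definition property_F ::
    "('o, 'm) category \<Rightarrow> ('p, 'n) category \<Rightarrow> ('o \<Rightarrow> 'p) \<Rightarrow> ('m \<Rightarrow> 'n) \<Rightarrow> bool" where
  "property_F C D FO FM \<longleftrightarrow>
    (\<forall>y \<in> Obj D. \<exists>S :: ('o \<times> 'n) set. finite S \<and>
      (\<forall>p \<in> S. fst p \<in> Obj C \<and> snd p \<in> Hom D y (FO (fst p))) \<and>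
      (\<forall>x \<in> Obj C. \<forall>f \<in> Hom D y (FO x).
        \<exists>p \<in> S. \<exists>g \<in> Hom C (fst p) x. f = Comp D (FM g) (snd p)))"


section \<open>Groebner and quasi-Groebner categories\<close>

definition iso_representatives :: "('o, 'm) category \<Rightarrow> 'o set \<Rightarrow> bool" where
  "iso_representatives C I \<longleftrightarrow> I \<subseteq> Obj C \<and> (\<forall>x \<in> Obj C. \<exists>!y. y \<in> I \<and> isomorphic C x y)"

text \<open>An arrow determines its codomain, so the coproduct of the \<open>Hom C x y\<close> over \<open>y \<in> I\<close> is
  their union.\<close>

definition arrows_from :: "('o, 'm) category \<Rightarrow> 'o set \<Rightarrow> 'o \<Rightarrow> 'm set" where
  "arrows_from C I x = (\<Union>y \<in> I. Hom C x y)"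

definition arrow_le :: "('o, 'm) category \<Rightarrow> 'm \<Rightarrow> 'm \<Rightarrow> bool" where
  "arrow_le C f g \<longleftrightarrow> (\<exists>h \<in> Hom C (Cod C f) (Cod C g). g = Comp C h f)"

definition noetherian_on :: "'a set \<Rightarrow> ('a \<Rightarrow> 'a \<Rightarrow> bool) \<Rightarrow> bool" where
  "noetherian_on S leq \<longleftrightarrow> (\<forall>f :: nat \<Rightarrow> 'a. range f \<subseteq> S \<longrightarrow> (\<exists>i j. i < j \<and> leq (f i) (f j)))"

definition admissible_order :: "('o, 'm) category \<Rightarrow> 'o set \<Rightarrow> 'o \<Rightarrow> 'm rel \<Rightarrow> bool" where
  "admissible_order C I x r \<longleftrightarrow>
    linear_order_on (arrows_from C I x) r \<and>
    (\<forall>y \<in> I. \<forall>z \<in> I. \<forall>f \<in> Hom C x y. \<forall>g \<in> Hom C x y. \<forall>h \<in> Hom C y z.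
      (f, g) \<in> r \<longrightarrow> (Comp C h f, Comp C h g) \<in> r) \<and>
    (\<forall>y \<in> I. well_order_on (Hom C x y) (Restr r (Hom C x y)))"

text \<open>A system of representatives \<open>I\<close> always exists, and the condition does not depend on its
  choice, since conjugation by isomorphisms transports the orders.\<close>

definition groebner :: "('o, 'm) category \<Rightarrow> bool" where
  "groebner C \<longleftrightarrow> category C \<and>
    (\<exists>I. iso_representatives C I \<and>
      (\<forall>x \<in> Obj C. noetherian_on (arrows_from C I x) (arrow_le C) \<and>
        (\<exists>r. admissible_order C I x r)))"

text \<open>HOL cannot quantify over types, so the Groebner category \<open>C'\<close> is sought in the universe
  (types of objects and arrows) of \<open>C\<close>. When these types are infinite this is no restriction: a
  larger \<open>C'\<close> can be cut down to a subcategory of cardinality at most that of \<open>C\<close> (or countable)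
  by closing under the witnesses for (F), for essential surjectivity and for \<open>\<preceq>\<close>.\<close>

definition quasi_groebner :: "('o, 'm) category \<Rightarrow> bool" where
  "quasi_groebner C \<longleftrightarrow>
    (\<exists>(C' :: ('o, 'm) category) FO FM. groebner C' \<and> cat_functor C' C FO FM \<and>
      essentially_surjective C' C FO \<and> property_F C' C FO FM)"


section \<open>The category of ordered-basis free modules\<close>

text \<open>The locale \<open>module\<close> of HOL-Algebra requires a commutative ring; here the ring is arbitrary.\<close>

locale left_module = R?: ring R + M?: abelian_group M
  for R :: "('r, 'x) ring_scheme" (structure) and M :: "('r, 'v, 'y) module_scheme" (structure) +
  assumes smult_closed: "a \<in> carrier R \<Longrightarrow> x \<in> carrier M \<Longrightarrow> a \<odot>\<^bsub>M\<^esub> x \<in> carrier M"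
    and smult_l_distr: "a \<in> carrier R \<Longrightarrow> b \<in> carrier R \<Longrightarrow> x \<in> carrier M \<Longrightarrow>
      (a \<oplus>\<^bsub>R\<^esub> b) \<odot>\<^bsub>M\<^esub> x = a \<odot>\<^bsub>M\<^esub> x \<oplus>\<^bsub>M\<^esub> b \<odot>\<^bsub>M\<^esub> x"
    and smult_r_distr: "a \<in> carrier R \<Longrightarrow> x \<in> carrier M \<Longrightarrow> y \<in> carrier M \<Longrightarrow>
      a \<odot>\<^bsub>M\<^esub> (x \<oplus>\<^bsub>M\<^esub> y) = a \<odot>\<^bsub>M\<^esub> x \<oplus>\<^bsub>M\<^esub> a \<odot>\<^bsub>M\<^esub> y"
    and smult_assoc1: "a \<in> carrier R \<Longrightarrow> b \<in> carrier R \<Longrightarrow> x \<in> carrier M \<Longrightarrow>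
      (a \<otimes>\<^bsub>R\<^esub> b) \<odot>\<^bsub>M\<^esub> x = a \<odot>\<^bsub>M\<^esub> (b \<odot>\<^bsub>M\<^esub> x)"
    and smult_one: "x \<in> carrier M \<Longrightarrow> \<one>\<^bsub>R\<^esub> \<odot>\<^bsub>M\<^esub> x = x"

lemma module_iff_left_module: "module R M \<longleftrightarrow> cring R \<and> left_module R M"
  by (auto simp: module_def module_axioms_def left_module_def left_module_axioms_def
      cring.axioms(1))

definition linear_maps ::
    "('r, 'x) ring_scheme \<Rightarrow> ('r, 'v, 'y) module_scheme \<Rightarrow> ('r, 'w, 'z) module_scheme \<Rightarrow> ('v \<Rightarrow> 'w) set"
  where
  "linear_maps R V W =
    {f \<in> carrier V \<rightarrow> carrier W.
      (\<forall>x \<in> carrier V. \<forall>y \<in> carrier V. f (x \<oplus>\<^bsub>V\<^esub> y) = f x \<oplus>\<^bsub>W\<^esub> f y) \<and>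
      (\<forall>a \<in> carrier R. \<forall>x \<in> carrier V. f (a \<odot>\<^bsub>V\<^esub> x) = a \<odot>\<^bsub>W\<^esub> f x)}"

text \<open>A module together with a family of vectors indexed by an ordered set;
  \<open>(i, j) \<in> Ord V\<close> means \<open>i \<le> j\<close>.\<close>

record ('r, 'v, 'i) based_module = "('r, 'v) module" +
  Idx :: "'i set"
  Ord :: "'i rel"
  Bas :: "'i \<Rightarrow> 'v"

definition finite_basis :: "('r, 'x) ring_scheme \<Rightarrow> ('r, 'v, 'y) module_scheme \<Rightarrow> 'i set \<Rightarrow> ('i \<Rightarrow> 'v) \<Rightarrow> bool"
  where
  "finite_basis R V I v \<longleftrightarrow> finite I \<and> v \<in> I \<rightarrow> carrier V \<and>
    (\<forall>x \<in> carrier V. \<exists>!c. c \<in> I \<rightarrow>\<^sub>E carrier R \<and> x = (\<Oplus>\<^bsub>V\<^esub>i\<in>I. c i \<odot>\<^bsub>V\<^esub> v i))"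

definition OVI_obj :: "('r, 'x) ring_scheme \<Rightarrow> ('r, 'v, 'i) based_module set" where
  "OVI_obj R = {V. left_module R V \<and> linear_order_on (Idx V) (Ord V) \<and>
    finite_basis R V (Idx V) (Bas V)}"

text \<open>Maps are taken extensional, so that equality of morphisms is equality on the carrier and on
  the index set.\<close>

definition OVI_hom :: "('r, 'x) ring_scheme \<Rightarrow> ('r, 'v, 'i) based_module \<Rightarrow> ('r, 'v, 'i) based_module \<Rightarrow>
    (('v \<Rightarrow> 'v) \<times> ('i \<Rightarrow> 'i)) set" where
  "OVI_hom R V W =
    {(f, f0). f \<in> linear_maps R V W \<and> f \<in> extensional (carrier V) \<and>
      f0 \<in> Idx V \<rightarrow>\<^sub>E Idx W \<and> inj_on f0 (Idx V) \<and>
      (\<forall>i \<in> Idx V. \<forall>i' \<in> Idx V. (i, i') \<in> Ord V \<longrightarrow> (f0 i, f0 i') \<in> Ord W) \<and>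
      (\<forall>i \<in> Idx V. \<exists>a.
        let J = {j \<in> Idx W. (j, f0 i) \<in> Ord W \<and> j \<noteq> f0 i} in
        a \<in> J \<rightarrow> carrier R \<and>
        f (Bas V i) = Bas W (f0 i) \<oplus>\<^bsub>W\<^esub> (\<Oplus>\<^bsub>W\<^esub>j\<in>J. a j \<odot>\<^bsub>W\<^esub> Bas W j))}"

type_synonym ('r, 'v, 'i) OVI_arrow =
  "('r, 'v, 'i) based_module \<times> (('v \<Rightarrow> 'v) \<times> ('i \<Rightarrow> 'i)) \<times> ('r, 'v, 'i) based_module"

text \<open>Arrows are triples (source, morphism, target). The modules have carriers in \<open>'v\<close> and the
  bases are indexed by subsets of \<open>'i\<close>. If \<open>'i\<close> is infinite and \<open>'v\<close> is infinite (for finite \<open>R\<close>;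
  in general, large enough to hold every \<open>R\<^sup>n\<close>), every object is represented up to isomorphism.\<close>

definition OVI :: "('r, 'x) ring_scheme \<Rightarrow>
    (('r, 'v, 'i) based_module, ('r, 'v, 'i) OVI_arrow) category" where
  "OVI R =
    \<lparr>Obj = OVI_obj R,
     Arr = {(V, \<phi>, W). V \<in> OVI_obj R \<and> W \<in> OVI_obj R \<and> \<phi> \<in> OVI_hom R V W},
     Dom = (\<lambda>(V, \<phi>, W). V),
     Cod = (\<lambda>(V, \<phi>, W). W),
     Id = (\<lambda>V. (V, (\<lambda>x \<in> carrier V. x, \<lambda>i \<in> Idx V. i), V)),
     Comp = (\<lambda>(V', (g, g0), W) (U, (f, f0), V).
       (U, (compose (carrier U) g f, compose (Idx U) g0 f0), W))\<rparr>"


section \<open>Modules over a category\<close>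

record ('o, 'm, 'k, 'a) cat_module =
  At :: "'o \<Rightarrow> ('k, 'a) module"
  Act :: "'m \<Rightarrow> 'a \<Rightarrow> 'a"

text \<open>Functors from \<open>C\<close> to \<open>k\<close>-modules with carriers in \<open>'a\<close>. The values of \<open>Act M f\<close> outside the
  carrier are irrelevant.\<close>

locale cat_module = category C + k: cring k
  for k :: "('k, 'x) ring_scheme" and C :: "('o, 'm) category" +
  fixes M :: "('o, 'm, 'k, 'a) cat_module"
  assumes At_module: "x \<in> Obj C \<Longrightarrow> module k (At M x)"
    and Act_linear: "f \<in> Hom C x y \<Longrightarrow> Act M f \<in> linear_maps k (At M x) (At M y)"
    and Act_Id: "x \<in> Obj C \<Longrightarrow> u \<in> carrier (At M x) \<Longrightarrow> Act M (Id C x) u = u"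
    and Act_Comp: "f \<in> Hom C x y \<Longrightarrow> g \<in> Hom C y z \<Longrightarrow> u \<in> carrier (At M x) \<Longrightarrow>
      Act M (Comp C g f) u = Act M g (Act M f u)"

definition cat_module_hom :: "('k, 'x) ring_scheme \<Rightarrow> ('o, 'm) category \<Rightarrow>
    ('o, 'm, 'k, 'a) cat_module \<Rightarrow> ('o, 'm, 'k, 'b) cat_module \<Rightarrow> ('o \<Rightarrow> 'a \<Rightarrow> 'b) \<Rightarrow> bool" where
  "cat_module_hom k C M N \<phi> \<longleftrightarrow>
    (\<forall>x \<in> Obj C. \<phi> x \<in> linear_maps k (At M x) (At N x)) \<and>
    (\<forall>x \<in> Obj C. \<forall>y \<in> Obj C. \<forall>f \<in> Hom C x y. \<forall>u \<in> carrier (At M x).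
      \<phi> y (Act M f u) = Act N f (\<phi> x u))"

definition is_quotient_of :: "('k, 'x) ring_scheme \<Rightarrow> ('o, 'm) category \<Rightarrow>
    ('o, 'm, 'k, 'b) cat_module \<Rightarrow> ('o, 'm, 'k, 'a) cat_module \<Rightarrow> bool" where
  "is_quotient_of k C N M \<longleftrightarrow>
    (\<exists>\<phi>. cat_module_hom k C M N \<phi> \<and>
      (\<forall>x \<in> Obj C. \<phi> x ` carrier (At M x) = carrier (At N x)))"

text \<open>The free module \<open>k[S]\<close>, as finitely supported functions vanishing off \<open>S\<close>. The
  multiplicative fields of a module record play no role.\<close>

definition free_module :: "('k, 'x) ring_scheme \<Rightarrow> 's set \<Rightarrow> ('k, 's \<Rightarrow> 'k) module" where
  "free_module k S =
    \<lparr>carrier = {c. (\<forall>s. c s \<in> carrier k) \<and> (\<forall>s. s \<notin> S \<longrightarrow> c s = \<zero>\<^bsub>k\<^esub>) \<and> finite {s. c s \<noteq> \<zero>\<^bsub>k\<^esub>}},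
     mult = undefined, one = undefined,
     zero = (\<lambda>s. \<zero>\<^bsub>k\<^esub>),
     add = (\<lambda>c d s. c s \<oplus>\<^bsub>k\<^esub> d s),
     smult = (\<lambda>a c s. a \<otimes>\<^bsub>k\<^esub> c s)\<rparr>"

text \<open>The module \<open>P\<^sub>x\<close>: an arrow \<open>f\<close> sends the basis element \<open>g\<close> to \<open>f g\<close>.\<close>

definition principal_module :: "('k, 'x) ring_scheme \<Rightarrow> ('o, 'm) category \<Rightarrow> 'o \<Rightarrow>
    ('o, 'm, 'k, 'm \<Rightarrow> 'k) cat_module" where
  "principal_module k C x =
    \<lparr>At = (\<lambda>y. free_module k (Hom C x y)),
     Act = (\<lambda>f c h. \<Oplus>\<^bsub>k\<^esub>g \<in> {g \<in> Hom C x (Dom C f). c g \<noteq> \<zero>\<^bsub>k\<^esub> \<and> Comp C f g = h}. c g)\<rparr>"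

definition direct_sum :: "('o, 'm, 'k, 'a) cat_module list \<Rightarrow> ('o, 'm, 'k, nat \<Rightarrow> 'a) cat_module" where
  "direct_sum Ms =
    \<lparr>At = (\<lambda>x.
      \<lparr>carrier = (\<Pi>\<^sub>E n \<in> {..<length Ms}. carrier (At (Ms ! n) x)),
       mult = undefined, one = undefined,
       zero = (\<lambda>n \<in> {..<length Ms}. \<zero>\<^bsub>At (Ms ! n) x\<^esub>),
       add = (\<lambda>u v. \<lambda>n \<in> {..<length Ms}. u n \<oplus>\<^bsub>At (Ms ! n) x\<^esub> v n),
       smult = (\<lambda>a u. \<lambda>n \<in> {..<length Ms}. a \<odot>\<^bsub>At (Ms ! n) x\<^esub> u n)\<rparr>),
     Act = (\<lambda>f u. \<lambda>n \<in> {..<length Ms}. Act (Ms ! n) f (u n))\<rparr>"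

definition finitely_generated :: "('k, 'x) ring_scheme \<Rightarrow> ('o, 'm) category \<Rightarrow>
    ('o, 'm, 'k, 'a) cat_module \<Rightarrow> bool" where
  "finitely_generated k C M \<longleftrightarrow>
    (\<exists>xs. set xs \<subseteq> Obj C \<and> is_quotient_of k C M (direct_sum (map (principal_module k C) xs)))"

definition cat_submodule :: "('k, 'x) ring_scheme \<Rightarrow> ('o, 'm) category \<Rightarrow>
    ('o, 'm, 'k, 'a) cat_module \<Rightarrow> ('o \<Rightarrow> 'a set) \<Rightarrow> bool" where
  "cat_submodule k C M N \<longleftrightarrow>
    (\<forall>x \<in> Obj C. submodule (N x) k (At M x)) \<and>
    (\<forall>x \<in> Obj C. \<forall>y \<in> Obj C. \<forall>f \<in> Hom C x y. Act M f ` N x \<subseteq> N y)"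

definition restrict_module :: "('o, 'm, 'k, 'a) cat_module \<Rightarrow> ('o \<Rightarrow> 'a set) \<Rightarrow>
    ('o, 'm, 'k, 'a) cat_module" where
  "restrict_module M N = M\<lparr>At := (\<lambda>x. (At M x)\<lparr>carrier := N x\<rparr>)\<rparr>"

text \<open>The type argument is the universe in which the \<open>C\<close>-modules take their values.\<close>

definition locally_noetherian :: "'a itself \<Rightarrow> ('k, 'x) ring_scheme \<Rightarrow> ('o, 'm) category \<Rightarrow> bool" where
  "locally_noetherian (_ :: 'a itself) k C \<longleftrightarrow>
    (\<forall>M :: ('o, 'm, 'k, 'a) cat_module. cat_module k C M \<and> finitely_generated k C M \<longrightarrow>
      (\<forall>N. cat_submodule k C M N \<longrightarrow> finitely_generated k C (restrict_module M N)))"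

end

theory Submission
  imports Defs "HOL-Library.Infinite_Set" "HOL-Library.Nat_Bijection"
begin

text \<open>A morphism of \<open>OVI(R)\<close> out of a module of rank \<open>n\<close> is a matrix whose rows are linear forms. If
  \<open>R\<close> is finite, there are finitely many possible rows, so deleting all but the last occurrence of each
  row leaves one of finitely many matrices, and the original matrix is recovered by repeating rows.
  Row repetitions are words \<open>w\<close> over \<open>{0, \<dots>, n-1}\<close> in which every letter occurs and the last
  occurrences appear in increasing order. They form a category (opposite to ordered surjections) mapping
  to \<open>OVI(R)\<close> with property (F). It is Groebner: noetherianity is a variant of Higman's lemma, and words
  are ordered lexicographically from the right. Local noetherianity follows by the proof of the
  Hilbert basis theorem, run with leading terms in this order.\<close>

section \<open>Words with ordered last occurrences\<close>

text \<open>Unitriangularity forces the choice of last occurrences. In the matrix of a morphism the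
  row \<open>f0 i\<close> has entry 1 at the basis vector \<open>i\<close>, and every later row has
  entry 0 there; so this pivot row is not repeated further down and survives when earlier copies are
  deleted. Keeping first occurrences could leave rows with a nonzero entry at \<open>i\<close> below
  the pivot. Numbering the retained rows from top to bottom makes the last occurrences in the word
  increase, and the same ordering makes the comparison of words from the right compatible with
  substitution.

  The number of retained rows is bounded in terms of the source module alone, which is what (F)
  demands. For local noetherianity a module over the target category is pulled back to words: (F)
  keeps the pullback finitely generated, the leading-term argument treats its submodules there, and
  essential surjectivity carries generators back.\<close>

text \<open>\<open>remdups\<close> decides about a letter by what stands to its right, so
  \<open>remdups ys\<close> is a suffix of \<open>remdups (xs @ ys)\<close>, and sortedness passes
  to suffixes.\<close>

lemma sorted_remdups_suffix:
  "sorted_wrt (<) (remdups (xs @ ys)) \<Longrightarrow> sorted_wrt (<) (remdups ys)"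
  by (induction xs) (simp_all split: if_splits)

text \<open>The displayed \<open>j\<close> is a last occurrence, and the last occurrence of
  \<open>k\<close> is further right. Comparisons of words and of pivots use the order of last
  occurrences in this form.\<close>

lemma remdups_upt_later:
  assumes "remdups (xs @ j # ys) = [0..<n]" "j \<notin> set ys" "k \<in> set ys"
  shows "j < k"
proof -
  have "sorted_wrt (<) (remdups (j # ys))"
    by (rule sorted_remdups_suffix[of xs]) (simp only: assms(1) sorted_wrt_upt)
  with assms(2,3) show ?thesis by simp
qed

text \<open>Since \<^const>\<open>remdups\<close> keeps last occurrences, \<open>ordered_word n w\<close> below says that \<open>w\<close> is a surjection
  onto \<open>{..<n}\<close> with increasing last occurrences; \<open>word_comp v w\<close> is the composite
  \<open>w \<circ> v\<close> of the surjections.\<close>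

definition word_comp :: "nat list \<Rightarrow> nat list \<Rightarrow> nat list" where
  "word_comp v w = map ((!) w) v"

definition ordered_word :: "nat \<Rightarrow> nat list \<Rightarrow> bool" where
  "ordered_word n w \<longleftrightarrow> remdups w = [0..<n]"

lemma ordered_wordD:
  assumes "ordered_word n w"
  shows "set w = {..<n}" "length (remdups w) = n" "n \<le> length w"
proof -
  have r: "remdups w = [0..<n]" using assms by (simp add: ordered_word_def)
  then show "length (remdups w) = n" by simp
  from r have "set (remdups w) = {..<n}" by auto
  then show "set w = {..<n}" by simp
  from length_remdups_leq[of w] r show "n \<le> length w" by simp
qed

lemma length_word_comp [simp]: "length (word_comp v w) = length v"
  by (simp add: word_comp_def)

text \<open>Reducing \<open>v\<close> before the lookup does not change the reduction of the result,
  and \<open>v\<close> reduces to the identity word, whose lookup returns \<open>w\<close>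
  itself.\<close>

lemma ordered_word_comp:
  assumes "ordered_word n w" "ordered_word (length w) v"
  shows "ordered_word n (word_comp v w)"
proof -
  have "remdups (map ((!) w) v) = remdups (map ((!) w) (remdups v))"
    by (simp add: remdups_map_remdups)
  also have "\<dots> = remdups w"
    using assms(2) by (simp add: ordered_word_def map_nth)
  finally show ?thesis using assms(1) by (simp add: ordered_word_def word_comp_def)
qed

lemma word_comp_assoc:
  assumes "ordered_word (length v) u"
  shows "word_comp u (word_comp v w) = word_comp (word_comp u v) w"
  using ordered_wordD(1)[OF assms] by (simp add: word_comp_def)

lemma word_comp_id_right:
  assumes "ordered_word n w"
  shows "word_comp w [0..<n] = w"
  unfolding word_comp_def by (rule map_idI) (simp add: ordered_wordD(1)[OF assms])

lemma word_comp_id_left: "word_comp [0..<length w] w = w"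
  by (simp add: word_comp_def map_nth)

text \<open>\<open>emb u w\<close> means that \<open>w\<close> is a composite \<open>u \<circ> v\<close>: an inserted letter must occur again
  later, so that it does not change the last occurrences.\<close>

inductive emb :: "'a list \<Rightarrow> 'a list \<Rightarrow> bool" where
  Nil: "emb [] []"
| Cons: "emb u w \<Longrightarrow> emb (a # u) (a # w)"
| Insert: "emb u w \<Longrightarrow> a \<in> set u \<Longrightarrow> emb u (a # w)"

lemma emb_set_eq: "emb u w \<Longrightarrow> set u = set w"
  by (induction rule: emb.induct) auto

text \<open>The factor \<open>v\<close> is built from the right. A matched letter shifts all
  positions by one and puts 0 in front. An inserted letter puts in front any position of
  \<open>u\<close> that holds it; this position already occurs in \<open>v\<close>, since
  \<open>v\<close> is onto, so the reduction of \<open>v\<close> is unchanged.\<close>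

lemma emb_imp_factor: "emb u w \<Longrightarrow> \<exists>v. ordered_word (length u) v \<and> w = word_comp v u"
proof (induction rule: emb.induct)
  case Nil
  show ?case by (simp add: ordered_word_def word_comp_def)
next
  case (Cons u w a)
  then obtain v where v: "remdups v = [0..<length u]" "w = map ((!) u) v"
    by (auto simp: ordered_word_def word_comp_def)
  have "remdups (map Suc v) = map Suc (remdups v)"
    by (induction v) auto
  with v have "remdups (0 # map Suc v) = [0..<length (a # u)]"
    by (auto simp: map_Suc_upt upt_conv_Cons simp del: upt_Suc)
  moreover have "a # w = map ((!) (a # u)) (0 # map Suc v)"
    using v by simp
  ultimately show ?case by (metis ordered_word_def word_comp_def)
next
  case (Insert u w a)
  then obtain v where v: "ordered_word (length u) v" "w = map ((!) u) v"
    by (auto simp: word_comp_def)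
  obtain j where j: "j < length u" "u ! j = a"
    using Insert by (auto simp: in_set_conv_nth)
  then have "j \<in> set v" using ordered_wordD(1)[OF v(1)] by simp
  then have "ordered_word (length u) (j # v)"
    using v by (simp add: ordered_word_def)
  moreover have "a # w = word_comp (j # v) u"
    using v j by (simp add: word_comp_def)
  ultimately show ?case by blast
qed

section \<open>Minimal bad sequences and a Higman lemma for \<open>emb\<close>\<close>

definition good :: "(nat \<Rightarrow> 'a list) \<Rightarrow> bool" where
  "good f \<longleftrightarrow> (\<exists>i j. i < j \<and> emb (f i) (f j))"

text \<open>Nash-Williams: a prefix that has a bad continuation over \<open>A\<close> (predicate
  \<open>B\<close>) is extended by a shortest word that preserves this property. A related pair in
  the limit sequence would already lie in one of its prefixes, hence in a bad sequence. All
  competitors are kept over the alphabet \<open>A\<close> so that an induction on alphabets can use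
  the result.\<close>

lemma minimal_bad_sequence:
  assumes bad: "\<not> good f" and A: "\<And>i. set (f i) \<subseteq> A"
  obtains g where "\<not> good g" "\<And>i. set (g i) \<subseteq> A"
    "\<And>n h. (\<And>i. i < n \<Longrightarrow> h i = g i) \<Longrightarrow> (\<And>i. set (h i) \<subseteq> A) \<Longrightarrow> length (h n) < length (g n) \<Longrightarrow> good h"
proof -
  define B where "B p \<longleftrightarrow> (\<exists>h. \<not> good h \<and> (\<forall>i. set (h i) \<subseteq> A) \<and> (\<forall>i < length p. h i = p ! i))"
    for p :: "'a list list"
  define next_word where "next_word p = (ARG_MIN length x. B (p @ [x]))" for p
  define P where "P n = ((\<lambda>p. p @ [next_word p]) ^^ n) []" for n
  have next_word: "B (p @ [next_word p]) \<and> (\<forall>x. B (p @ [x]) \<longrightarrow> length (next_word p) \<le> length x)"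
    if "B p" for p
  proof -
    from that obtain h where h: "\<not> good h" "\<And>i. set (h i) \<subseteq> A" "\<And>i. i < length p \<Longrightarrow> h i = p ! i"
      unfolding B_def by blast
    then have "B (p @ [h (length p)])"
      unfolding B_def by (intro exI[of _ h]) (simp add: nth_append less_Suc_eq)
    then show ?thesis unfolding next_word_def by (rule arg_min_nat_lemma[where P = "\<lambda>x. B (p @ [x])"])
  qed
  have P_Suc: "P (Suc n) = P n @ [next_word (P n)]" for n by (simp add: P_def)
  have len: "length (P n) = n" for n by (induction n) (simp_all add: P_Suc, simp add: P_def)
  have BP: "B (P n)" for n
  proof (induction n)
    case 0
    have "P 0 = []" by (simp add: P_def)
    with bad A show ?case unfolding B_def by (intro exI[of _ f]) simp
  next
    case (Suc n) then show ?case using next_word by (simp add: P_Suc)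
  qed
  define g where "g n = next_word (P n)" for n
  have nth: "i < n \<Longrightarrow> P n ! i = g i" for i n
    by (induction n) (auto simp: P_Suc nth_append len less_Suc_eq g_def)
  show ?thesis
  proof (rule that[of g])
    show "\<not> good g"
    proof
      assume "good g"
      then obtain i j where ij: "i < j" "emb (g i) (g j)" by (auto simp: good_def)
      obtain h where h: "\<not> good h" "\<And>k. k < Suc j \<Longrightarrow> h k = P (Suc j) ! k"
        using BP[of "Suc j"] unfolding B_def len by blast
      then have "emb (h i) (h j)" using ij by (simp add: nth)
      with h(1) ij(1) show False unfolding good_def by blast
    qed
    show "set (g i) \<subseteq> A" for i
    proof -
      obtain h where "\<forall>k. set (h k) \<subseteq> A" "\<forall>k < Suc i. h k = P (Suc i) ! k"
        using BP[of "Suc i"] unfolding B_def len by blast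
      then show ?thesis by (metis lessI nth)
    qed
    show "good h" if "\<And>i. i < n \<Longrightarrow> h i = g i" "\<And>i. set (h i) \<subseteq> A" "length (h n) < length (g n)" for n h
    proof (rule ccontr)
      assume "\<not> good h"
      then have "B (P n @ [h n])"
        unfolding B_def using that(1,2) by (intro exI[of _ h]) (simp add: nth_append len nth less_Suc_eq)
      with next_word[OF BP[of n]] have "length (g n) \<le> length (h n)" by (simp add: g_def)
      with that(3) show False by simp
    qed
  qed
qed

lemma set_tl_subset: "set (tl xs) \<subseteq> set xs"
  by (cases xs) auto

text \<open>Induction on the alphabet: in a minimal bad sequence infinitely many words start with the same
  letter \<open>a\<close>. If \<open>a\<close> recurs in infinitely many of their tails, then minimality applies to these
  tails; otherwise infinitely many tails are words over a smaller alphabet.\<close>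

lemma emb_good:
  assumes "finite A" "\<And>i. set (f i) \<subseteq> A"
  shows "good f"
  using assms
proof (induction A arbitrary: f rule: finite_psubset_induct)
  case (psubset A)
  show ?case
  proof (rule ccontr)
    assume "\<not> good f"
    from minimal_bad_sequence[OF this psubset.prems]
    obtain g where g: "\<not> good g" "\<And>i. set (g i) \<subseteq> A"
      and min: "\<And>n h. (\<And>i. i < n \<Longrightarrow> h i = g i) \<Longrightarrow> (\<And>i. set (h i) \<subseteq> A) \<Longrightarrow>
        length (h n) < length (g n) \<Longrightarrow> good h"
      by metis
    have bad: "\<not> emb (g i) (g j)" if "i < j" for i j using that g(1) by (auto simp: good_def)
    have inf: "infinite {i. g i \<noteq> []}"
    proof
      assume "finite {i. g i \<noteq> []}"
      moreover have "{i. g i \<noteq> []} \<union> {i. g i = []} = UNIV" by blast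
      ultimately have "infinite {i. g i = []}" by (metis finite_UnI infinite_UNIV_nat)
      then obtain i j where "i < j" "g i = []" "g j = []"
        unfolding infinite_nat_iff_unbounded by blast
      with bad[of i j] show False by (simp add: emb.Nil)
    qed
    have "(\<lambda>i. hd (g i)) ` {i. g i \<noteq> []} \<subseteq> A"
      using g(2) hd_in_set by blast
    then have "finite ((\<lambda>i. hd (g i)) ` {i. g i \<noteq> []})"
      using psubset.hyps finite_subset by blast
    from pigeonhole_infinite[OF inf this]
    obtain i0 where "infinite {i \<in> {i. g i \<noteq> []}. hd (g i) = hd (g i0)}" by auto
    then obtain a where a: "infinite {i. g i \<noteq> [] \<and> hd (g i) = a}" by auto
    define S where "S = {i. g i \<noteq> [] \<and> hd (g i) = a \<and> a \<in> set (tl (g i))}"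
    define T where "T = {i. g i \<noteq> [] \<and> hd (g i) = a \<and> a \<notin> set (tl (g i))}"
    have "{i. g i \<noteq> [] \<and> hd (g i) = a} = S \<union> T" by (auto simp: S_def T_def)
    with a have "infinite S \<or> infinite T" by (metis finite_UnI)
    have Cons_tl: "g i = a # tl (g i)" if "i \<in> S \<union> T" for i
      using that by (auto simp: S_def T_def)
    show False
    proof (cases "infinite T")
      case True
      define e where "e = enumerate T"
      have e: "e i \<in> T" "strict_mono e" for i
        using True by (auto simp: e_def enumerate_in_set strict_mono_enumerate)
      have "a \<in> A" using e(1)[of 0] Cons_tl[of "e 0"] g(2)[of "e 0"] by (metis UnCI list.set_intros(1) subsetD)
      then have "A - {a} \<subset> A" by auto
      moreover have "set (tl (g (e i))) \<subseteq> A - {a}" for i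
        using e(1)[of i] g(2)[of "e i"] Cons_tl[of "e i"]
        by (auto simp: T_def) (metis list.set_sel(2) subsetD)
      ultimately have "good (\<lambda>i. tl (g (e i)))" by (rule psubset.IH)
      then obtain i j where ij: "i < j" "emb (tl (g (e i))) (tl (g (e j)))" by (auto simp: good_def)
      then have "emb (g (e i)) (g (e j))"
        using emb.Cons[of _ _ a] e(1) Cons_tl by (metis UnCI)
      with bad[of "e i" "e j"] ij e(2) show False by (simp add: strict_mono_less)
    next
      case False
      then have infS: "infinite S" using \<open>infinite S \<or> infinite T\<close> by simp
      define e where "e = enumerate S"
      have e: "e i \<in> S" "strict_mono e" for i
        using infS by (auto simp: e_def enumerate_in_set strict_mono_enumerate)
      \<comment> \<open>The words from position \<open>e 0\<close> on are replaced by the tails of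
        the words with index in \<open>S\<close>. Then \<open>h\<close> agrees with \<open>g\<close>
        below \<open>e 0\<close> and has a shorter word there, so minimality makes it good.\<close>
      define h where "h i = (if i < e 0 then g i else tl (g (e (i - e 0))))" for i
      have "good h"
      proof (rule min[of "e 0"])
        show "set (h i) \<subseteq> A" for i
          using g(2)[of i] g(2)[of "e (i - e 0)"] set_tl_subset[of "g (e (i - e 0))"]
          by (cases "i < e 0") (simp_all add: h_def subset_trans)
        show "length (h (e 0)) < length (g (e 0))"
          using e(1)[of 0] by (auto simp: h_def S_def)
      qed (simp add: h_def)
      then obtain i j where ij: "i < j" "emb (h i) (h j)" by (auto simp: good_def)
      consider "j < e 0" | "i < e 0" "e 0 \<le> j" | "e 0 \<le> i" using ij by linarith
      then show False
      proof cases
        case 1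
        with ij bad[of i j] show ?thesis by (simp add: h_def)
      next
        case 2
        let ?j = "e (j - e 0)"
        have emb: "emb (g i) (tl (g ?j))" using 2 ij by (simp add: h_def)
        \<comment> \<open>The letter removed from the word at \<open>?j\<close> recurs in its tail,
          hence in \<open>g i\<close>, because embedded words have the same letters. It can
          therefore be inserted again.\<close>
        have "a \<in> set (tl (g ?j))" using e(1) by (simp add: S_def)
        then have "a \<in> set (g i)" using emb_set_eq[OF emb] by simp
        from emb.Insert[OF emb this] have "emb (g i) (g ?j)"
          using Cons_tl[of ?j] e(1) by simp
        moreover have "e 0 \<le> ?j" using e(2) by (simp add: strict_mono_less_eq)
        ultimately show ?thesis using bad[of i ?j] 2 by simp
      next
        case 3
        let ?i = "e (i - e 0)" and ?j = "e (j - e 0)"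
        have "emb (tl (g ?i)) (tl (g ?j))" using 3 ij by (simp add: h_def)
        then have "emb (g ?i) (g ?j)" using emb.Cons[of _ _ a] e(1) Cons_tl by (metis UnCI)
        moreover have "?i < ?j" using e(2) 3 ij by (simp add: strict_mono_less)
        ultimately show ?thesis using bad by blast
      qed
    qed
  qed
qed

section \<open>A well-founded order on words\<close>

text \<open>Length comes first, which makes the relation well-founded on all words at once.
  Compatibility with composition is not affected: it concerns words in one Hom set, and these have
  equal length.\<close>

definition word_less :: "nat list rel" where
  "word_less = inv_image (lenlex less_than) rev"

lemma wf_word_less: "wf word_less"
  unfolding word_less_def by (intro wf_inv_image wf_lenlex wf_less_than)

lemma trans_word_less: "trans word_less"
  unfolding word_less_def by (intro trans_inv_image lenlex_transI trans_less_than)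

lemma total_word_less: "total word_less"
  unfolding word_less_def
  by (intro total_inv_image injI total_lenlex) (auto simp: total_less_than)

text \<open>Substitution preserves the order since the last place where the results differ is the last
  occurrence in \<open>v\<close> of the last place where the words differ.\<close>

lemma word_less_comp:
  assumes "length w = length w'" "(w, w') \<in> word_less" "ordered_word (length w) v"
  shows "(word_comp v w, word_comp v w') \<in> word_less"
proof -
  have "(rev w, rev w') \<in> lex less_than"
    using assms by (auto simp: word_less_def lenlex_conv)
  then obtain zs x y xs ys where
    r: "rev w = zs @ x # xs" "rev w' = zs @ y # ys" "x < y"
    by (auto simp: lex_conv)
  define j where "j = length xs"
  have w: "w = rev xs @ x # rev zs" "w' = rev ys @ y # rev zs"
    using arg_cong[OF r(1), of rev] arg_cong[OF r(2), of rev] by simp_all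
  have j: "length ys = j" "j < length w" using assms(1) w by (simp_all add: j_def)
  have "j \<in> set v" using ordered_wordD(1)[OF assms(3)] j by simp
  then obtain as bs where v: "v = as @ j # bs" "j \<notin> set bs"
    by (metis split_list_last)
  \<comment> \<open>To the right of the last \<open>j\<close> the word \<open>v\<close> only has
    letters above \<open>j\<close>, and these are positions at which \<open>w\<close> and
    \<open>w'\<close> agree.\<close>
  have bs: "j < k" if "k \<in> set bs" for k
    using remdups_upt_later[of as j bs "length w" k] v assms(3) that by (simp add: ordered_word_def)
  have "map ((!) w) bs = map ((!) w') bs"
    using j by (auto simp: w nth_append nth_Cons j_def dest!: bs split: nat.splits)
  moreover have "w ! j = x" "w' ! j = y" using j by (auto simp: w nth_append j_def)
  ultimately have "rev (word_comp v w) = rev (map ((!) w) bs) @ x # rev (map ((!) w) as)"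
    "rev (word_comp v w') = rev (map ((!) w) bs) @ y # rev (map ((!) w') as)"
    by (simp_all add: word_comp_def v)
  then have "(rev (word_comp v w), rev (word_comp v w')) \<in> lex less_than"
    using r(3) unfolding lex_conv by auto
  then show ?thesis by (simp add: word_less_def lenlex_conv)
qed

section \<open>The Groebner category of words\<close>

text \<open>Words are encoded in arbitrary types of objects and arrows, because the Groebner category
  must live in the types of the target category.\<close>

locale word_category =
  fixes eo :: "nat \<Rightarrow> 'o" and ea :: "nat list \<Rightarrow> 'm"
  assumes inj_eo: "inj eo" and inj_ea: "inj ea"
begin

text \<open>A word of length \<open>m\<close> with \<open>n\<close> distinct letters is an arrow
  from \<open>n\<close> to \<open>m\<close>, so the surjection it describes runs in the opposite
  direction. Both ends can be read off the word: the source is the number of distinct letters, the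
  target the length.\<close>

definition W :: "('o, 'm) category" where
  "W = \<lparr>Obj = range eo,
    Arr = ea ` {w. \<exists>n. ordered_word n w},
    Dom = (\<lambda>f. eo (length (remdups (inv_into UNIV ea f)))),
    Cod = (\<lambda>f. eo (length (inv_into UNIV ea f))),
    Id = (\<lambda>x. ea [0..<inv_into UNIV eo x]),
    Comp = (\<lambda>g f. ea (word_comp (inv_into UNIV ea g) (inv_into UNIV ea f)))\<rparr>"

lemma inv_ea [simp]: "inv_into UNIV ea (ea w) = w"
  by (rule inv_f_f[OF inj_ea])

lemma inv_eo [simp]: "inv_into UNIV eo (eo n) = n"
  by (rule inv_f_f[OF inj_eo])

lemma eo_eq [simp]: "eo n = eo m \<longleftrightarrow> n = m"
  by (rule inj_eq[OF inj_eo])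

lemma ea_eq [simp]: "ea v = ea w \<longleftrightarrow> v = w"
  by (rule inj_eq[OF inj_ea])

lemma Obj_W: "Obj W = range eo"
  by (simp add: W_def)

lemma Hom_W: "Hom W (eo n) (eo m) = ea ` {w. ordered_word n w \<and> length w = m}"
proof -
  have "length (remdups w) = n \<longleftrightarrow> ordered_word n w" if "ordered_word k w" for k w
    using ordered_wordD(2) that by metis
  then show ?thesis by (fastforce simp: W_def Hom_def)
qed

lemma Hom_W_cases:
  assumes "f \<in> Hom W x y"
  obtains w where "f = ea w" "ordered_word (inv_into UNIV eo x) w"
    "x = eo (inv_into UNIV eo x)" "y = eo (length w)"
proof -
  from assms obtain w n where w: "f = ea w" "ordered_word n w" "x = eo (length (remdups w))"
    "y = eo (length w)"
    by (fastforce simp: W_def Hom_def)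
  show thesis by (rule that[of w]) (use w ordered_wordD(2)[OF w(2)] in simp_all)
qed

lemma ea_in_Hom [simp]: "ea w \<in> Hom W (eo n) (eo m) \<longleftrightarrow> ordered_word n w \<and> length w = m"
  by (auto simp: Hom_W)

lemma Comp_W [simp]: "Comp W (ea v) (ea w) = ea (word_comp v w)"
  by (simp add: W_def)

lemma Id_W [simp]: "Id W (eo n) = ea [0..<n]"
  by (simp add: W_def)

lemma ordered_word_upt [simp]: "ordered_word n [0..<n]"
  by (simp add: ordered_word_def)

lemma category_W: "category W"
proof
  show "Dom W f \<in> Obj W" "Cod W f \<in> Obj W" if "f \<in> Arr W" for f
    by (simp_all add: W_def)
  show "Id W x \<in> Hom W x x" if "x \<in> Obj W" for x
  proof -
    from that obtain n where "x = eo n" by (auto simp: Obj_W)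
    then show ?thesis by simp
  qed
  fix f x y
  assume f: "f \<in> Hom W x y"
  then obtain w where w: "f = ea w" "ordered_word (inv_into UNIV eo x) w"
    "x = eo (inv_into UNIV eo x)" "y = eo (length w)" by (rule Hom_W_cases)
  show "Comp W f (Id W x) = f"
    by (subst w(3)) (simp add: w(1) word_comp_id_right[OF w(2)])
  show "Comp W (Id W y) f = f"
    by (simp add: w(1,4) word_comp_id_left)
  show "Comp W g f \<in> Hom W x z" if "g \<in> Hom W y z" for g z
  proof -
    from that obtain v where v: "g = ea v" "ordered_word (inv_into UNIV eo y) v" "z = eo (length v)"
      by (rule Hom_W_cases)
    have "ordered_word (inv_into UNIV eo x) (word_comp v w)"
      using ordered_word_comp[OF w(2)] v(2) by (simp add: w(4))
    then show ?thesis by (subst w(3)) (simp add: w(1) v(1,3))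
  qed
next
  show "Comp W h (Comp W g f) = Comp W (Comp W h g) f"
    if "f \<in> Hom W w x" "g \<in> Hom W x y" "h \<in> Hom W y z" for f g h w x y z
  proof -
    from that(2) obtain v where g: "g = ea v" "y = eo (length v)" by (rule Hom_W_cases)
    from that(3) obtain u where h: "h = ea u" "ordered_word (inv_into UNIV eo y) u" by (rule Hom_W_cases)
    from that(1) obtain t where f: "f = ea t" by (rule Hom_W_cases)
    show ?thesis using h(2) by (simp add: f g h(1) word_comp_assoc)
  qed
qed

text \<open>All arrows out of one object are words over one finite alphabet. The Higman lemma
  supplies an embedded pair, and the factor belonging to the embedding is the required
  arrow.\<close>

lemma noetherian_W:
  assumes "x \<in> Obj W"
  shows "noetherian_on (arrows_from W (Obj W) x) (arrow_le W)"
  unfolding noetherian_on_def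
proof (intro allI impI)
  fix f :: "nat \<Rightarrow> 'm"
  assume f: "range f \<subseteq> arrows_from W (Obj W) x"
  obtain n where x: "x = eo n" using assms by (auto simp: Obj_W)
  have "\<exists>w. f i = ea w \<and> ordered_word n w" for i
  proof -
    have "f i \<in> arrows_from W (Obj W) x" using f by auto
    then show ?thesis by (auto simp: arrows_from_def Obj_W Hom_W x)
  qed
  then obtain w where w: "\<And>i. f i = ea (w i)" "\<And>i. ordered_word n (w i)" by metis
  have "good w"
    by (rule emb_good[of "{..<n}"]) (simp_all add: ordered_wordD(1)[OF w(2)])
  then obtain i j where ij: "i < j" "emb (w i) (w j)" by (auto simp: good_def)
  from emb_imp_factor[OF ij(2)] obtain v where
    v: "ordered_word (length (w i)) v" "w j = word_comp v (w i)" by blast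
  have Cod: "Cod W (f k) = eo (length (w k))" for k by (simp add: W_def w)
  have "ea v \<in> Hom W (Cod W (f i)) (Cod W (f j))"
    using v by (simp add: Cod)
  moreover have "f j = Comp W (ea v) (f i)" by (simp add: w(1) v(2))
  ultimately have "arrow_le W (f i) (f j)" unfolding arrow_le_def by blast
  with ij(1) show "\<exists>i j. i < j \<and> arrow_le W (f i) (f j)" by blast
qed

definition less_W :: "'m rel" where
  "less_W = inv_image word_less (inv_into UNIV ea)"

lemma ea_less_W [simp]: "(ea v, ea w) \<in> less_W \<longleftrightarrow> (v, w) \<in> word_less"
  by (simp add: less_W_def)

lemma wf_less_W: "wf less_W"
  by (simp add: less_W_def wf_inv_image wf_word_less)

lemma trans_less_W: "trans less_W"
  by (simp add: less_W_def trans_inv_image trans_word_less)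

lemma total_less_W:
  assumes "f \<in> Hom W x y" "g \<in> Hom W x' y'" "f \<noteq> g"
  shows "(f, g) \<in> less_W \<or> (g, f) \<in> less_W"
proof -
  from assms(1) obtain v where v: "f = ea v" by (rule Hom_W_cases)
  from assms(2) obtain w where w: "g = ea w" by (rule Hom_W_cases)
  show ?thesis using assms(3) total_word_less by (auto simp: v w total_on_def)
qed

lemma less_W_Comp:
  assumes "f \<in> Hom W x y" "g \<in> Hom W x y" "h \<in> Hom W y z" "(f, g) \<in> less_W"
  shows "(Comp W h f, Comp W h g) \<in> less_W"
proof -
  from assms(1) obtain v where v: "f = ea v" "y = eo (length v)" by (rule Hom_W_cases)
  from assms(2) obtain w where w: "g = ea w" "y = eo (length w)" by (rule Hom_W_cases)
  from assms(3) obtain u where u: "h = ea u" "ordered_word (inv_into UNIV eo y) u" by (rule Hom_W_cases)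
  have "length v = length w" using v w by simp
  with assms(4) u v word_less_comp[of v w u] show ?thesis by (simp add: w(1))
qed

text \<open>An arrow from \<open>n\<close> to \<open>m\<close> forces \<open>n \<le> m\<close>.
  Hence \<open>W\<close> is skeletal, and its full set of objects serves as the system of
  representatives.\<close>

lemma isomorphic_W_iff: "isomorphic W (eo n) (eo m) \<longleftrightarrow> n = m"
proof
  assume "isomorphic W (eo n) (eo m)"
  then show "n = m"
    unfolding isomorphic_def Hom_W by (auto dest: ordered_wordD(3) intro: antisym)
next
  assume "n = m"
  then show "isomorphic W (eo n) (eo m)"
    unfolding isomorphic_def
    by (intro bexI[of _ "ea [0..<n]"] conjI) (simp_all add: word_comp_id_right)
qed

lemma groebner_W: "groebner W"
  unfolding groebner_def
proof (intro conjI exI[of _ "Obj W"] ballI noetherian_W category_W)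
  show "iso_representatives W (Obj W)"
    unfolding iso_representatives_def by (auto simp: Obj_W isomorphic_W_iff)
  fix x
  let ?A = "arrows_from W (Obj W) x"
  \<comment> \<open>\<open>less_W\<close> is strict and lives on the whole type; its reflexive
    closure is cut down to the arrows out of \<open>x\<close>, where a reflexive order is
    expected.\<close>
  define r where "r = {(f, g) \<in> ?A \<times> ?A. f = g \<or> (f, g) \<in> less_W}"
  have A_Hom: "\<exists>y. f \<in> Hom W x y" if "f \<in> ?A" for f
    using that by (auto simp: arrows_from_def)
  have irrefl: "(f, f) \<notin> less_W" for f using wf_less_W by simp
  have lin: "linear_order_on ?A r"
    unfolding linear_order_on_def partial_order_on_def preorder_on_def
  proof (intro conjI)
    show "total_on ?A r"
      using total_less_W A_Hom by (fastforce simp: total_on_def r_def)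
    show "antisym r"
      unfolding antisym_def r_def using irrefl transD[OF trans_less_W] by blast
    show "trans r"
      unfolding r_def trans_def using transD[OF trans_less_W] by blast
  qed (auto simp: r_def refl_on_def)
  show "\<exists>r. admissible_order W (Obj W) x r"
  proof (intro exI[of _ r], unfold admissible_order_def, intro conjI lin ballI impI)
    fix y z f g h
    assume a: "y \<in> Obj W" "z \<in> Obj W" "f \<in> Hom W x y" "g \<in> Hom W x y" "h \<in> Hom W y z" "(f, g) \<in> r"
    then have "Comp W h f \<in> ?A" "Comp W h g \<in> ?A"
      using category.Comp_closed[OF category_W] unfolding arrows_from_def by blast+
    then show "(Comp W h f, Comp W h g) \<in> r"
      using a less_W_Comp[of f x y g h z] by (auto simp: r_def)
  next
    fix y
    assume y: "y \<in> Obj W"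
    let ?H = "Hom W x y"
    have sub: "?H \<subseteq> ?A" using y by (auto simp: arrows_from_def)
    show "well_order_on ?H (Restr r ?H)"
      unfolding well_order_on_def
    proof
      have r: "refl_on ?A r" "trans r" "antisym r" "total_on ?A r"
        using lin by (simp_all add: linear_order_on_def partial_order_on_def preorder_on_def)
      have "refl_on ?H (Restr r ?H)" "total_on ?H (Restr r ?H)"
        using r(1,4) sub by (auto simp: refl_on_def total_on_def subset_iff)
      moreover have "antisym (Restr r ?H)"
        by (rule antisym_subset[OF _ r(3)]) simp
      ultimately show "linear_order_on ?H (Restr r ?H)"
        using trans_Restr[OF r(2)] by (simp add: linear_order_on_def partial_order_on_def preorder_on_def)
      have "Restr r ?H - Relation.Id \<subseteq> less_W" by (auto simp: r_def)
      then show "wf (Restr r ?H - Relation.Id)" using wf_less_W wf_subset by blast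
    qed
  qed
qed

end

section \<open>Linear combinations and noetherian orders\<close>

text \<open>Adding one scaled generator at a time lets linear maps, submodules and leading terms be
  handled by induction instead of by finite sums. The rules refer to the operations but not to the
  carrier, so passing to a submodule does not change spans.\<close>

inductive_set lin_span :: "('k, 'x) ring_scheme \<Rightarrow> ('k, 'a, 'y) module_scheme \<Rightarrow> 'a set \<Rightarrow> 'a set"
  for k and M and B where
  zero: "\<zero>\<^bsub>M\<^esub> \<in> lin_span k M B"
| step: "x \<in> lin_span k M B \<Longrightarrow> a \<in> carrier k \<Longrightarrow> b \<in> B \<Longrightarrow> a \<odot>\<^bsub>M\<^esub> b \<oplus>\<^bsub>M\<^esub> x \<in> lin_span k M B"

lemma lin_span_mono:
  assumes "B \<subseteq> B'"
  shows "lin_span k M B \<subseteq> lin_span k M B'"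
proof
  fix x assume "x \<in> lin_span k M B"
  then show "x \<in> lin_span k M B'"
    by induction (use assms in \<open>auto intro: lin_span.intros\<close>)
qed

lemma lin_span_restrict: "lin_span k (M\<lparr>carrier := H\<rparr>) B = lin_span k M B"
proof (intro equalityI subsetI)
  show "x \<in> lin_span k M B" if "x \<in> lin_span k (M\<lparr>carrier := H\<rparr>) B" for x
    using that
  proof induction
    case zero show ?case using lin_span.zero[of M k B] by simp
  next
    case (step x a b) then show ?case using lin_span.step[of x k M B a b] by simp
  qed
  show "x \<in> lin_span k (M\<lparr>carrier := H\<rparr>) B" if "x \<in> lin_span k M B" for x
    using that
  proof induction
    case zero show ?case using lin_span.zero[of "M\<lparr>carrier := H\<rparr>" k B] by simp
  next
    case (step x a b) then show ?case using lin_span.step[of x k "M\<lparr>carrier := H\<rparr>" B a b] by simp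
  qed
qed

context module
begin

lemma lin_span_closed:
  assumes "B \<subseteq> carrier M" "x \<in> lin_span R M B"
  shows "x \<in> carrier M"
  using assms(2) by induction (use assms(1) in auto)

lemma lin_span_add:
  assumes B: "B \<subseteq> carrier M" and "x \<in> lin_span R M B" "y \<in> lin_span R M B"
  shows "x \<oplus>\<^bsub>M\<^esub> y \<in> lin_span R M B"
  using assms(2)
proof induction
  case zero show ?case using assms lin_span_closed by simp
next
  case (step x a b)
  have "b \<in> carrier M" "x \<in> carrier M" "y \<in> carrier M"
    using step assms lin_span_closed[OF B] by auto
  then have "a \<odot>\<^bsub>M\<^esub> b \<oplus>\<^bsub>M\<^esub> x \<oplus>\<^bsub>M\<^esub> y = a \<odot>\<^bsub>M\<^esub> b \<oplus>\<^bsub>M\<^esub> (x \<oplus>\<^bsub>M\<^esub> y)"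
    using step.hyps by (simp add: M.a_assoc)
  then show ?case using lin_span.step[OF step.IH step.hyps(2,3)] by simp
qed

lemma lin_span_smult:
  assumes B: "B \<subseteq> carrier M" and "x \<in> lin_span R M B" and c: "c \<in> carrier R"
  shows "c \<odot>\<^bsub>M\<^esub> x \<in> lin_span R M B"
  using assms(2)
proof induction
  case zero show ?case using c lin_span.zero[of M R B] by simp
next
  case (step x a b)
  have "b \<in> carrier M" "x \<in> carrier M"
    using step assms lin_span_closed[OF B] by auto
  then have "c \<odot>\<^bsub>M\<^esub> (a \<odot>\<^bsub>M\<^esub> b \<oplus>\<^bsub>M\<^esub> x) = (c \<otimes> a) \<odot>\<^bsub>M\<^esub> b \<oplus>\<^bsub>M\<^esub> c \<odot>\<^bsub>M\<^esub> x"
    using step.hyps c by (simp add: smult_r_distr smult_assoc1)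
  then show ?case using lin_span.step[OF step.IH _ step.hyps(3), of "c \<otimes> a"] step.hyps c by simp
qed

lemma submodule_lin_span:
  assumes B: "B \<subseteq> carrier M"
  shows "submodule (lin_span R M B) R M"
proof (rule submoduleI)
  show "lin_span R M B \<subseteq> carrier M" using lin_span_closed[OF B] by blast
  show "\<ominus>\<^bsub>M\<^esub> x \<in> lin_span R M B" if "x \<in> lin_span R M B" for x
    using lin_span_smult[OF B that, of "\<ominus> \<one>"] lin_span_closed[OF B that] by (simp add: smult_l_minus)
qed (auto intro: lin_span.zero lin_span_add[OF B] lin_span_smult[OF B])

lemma lin_span_base:
  assumes B: "B \<subseteq> carrier M" and "b \<in> B"
  shows "b \<in> lin_span R M B"
  using lin_span.step[OF lin_span.zero, of "\<one>" R b B M] assms by auto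

lemma submodule_zero: "submodule H R M \<Longrightarrow> \<zero>\<^bsub>M\<^esub> \<in> H"
  using submoduleE[of H] M.r_neg by (metis all_not_in_conv subsetD)

lemma submodule_diff:
  assumes "submodule H R M" "x \<in> H" "y \<in> H"
  shows "x \<ominus>\<^bsub>M\<^esub> y \<in> H"
  using submoduleE(3,5)[OF assms(1)] assms(2,3) by (simp add: a_minus_def)

lemma lin_span_least:
  assumes "submodule H R M" "B \<subseteq> H"
  shows "lin_span R M B \<subseteq> H"
proof
  fix x assume "x \<in> lin_span R M B"
  then show "x \<in> H"
  proof induction
    case zero show ?case by (rule submodule_zero[OF assms(1)])
  next
    case (step x a b)
    then show ?case using submoduleE(4,5)[OF assms(1)] assms(2) by blast
  qed
qed

text \<open>All multiples of \<open>b\<close> are collected into one. This is how a leading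
  coefficient is separated from the lower terms.\<close>

lemma lin_span_insert:
  assumes "insert b B \<subseteq> carrier M" "x \<in> lin_span R M (insert b B)"
  obtains a y where "a \<in> carrier R" "y \<in> lin_span R M B" "x = a \<odot>\<^bsub>M\<^esub> b \<oplus>\<^bsub>M\<^esub> y"
proof -
  have B: "B \<subseteq> carrier M" and b: "b \<in> carrier M" using assms(1) by auto
  from assms(2) have "\<exists>a \<in> carrier R. \<exists>y \<in> lin_span R M B. x = a \<odot>\<^bsub>M\<^esub> b \<oplus>\<^bsub>M\<^esub> y"
  proof induction
    case zero
    show ?case using b by (intro bexI[of _ \<zero>] bexI[of _ "\<zero>\<^bsub>M\<^esub>"]) (auto intro: lin_span.zero)
  next
    case (step x c d)
    then obtain a y where ay: "a \<in> carrier R" "y \<in> lin_span R M B" "x = a \<odot>\<^bsub>M\<^esub> b \<oplus>\<^bsub>M\<^esub> y"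
      by blast
    have y: "y \<in> carrier M" by (rule lin_span_closed[OF B ay(2)])
    show ?case
    proof (cases "d = b")
      case True
      have "c \<odot>\<^bsub>M\<^esub> d \<oplus>\<^bsub>M\<^esub> x = (c \<oplus> a) \<odot>\<^bsub>M\<^esub> b \<oplus>\<^bsub>M\<^esub> y"
        using step.hyps ay b y True by (simp add: smult_l_distr M.a_assoc)
      then show ?thesis using ay step.hyps by blast
    next
      case False
      then have d: "d \<in> B" "d \<in> carrier M" using step.hyps B by auto
      have "c \<odot>\<^bsub>M\<^esub> d \<oplus>\<^bsub>M\<^esub> x = a \<odot>\<^bsub>M\<^esub> b \<oplus>\<^bsub>M\<^esub> (c \<odot>\<^bsub>M\<^esub> d \<oplus>\<^bsub>M\<^esub> y)"
        using step.hyps ay b y d by (simp add: M.a_lcomm)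
      then show ?thesis using lin_span.step[OF ay(2) step.hyps(2) d(1)] ay(1) by blast
    qed
  qed
  then show thesis using that by blast
qed

text \<open>A combination involves finitely many indices, and a largest one bounds it; in the
  induction the new index is compared with the current bound. The order is on indices rather than on
  vectors because \<open>v\<close> need not be injective.\<close>

lemma lin_span_leading_term:
  assumes v: "v ` T \<subseteq> carrier M" and "trans r" and tot: "total_on T r"
    and "x \<in> lin_span R M (v ` T)"
  shows "x = \<zero>\<^bsub>M\<^esub> \<or> (\<exists>t \<in> T. x \<in> lin_span R M (v ` {s \<in> T. s = t \<or> (s, t) \<in> r}))"
  using assms(4)
proof induction
  case zero show ?case by simp
next
  case (step x a b)
  then obtain s where s: "s \<in> T" "b = v s" by blast
  let ?B = "\<lambda>t. v ` {s \<in> T. s = t \<or> (s, t) \<in> r}"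
  have B: "?B t \<subseteq> carrier M" for t using v by blast
  have bB: "b \<in> ?B s" using s by blast
  from step.IH show ?case
  proof
    assume "x = \<zero>\<^bsub>M\<^esub>"
    then have "a \<odot>\<^bsub>M\<^esub> b \<oplus>\<^bsub>M\<^esub> x \<in> lin_span R M (?B s)"
      using lin_span.step[OF lin_span.zero step.hyps(2) bB] by simp
    then show ?thesis using s(1) by blast
  next
    assume "\<exists>t \<in> T. x \<in> lin_span R M (?B t)"
    then obtain t where t: "t \<in> T" "x \<in> lin_span R M (?B t)" by blast
    consider "s = t \<or> (s, t) \<in> r" | "(t, s) \<in> r"
      using tot s(1) t(1) unfolding total_on_def by blast
    then show ?thesis
    proof cases
      case 1
      then have "b \<in> ?B t" using s by blast
      then show ?thesis using lin_span.step[OF t(2) step.hyps(2)] t(1) by blast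
    next
      case 2
      then have "?B t \<subseteq> ?B s" using transD[OF \<open>trans r\<close>] by blast
      then have "x \<in> lin_span R M (?B s)" using t(2) lin_span_mono by blast
      then show ?thesis using lin_span.step[OF _ step.hyps(2) bB] s(1) by blast
    qed
  qed
qed

end

lemma module_imp_left_module: "module k V \<Longrightarrow> left_module k V"
  by (simp add: module_iff_left_module)

lemma linear_maps_zero:
  assumes "left_module k V" "left_module k W" "f \<in> linear_maps k V W"
  shows "f \<zero>\<^bsub>V\<^esub> = \<zero>\<^bsub>W\<^esub>"
proof -
  interpret V: left_module k V by fact
  interpret W: left_module k W by fact
  have "f (\<zero>\<^bsub>V\<^esub> \<oplus>\<^bsub>V\<^esub> \<zero>\<^bsub>V\<^esub>) = f \<zero>\<^bsub>V\<^esub> \<oplus>\<^bsub>W\<^esub> f \<zero>\<^bsub>V\<^esub>" "f \<zero>\<^bsub>V\<^esub> \<in> carrier W"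
    using assms(3) by (auto simp: linear_maps_def simp del: V.M.l_zero V.M.r_zero)
  then show ?thesis by simp
qed

lemma linear_maps_lin_span:
  assumes "module k V" "module k W" and f: "f \<in> linear_maps k V W" and B: "B \<subseteq> carrier V"
    and "x \<in> lin_span k V B" "f ` B \<subseteq> B'"
  shows "f x \<in> lin_span k W B'"
  using assms(5)
proof induction
  case zero show ?case by (simp add: linear_maps_zero[OF assms(1,2)[THEN module_imp_left_module] f] lin_span.zero)
next
  case (step x a b)
  interpret V: module k V by fact
  have "x \<in> carrier V" "b \<in> carrier V"
    using step.hyps B V.lin_span_closed[OF B] by auto
  then have "f (a \<odot>\<^bsub>V\<^esub> b \<oplus>\<^bsub>V\<^esub> x) = a \<odot>\<^bsub>W\<^esub> f b \<oplus>\<^bsub>W\<^esub> f x"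
    using f step.hyps by (simp add: linear_maps_def)
  then show ?case using lin_span.step[OF step.IH step.hyps(2)] step.hyps(3) assms(6) by auto
qed

lemma linear_mapsD:
  assumes "f \<in> linear_maps k V W"
  shows "x \<in> carrier V \<Longrightarrow> f x \<in> carrier W"
    "x \<in> carrier V \<Longrightarrow> y \<in> carrier V \<Longrightarrow> f (x \<oplus>\<^bsub>V\<^esub> y) = f x \<oplus>\<^bsub>W\<^esub> f y"
    "a \<in> carrier k \<Longrightarrow> x \<in> carrier V \<Longrightarrow> f (a \<odot>\<^bsub>V\<^esub> x) = a \<odot>\<^bsub>W\<^esub> f x"
  using assms by (auto simp: linear_maps_def)

lemma linear_maps_finsum:
  assumes "left_module k V" "left_module k W" and f: "f \<in> linear_maps k V W" and "finite A" "F \<in> A \<rightarrow> carrier V"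
  shows "f (\<Oplus>\<^bsub>V\<^esub>a\<in>A. F a) = (\<Oplus>\<^bsub>W\<^esub>a\<in>A. f (F a))"
proof -
  interpret V: left_module k V by fact
  interpret W: left_module k W by fact
  show ?thesis using assms(4,5)
  proof (induction A)
    case empty show ?case by (simp add: linear_maps_zero[OF assms(1-3)])
  next
    case (insert a A)
    then have "F a \<in> carrier V" "F \<in> A \<rightarrow> carrier V" "(\<Oplus>\<^bsub>V\<^esub>a\<in>A. F a) \<in> carrier V" by auto
    then show ?case using insert linear_mapsD[OF f] by (simp add: Pi_iff)
  qed
qed

section \<open>Infinite chains and ascending ideals\<close>

text \<open>Infinitely many indices without a larger later partner would form a subsequence with no
  related pair. So from some \<open>m\<close> on every index has a later partner, and iterating a
  choice of partners gives the chain, with transitivity relating non-adjacent members.\<close>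

lemma noetherian_on_chain:
  assumes "noetherian_on S leq" and "range f \<subseteq> S"
    and trans: "transp_on S leq"
  obtains e :: "nat \<Rightarrow> nat" where "strict_mono e" "\<And>i j. i < j \<Longrightarrow> leq (f (e i)) (f (e j))"
proof -
  define T where "T = {i. \<forall>j > i. \<not> leq (f i) (f j)}"
  have "finite T"
  proof (rule ccontr)
    assume inf: "infinite T"
    have "range (\<lambda>i. f (enumerate T i)) \<subseteq> S" using assms(2) by blast
    then obtain i j where "i < j" "leq (f (enumerate T i)) (f (enumerate T j))"
      using assms(1) unfolding noetherian_on_def by blast
    moreover have "enumerate T i \<in> T" "enumerate T i < enumerate T j"
      using inf \<open>i < j\<close> by (simp_all add: enumerate_in_set enumerate_mono)
    ultimately show False by (simp add: T_def)
  qed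
  then obtain m where m: "\<And>i. i \<in> T \<Longrightarrow> i < m"
    unfolding finite_nat_set_iff_bounded by blast
  have "\<exists>j. i < j \<and> m \<le> j \<and> leq (f i) (f j)" if "m \<le> i" for i
  proof -
    have "i \<notin> T" using m that by (meson leD)
    then obtain j where "i < j" "leq (f i) (f j)" by (auto simp: T_def)
    then show ?thesis using that by auto
  qed
  then obtain next_idx where n: "\<And>i. m \<le> i \<Longrightarrow> i < next_idx i" "\<And>i. m \<le> i \<Longrightarrow> m \<le> next_idx i"
    "\<And>i. m \<le> i \<Longrightarrow> leq (f i) (f (next_idx i))"
    by metis
  define e where "e i = (next_idx ^^ i) m" for i
  have ge: "m \<le> e i" for i by (induction i) (simp_all add: e_def n(2))
  have Suc: "e i < e (Suc i)" "leq (f (e i)) (f (e (Suc i)))" for i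
    using n[OF ge[of i]] by (simp_all add: e_def)
  have "leq (f (e i)) (f (e j))" if "i < j" for i j
    using that
  proof (induction j)
    case (Suc j)
    have S: "f n \<in> S" for n using assms(2) by blast
    show ?case
    proof (cases "i = j")
      case True then show ?thesis using \<open>leq (f (e i)) (f (e (Suc i)))\<close> by simp
    next
      case False
      then have "leq (f (e i)) (f (e j))" using Suc by simp
      then show ?thesis using transp_onD[OF trans S S S] Suc(2) \<open>\<And>i. leq (f (e i)) (f (e (Suc i)))\<close> by blast
    qed
  qed simp
  with Suc(1) show thesis using that[of e] by (simp add: strict_mono_Suc_iff)
qed

text \<open>Along an infinite chain the ideals generated by the coefficients seen so far increase,
  hence become stationary; the next coefficient is then redundant. Restricting to a chain ensures
  that every coefficient used belongs to a divisor of the last term.\<close>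

lemma noetherian_on_ideal_stop:
  assumes "noetherian_ring k" and noeth: "noetherian_on S leq" and f: "range f \<subseteq> S"
    and trans: "transp_on S leq"
    and a: "\<And>n :: nat. a n \<in> carrier k"
  obtains n where "a n \<in> genideal k {a i |i. i < n \<and> leq (f i) (f n)}"
proof -
  interpret k: noetherian_ring k by fact
  obtain e where e: "strict_mono e" "\<And>i j :: nat. i < j \<Longrightarrow> leq (f (e i)) (f (e j))"
    using noetherian_on_chain[OF noeth f trans] by metis
  define J where "J n = genideal k {a (e i) |i. i < n}" for n
  have sub: "{a (e i) |i. i < n} \<subseteq> carrier k" for n using a by blast
  have J: "ideal (J n) k" for n unfolding J_def by (rule k.genideal_ideal[OF sub])
  have mono: "J m \<subseteq> J n" if "m \<le> n" for m n
  proof -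
    have "{a (e i) |i. i < m} \<subseteq> J n"
      using k.genideal_self[OF sub[of n]] that unfolding J_def by fastforce
    then show ?thesis unfolding J_def[of m] using J by (rule k.genideal_minimal[rotated])
  qed
  have "subset.chain {I. ideal I k} (range J)"
    unfolding subset_chain_def
  proof (intro conjI ballI)
    fix I I' assume "I \<in> range J" "I' \<in> range J"
    then obtain m n where "I = J m" "I' = J n" by blast
    then show "I \<subseteq> I' \<or> I' \<subseteq> I" using mono linear[of m n] by blast
  qed (use J in blast)
  then have "\<Union>(range J) \<in> range J"
    by (rule k.ideal_chain_is_trivial[rotated]) simp
  then obtain n where n: "\<Union>(range J) = J n" by blast
  \<comment> \<open>\<open>J (Suc n)\<close> is contained in the union, which equals
    \<open>J n\<close>.\<close>
  have "a (e n) \<in> J (Suc n)"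
    using k.genideal_self[OF sub[of "Suc n"]] unfolding J_def by blast
  then have "a (e n) \<in> J n" using n by blast
  moreover have "J n \<subseteq> genideal k {a i |i. i < e n \<and> leq (f i) (f (e n))}"
    unfolding J_def
  proof (rule k.subset_Idl_subset)
    show "{a i |i. i < e n \<and> leq (f i) (f (e n))} \<subseteq> carrier k" using a by blast
    show "{a (e i) |i. i < n} \<subseteq> {a i |i. i < e n \<and> leq (f i) (f (e n))}"
      using e by (auto simp: strict_mono_less)
  qed
  ultimately show thesis using that by blast
qed

section \<open>Finite generation of modules over a category\<close>

text \<open>Generators carry their object, since all modules \<open>At M x\<close> share one type
  and an element alone does not determine where it lives.\<close>

definition generated :: "('k, 'x) ring_scheme \<Rightarrow> ('o, 'm) category \<Rightarrow> ('o, 'm, 'k, 'a) cat_module \<Rightarrow>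
    ('o \<times> 'a) set \<Rightarrow> 'o \<Rightarrow> 'a set" where
  "generated k C M U y =
    lin_span k (At M y) {Act M f u |x u f. (x, u) \<in> U \<and> f \<in> Hom C x y}"

context cat_module
begin

lemma Act_closed: "f \<in> Hom C x y \<Longrightarrow> u \<in> carrier (At M x) \<Longrightarrow> Act M f u \<in> carrier (At M y)"
  using Act_linear[of f x y] by (auto simp: linear_maps_def)

lemma Hom_Obj: "f \<in> Hom C x y \<Longrightarrow> x \<in> Obj C \<and> y \<in> Obj C"
  using Dom_closed Cod_closed by (auto simp: Hom_def)

lemma translates_closed:
  assumes "U \<subseteq> (SIGMA x : Obj C. carrier (At M x))"
  shows "{Act M f u |x u f. (x, u) \<in> U \<and> f \<in> Hom C x y} \<subseteq> carrier (At M y)"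
  using assms Act_closed by blast

text \<open>By functoriality the translates of \<open>U\<close> are permuted among themselves by
  arrows, so their spans are stable.\<close>

lemma cat_submodule_generated:
  assumes U: "U \<subseteq> (SIGMA x : Obj C. carrier (At M x))"
  shows "cat_submodule k C M (generated k C M U)"
  unfolding cat_submodule_def
proof (intro conjI ballI)
  show "submodule (generated k C M U x) k (At M x)" if "x \<in> Obj C" for x
    unfolding generated_def
    by (rule module.submodule_lin_span[OF At_module[OF that] translates_closed[OF U]])
  fix x y f
  assume xyf: "x \<in> Obj C" "y \<in> Obj C" "f \<in> Hom C x y"
  let ?T = "\<lambda>y. {Act M f u |x u f. (x, u) \<in> U \<and> f \<in> Hom C x y}"
  have "Act M f ` ?T x \<subseteq> ?T y"
  proof (rule image_subsetI)
    fix v assume "v \<in> ?T x"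
    then obtain z u g where zug: "v = Act M g u" "(z, u) \<in> U" "g \<in> Hom C z x" by blast
    then have "Act M f v = Act M (Comp C f g) u" using Act_Comp[OF zug(3) xyf(3)] U by auto
    then show "Act M f v \<in> ?T y" using zug(2) Comp_closed[OF zug(3) xyf(3)] by blast
  qed
  then show "Act M f ` generated k C M U x \<subseteq> generated k C M U y"
    unfolding generated_def
    using linear_maps_lin_span[OF At_module[OF xyf(1)] At_module[OF xyf(2)] Act_linear[OF xyf(3)]
        translates_closed[OF U]] by blast
qed

lemma in_generated:
  assumes U: "U \<subseteq> (SIGMA x : Obj C. carrier (At M x))" and "(x, u) \<in> U"
  shows "u \<in> generated k C M U x"
proof -
  have x: "x \<in> Obj C" "u \<in> carrier (At M x)" using assms by auto
  have "Act M (Id C x) u \<in> lin_span k (At M x) {Act M f u |x' u f. (x', u) \<in> U \<and> f \<in> Hom C x' x}"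
    using assms(2) Id_closed[OF x(1)]
    by (intro module.lin_span_base[OF At_module[OF x(1)] translates_closed[OF U]]) blast
  then show ?thesis by (simp add: generated_def Act_Id x)
qed

lemma generated_least:
  assumes N: "cat_submodule k C M N" and U: "U \<subseteq> (SIGMA x : Obj C. N x)" and y: "y \<in> Obj C"
  shows "generated k C M U y \<subseteq> N y"
  unfolding generated_def
proof (rule module.lin_span_least[OF At_module[OF y]])
  show "submodule (N y) k (At M y)" using N y by (simp add: cat_submodule_def)
  show "{Act M f u |x u f. (x, u) \<in> U \<and> f \<in> Hom C x y} \<subseteq> N y"
    using N U y unfolding cat_submodule_def by blast
qed

lemma cat_submodule_carrier:
  assumes "cat_submodule k C M N" "x \<in> Obj C"
  shows "N x \<subseteq> carrier (At M x)"
  using assms module.submoduleE(1)[OF At_module] by (simp add: cat_submodule_def)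

lemma cat_module_restrict:
  assumes N: "cat_submodule k C M N"
  shows "cat_module k C (restrict_module M N)"
proof (intro cat_module.intro category_axioms k.is_cring cat_module_axioms.intro)
  fix x assume x: "x \<in> Obj C"
  have "submodule (N x) k (At M x)" using N x by (simp add: cat_submodule_def)
  then show "module k (At (restrict_module M N) x)"
    using submodule.submodule_is_module[OF _ At_module[OF x]] by (simp add: restrict_module_def)
next
  fix f x y assume f: "f \<in> Hom C x y"
  then have xy: "x \<in> Obj C" "y \<in> Obj C" using Hom_Obj by auto
  have sub: "Act M f ` N x \<subseteq> N y" using N f xy by (auto simp: cat_submodule_def)
  have "N x \<subseteq> carrier (At M x)" by (rule cat_submodule_carrier[OF N xy(1)])
  then have "\<And>u. u \<in> N x \<Longrightarrow> u \<in> carrier (At M x)" by blast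
  then show "Act (restrict_module M N) f \<in> linear_maps k (At (restrict_module M N) x) (At (restrict_module M N) y)"
    using Act_linear[OF f] sub by (auto simp: restrict_module_def linear_maps_def)
next
  fix x u assume "x \<in> Obj C" "u \<in> carrier (At (restrict_module M N) x)"
  then show "Act (restrict_module M N) (Id C x) u = u"
    using Act_Id[of x u] cat_submodule_carrier[OF N, of x] by (auto simp: restrict_module_def)
next
  fix f g x y z u
  assume f: "f \<in> Hom C x y" and "g \<in> Hom C y z" "u \<in> carrier (At (restrict_module M N) x)"
  then show "Act (restrict_module M N) (Comp C g f) u =
      Act (restrict_module M N) g (Act (restrict_module M N) f u)"
    using Act_Comp[of f x y g z u] cat_submodule_carrier[OF N, of x] Hom_Obj[OF f]
    by (auto simp: restrict_module_def)
qed

lemma generated_restrict: "generated k C (restrict_module M N) U y = generated k C M U y"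
  by (simp add: generated_def restrict_module_def lin_span_restrict)

end

section \<open>Linear combinations with finite support\<close>

text \<open>The sum runs over the support because \<open>S\<close> may be infinite, like a Hom set,
  and \<open>finsum\<close> over an infinite set is only a default value.\<close>

definition lin_comb :: "('k, 'x) ring_scheme \<Rightarrow> ('k, 'a, 'y) module_scheme \<Rightarrow> 's set \<Rightarrow> ('s \<Rightarrow> 'a) \<Rightarrow>
    ('s \<Rightarrow> 'k) \<Rightarrow> 'a" where
  "lin_comb k M S v c = (\<Oplus>\<^bsub>M\<^esub>s\<in>{s \<in> S. c s \<noteq> \<zero>\<^bsub>k\<^esub>}. c s \<odot>\<^bsub>M\<^esub> v s)"

context module
begin

text \<open>The support may be enlarged to any finite \<open>A\<close> inside \<open>S\<close>; this
  puts several combinations over one common index set.\<close>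

lemma lin_comb_eq:
  assumes "finite A" "{s \<in> S. c s \<noteq> \<zero>} \<subseteq> A" "A \<subseteq> S" "v \<in> S \<rightarrow> carrier M" "c \<in> S \<rightarrow> carrier R"
  shows "lin_comb R M S v c = (\<Oplus>\<^bsub>M\<^esub>s\<in>A. c s \<odot>\<^bsub>M\<^esub> v s)"
  unfolding lin_comb_def
proof (rule M.add.finprod_mono_neutral_cong_left[OF assms(1,2)])
  show "c s \<odot>\<^bsub>M\<^esub> v s = \<zero>\<^bsub>M\<^esub>" if "s \<in> A - {s \<in> S. c s \<noteq> \<zero>}" for s
  proof -
    have "c s = \<zero>" "v s \<in> carrier M" using that assms(3,4) by auto
    then show ?thesis by simp
  qed
  have "c s \<odot>\<^bsub>M\<^esub> v s \<in> carrier M" if "s \<in> S" for s using that assms(4,5) by (auto simp: Pi_iff)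
  then show "(\<lambda>s. c s \<odot>\<^bsub>M\<^esub> v s) \<in> A \<rightarrow> carrier M" using assms(3) by blast
qed simp

lemma lin_comb_closed:
  assumes "v \<in> S \<rightarrow> carrier M" "c \<in> S \<rightarrow> carrier R"
  shows "lin_comb R M S v c \<in> carrier M"
  unfolding lin_comb_def by (rule M.finsum_closed) (use assms in \<open>auto simp: Pi_iff\<close>)

lemma lin_comb_add:
  assumes "finite {s \<in> S. c s \<noteq> \<zero>}" "finite {s \<in> S. d s \<noteq> \<zero>}"
    and "v \<in> S \<rightarrow> carrier M" "c \<in> S \<rightarrow> carrier R" "d \<in> S \<rightarrow> carrier R"
  shows "lin_comb R M S v (\<lambda>s. c s \<oplus> d s) = lin_comb R M S v c \<oplus>\<^bsub>M\<^esub> lin_comb R M S v d"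
proof -
  let ?A = "{s \<in> S. c s \<noteq> \<zero>} \<union> {s \<in> S. d s \<noteq> \<zero>}"
  have A: "finite ?A" "?A \<subseteq> S" using assms by auto
  have v: "\<And>s. s \<in> S \<Longrightarrow> v s \<in> carrier M" and c: "\<And>s. s \<in> S \<Longrightarrow> c s \<in> carrier R"
    and d: "\<And>s. s \<in> S \<Longrightarrow> d s \<in> carrier R" using assms by auto
  have "lin_comb R M S v (\<lambda>s. c s \<oplus> d s) = (\<Oplus>\<^bsub>M\<^esub>s\<in>?A. (c s \<oplus> d s) \<odot>\<^bsub>M\<^esub> v s)"
    by (rule lin_comb_eq[OF A(1) _ A(2)]) (use c d v in auto)
  also have "\<dots> = (\<Oplus>\<^bsub>M\<^esub>s\<in>?A. c s \<odot>\<^bsub>M\<^esub> v s \<oplus>\<^bsub>M\<^esub> d s \<odot>\<^bsub>M\<^esub> v s)"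
    by (rule M.finsum_cong') (use A c d v in \<open>auto simp: smult_l_distr\<close>)
  also have "\<dots> = (\<Oplus>\<^bsub>M\<^esub>s\<in>?A. c s \<odot>\<^bsub>M\<^esub> v s) \<oplus>\<^bsub>M\<^esub> (\<Oplus>\<^bsub>M\<^esub>s\<in>?A. d s \<odot>\<^bsub>M\<^esub> v s)"
    by (rule M.finsum_addf) (use A c d v in auto)
  also have "(\<Oplus>\<^bsub>M\<^esub>s\<in>?A. c s \<odot>\<^bsub>M\<^esub> v s) = lin_comb R M S v c"
    by (rule lin_comb_eq[symmetric]) (use assms A in auto)
  also have "(\<Oplus>\<^bsub>M\<^esub>s\<in>?A. d s \<odot>\<^bsub>M\<^esub> v s) = lin_comb R M S v d"
    by (rule lin_comb_eq[symmetric]) (use assms A in auto)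
  finally show ?thesis .
qed

lemma lin_comb_smult:
  assumes "finite {s \<in> S. c s \<noteq> \<zero>}" "v \<in> S \<rightarrow> carrier M" "c \<in> S \<rightarrow> carrier R" "a \<in> carrier R"
  shows "lin_comb R M S v (\<lambda>s. a \<otimes> c s) = a \<odot>\<^bsub>M\<^esub> lin_comb R M S v c"
proof -
  let ?A = "{s \<in> S. c s \<noteq> \<zero>}"
  have v: "\<And>s. s \<in> S \<Longrightarrow> v s \<in> carrier M" and c: "\<And>s. s \<in> S \<Longrightarrow> c s \<in> carrier R"
    using assms by auto
  have "lin_comb R M S v (\<lambda>s. a \<otimes> c s) = (\<Oplus>\<^bsub>M\<^esub>s\<in>?A. (a \<otimes> c s) \<odot>\<^bsub>M\<^esub> v s)"
    by (rule lin_comb_eq) (use assms in auto)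
  also have "\<dots> = (\<Oplus>\<^bsub>M\<^esub>s\<in>?A. a \<odot>\<^bsub>M\<^esub> (c s \<odot>\<^bsub>M\<^esub> v s))"
    by (rule M.finsum_cong') (use c v assms(4) in \<open>auto simp: smult_assoc1\<close>)
  also have "\<dots> = a \<odot>\<^bsub>M\<^esub> (\<Oplus>\<^bsub>M\<^esub>s\<in>?A. c s \<odot>\<^bsub>M\<^esub> v s)"
    by (rule finsum_smult_ldistr[symmetric]) (use assms in auto)
  finally show ?thesis by (simp add: lin_comb_def)
qed

text \<open>Returns from the inductive span to a coefficient function that vanishes off
  \<open>S\<close>, which is the shape of the elements of free modules.\<close>

lemma lin_span_imp_lin_comb:
  assumes v: "v \<in> S \<rightarrow> carrier M" and "x \<in> lin_span R M (v ` S)"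
  obtains c where "\<And>s. c s \<in> carrier R" "finite {s. c s \<noteq> \<zero>}" "\<And>s. s \<notin> S \<Longrightarrow> c s = \<zero>"
    "x = lin_comb R M S v c"
proof -
  from assms(2) have "\<exists>c. (\<forall>s. c s \<in> carrier R) \<and> finite {s. c s \<noteq> \<zero>} \<and> (\<forall>s. s \<notin> S \<longrightarrow> c s = \<zero>) \<and>
    x = lin_comb R M S v c"
  proof induction
    case zero
    show ?case by (intro exI[of _ "\<lambda>_. \<zero>"]) (simp add: lin_comb_def)
  next
    case (step x a b)
    then obtain c where c: "\<And>s. c s \<in> carrier R" "finite {s. c s \<noteq> \<zero>}" "\<And>s. s \<notin> S \<Longrightarrow> c s = \<zero>"
      "x = lin_comb R M S v c" by auto
    from step.hyps obtain t where t: "t \<in> S" "b = v t" by blast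
    define d where "d s = (if s = t then a else \<zero>)" for s
    have d: "\<And>s. d s \<in> carrier R" "{s. d s \<noteq> \<zero>} \<subseteq> {t}"
      using step.hyps by (auto simp: d_def)
    have "lin_comb R M S v d = (\<Oplus>\<^bsub>M\<^esub>s\<in>{t}. d s \<odot>\<^bsub>M\<^esub> v s)"
      by (rule lin_comb_eq) (use d t v in auto)
    also have "\<dots> = a \<odot>\<^bsub>M\<^esub> b"
      using t v step.hyps by (simp add: d_def Pi_iff)
    finally have "a \<odot>\<^bsub>M\<^esub> b \<oplus>\<^bsub>M\<^esub> x = lin_comb R M S v (\<lambda>s. d s \<oplus> c s)"
      using c d v finite_subset[OF d(2)] by (simp add: lin_comb_add)
    moreover have "{s. d s \<oplus> c s \<noteq> \<zero>} \<subseteq> {t} \<union> {s. c s \<noteq> \<zero>}" by (auto simp: d_def)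
    then have "finite {s. d s \<oplus> c s \<noteq> \<zero>}" by (rule finite_subset) (use c(2) in simp)
    moreover have "d s \<oplus> c s = \<zero>" if "s \<notin> S" for s
      using that t(1) c(3)[OF that] by (auto simp: d_def)
    ultimately show ?case using c(1) d(1) by (intro exI[of _ "\<lambda>s. d s \<oplus> c s"]) simp
  qed
  then show thesis using that by blast
qed

end

lemma (in abelian_monoid) finsum_fibers:
  assumes "finite A" "F \<in> A \<rightarrow> carrier G"
  shows "(\<Oplus>b\<in>p ` A. \<Oplus>a\<in>{a \<in> A. p a = b}. F a) = (\<Oplus>a\<in>A. F a)"
proof -
  have "(\<Oplus>b\<in>B. \<Oplus>a\<in>{a \<in> A. p a = b}. F a) = (\<Oplus>a\<in>{a \<in> A. p a \<in> B}. F a)" if "finite B" for B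
    using that
  proof (induction B)
    case (insert b B)
    have "{a \<in> A. p a \<in> insert b B} = {a \<in> A. p a = b} \<union> {a \<in> A. p a \<in> B}" by auto
    moreover have "(\<Oplus>a\<in>{a \<in> A. p a = b} \<union> {a \<in> A. p a \<in> B}. F a) =
        (\<Oplus>a\<in>{a \<in> A. p a = b}. F a) \<oplus> (\<Oplus>a\<in>{a \<in> A. p a \<in> B}. F a)"
      by (rule finsum_Un_disjoint) (use assms insert.hyps in auto)
    moreover have "(\<Oplus>b\<in>insert b B. \<Oplus>a\<in>{a \<in> A. p a = b}. F a) =
        (\<Oplus>a\<in>{a \<in> A. p a = b}. F a) \<oplus> (\<Oplus>b\<in>B. \<Oplus>a\<in>{a \<in> A. p a = b}. F a)"
      by (rule finsum_insert) (use assms insert.hyps in \<open>auto intro!: finsum_closed\<close>)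
    ultimately show ?case using insert.IH by simp
  qed simp
  from this[of "p ` A"] show ?thesis using assms(1) by (simp add: Collect_conj_eq Int_absorb2 subset_iff)
qed

lemma (in module) finsum_smult_rdistr:
  assumes "finite A" "u \<in> carrier M" "f \<in> A \<rightarrow> carrier R"
  shows "(\<Oplus>a\<in>A. f a) \<odot>\<^bsub>M\<^esub> u = (\<Oplus>\<^bsub>M\<^esub>a\<in>A. f a \<odot>\<^bsub>M\<^esub> u)"
  using assms
proof (induction A)
  case (insert a A)
  then have "f a \<in> carrier R" "f \<in> A \<rightarrow> carrier R" "(\<Oplus>a\<in>A. f a) \<in> carrier R" by auto
  then show ?case using insert by (simp add: smult_l_distr Pi_iff)
qed simp

section \<open>Quotients of sums of principal modules and finite generating sets\<close>

lemma direct_sum_carrier: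
  "carrier (At (direct_sum (map (principal_module k C) xs)) y) =
    {c \<in> extensional {..<length xs}. \<forall>n < length xs. (\<forall>f. c n f \<in> carrier k) \<and>
      (\<forall>f. f \<notin> Hom C (xs ! n) y \<longrightarrow> c n f = \<zero>\<^bsub>k\<^esub>) \<and> finite {f. c n f \<noteq> \<zero>\<^bsub>k\<^esub>}}"
  by (simp add: direct_sum_def principal_module_def free_module_def PiE_iff set_eq_iff) blast

lemma direct_sum_add:
  "c \<oplus>\<^bsub>At (direct_sum (map (principal_module k C) xs)) y\<^esub> d =
    (\<lambda>n \<in> {..<length xs}. \<lambda>f. c n f \<oplus>\<^bsub>k\<^esub> d n f)"
  by (simp add: direct_sum_def principal_module_def free_module_def cong: restrict_cong)

lemma direct_sum_smult:
  "a \<odot>\<^bsub>At (direct_sum (map (principal_module k C) xs)) y\<^esub> d =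
    (\<lambda>n \<in> {..<length xs}. \<lambda>f. a \<otimes>\<^bsub>k\<^esub> d n f)"
  by (simp add: direct_sum_def principal_module_def free_module_def cong: restrict_cong)

lemma direct_sum_Act:
  "Act (direct_sum (map (principal_module k C) xs)) h c =
    (\<lambda>n \<in> {..<length xs}. \<lambda>g.
      \<Oplus>\<^bsub>k\<^esub>f \<in> {f \<in> Hom C (xs ! n) (Dom C h). c n f \<noteq> \<zero>\<^bsub>k\<^esub> \<and> Comp C h f = g}. c n f)"
  by (simp add: direct_sum_def principal_module_def cong: restrict_cong)

context cat_module
begin

text \<open>Yoneda: the basis element \<open>e n f\<close> is the translate along \<open>f\<close>
  of the one at the identity, so the images under \<open>\<phi>\<close> of the identities generate.
  The hypothesis \<open>one\<close> makes the identity lie in the support of its own basis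
  element.\<close>

lemma finitely_generated_imp_generated:
  assumes "finitely_generated k C M" and one: "\<one>\<^bsub>k\<^esub> \<noteq> \<zero>\<^bsub>k\<^esub>"
  obtains U where "finite U" "U \<subseteq> (SIGMA x : Obj C. carrier (At M x))"
    "\<And>y. y \<in> Obj C \<Longrightarrow> generated k C M U y = carrier (At M y)"
proof -
  from assms obtain xs \<phi> where xs: "set xs \<subseteq> Obj C"
    and \<phi>: "cat_module_hom k C (direct_sum (map (principal_module k C) xs)) M \<phi>"
    and surj: "\<And>x. x \<in> Obj C \<Longrightarrow>
      \<phi> x ` carrier (At (direct_sum (map (principal_module k C) xs)) x) = carrier (At M x)"
    unfolding finitely_generated_def is_quotient_of_def by blast
  define P where "P = direct_sum (map (principal_module k C) xs)"
  define e where "e n f = (\<lambda>m \<in> {..<length xs}. \<lambda>g. if m = n \<and> g = f then \<one>\<^bsub>k\<^esub> else \<zero>\<^bsub>k\<^esub>)"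
    for n :: nat and f :: 'm
  have lin: "\<phi> y \<in> linear_maps k (At P y) (At M y)" if "y \<in> Obj C" for y
    using \<phi> that by (simp add: cat_module_hom_def P_def)
  have e_closed: "e n f \<in> carrier (At P y)" if "f \<in> Hom C (xs ! n) y" for n f y
  proof -
    have "{g. (m = n \<longrightarrow> g = f) \<and> m = n \<and> \<one>\<^bsub>k\<^esub> \<noteq> \<zero>\<^bsub>k\<^esub>} \<subseteq> {f}" for m by auto
    then have "finite {g. (m = n \<longrightarrow> g = f) \<and> m = n \<and> \<one>\<^bsub>k\<^esub> \<noteq> \<zero>\<^bsub>k\<^esub>}" for m
      using finite_subset by blast
    then show ?thesis
      using that by (auto simp: P_def direct_sum_carrier e_def)
  qed
  define U where "U = (\<lambda>n. (xs ! n, \<phi> (xs ! n) (e n (Id C (xs ! n))))) ` {..<length xs}"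
  have xs_Obj: "xs ! n \<in> Obj C" if "n < length xs" for n using xs that by auto
  have e_Id: "e n (Id C (xs ! n)) \<in> carrier (At P (xs ! n))" if "n < length xs" for n
    by (rule e_closed[OF Id_closed[OF xs_Obj[OF that]]])
  have U: "U \<subseteq> (SIGMA x : Obj C. carrier (At M x))"
    using linear_mapsD(1)[OF lin] e_Id xs_Obj by (auto simp: U_def)
  have e_Act: "Act P f (e n (Id C (xs ! n))) = e n f" if "n < length xs" "f \<in> Hom C (xs ! n) y" for n f y
  proof -
    have D: "Dom C f = xs ! n" using that by (simp add: Hom_def)
    show ?thesis
    proof (rule extensionalityI[of _ "{..<length xs}"])
      fix m assume m: "m \<in> {..<length xs}"
      have "{g' \<in> Hom C (xs ! m) (Dom C f). e n (Id C (xs ! n)) m g' \<noteq> \<zero>\<^bsub>k\<^esub> \<and> Comp C f g' = g} =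
        (if m = n \<and> g = f then {Id C (xs ! n)} else {})" for g
        using Id_closed[OF xs_Obj[OF that(1)]] Comp_Id_right[OF that(2)] one m
        by (auto simp: e_def D split: if_splits)
      then show "Act P f (e n (Id C (xs ! n))) m = e n f m"
        using m by (auto simp: P_def direct_sum_Act fun_eq_iff) (auto simp: e_def)
    qed (auto simp: P_def direct_sum_Act e_def)
  qed
  show thesis
  proof (rule that[OF _ U])
    show "finite U" by (simp add: U_def)
    fix y assume y: "y \<in> Obj C"
    note G = cat_submodule_generated[OF U]
    have Gy: "submodule (generated k C M U y) k (At M y)" using G y by (simp add: cat_submodule_def)
    interpret My: module k "At M y" by (rule At_module[OF y])
    note l = linear_mapsD[OF lin[OF y]]
    \<comment> \<open>Induction on a finite set \<open>A\<close> containing the support; each step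
      either finds the coefficient at the new pair zero or splits off one basis element.\<close>
    have "\<phi> y c \<in> generated k C M U y"
      if "finite A" "c \<in> carrier (At P y)" "{(n, f). n < length xs \<and> c n f \<noteq> \<zero>\<^bsub>k\<^esub>} \<subseteq> A" for A c
      using that
    proof (induction A arbitrary: c rule: finite_induct)
      case empty
      have c: "c n f \<in> carrier k" if "n < length xs" for n f
        using empty.prems(1) that by (auto simp: P_def direct_sum_carrier)
      \<comment> \<open>Writing \<open>c\<close> as zero times itself gives
        \<open>\<phi> y c = 0\<close> from the compatibility of \<open>\<phi> y\<close> with
        scalars, without establishing module laws for \<open>At P y\<close>.\<close>
      have "c = \<zero>\<^bsub>k\<^esub> \<odot>\<^bsub>At P y\<^esub> c"
        unfolding P_def direct_sum_smult
      proof (rule extensionalityI[of _ "{..<length xs}"])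
        show "c n = (\<lambda>n \<in> {..<length xs}. \<lambda>f. \<zero>\<^bsub>k\<^esub> \<otimes>\<^bsub>k\<^esub> c n f) n" if "n \<in> {..<length xs}" for n
          using that empty.prems(2) c by (auto simp: fun_eq_iff)
      qed (use empty.prems(1) in \<open>auto simp: P_def direct_sum_carrier\<close>)
      then have "\<phi> y c = \<zero>\<^bsub>k\<^esub> \<odot>\<^bsub>At M y\<^esub> \<phi> y c"
        using l(3)[OF k.zero_closed empty.prems(1)] by metis
      also have "\<dots> = \<zero>\<^bsub>At M y\<^esub>" using l(1)[OF empty.prems(1)] by simp
      finally show ?case using My.submodule_zero[OF Gy] by simp
    next
      case (insert p A)
      obtain n f where p: "p = (n, f)" by (cases p)
      note carr = insert.prems(1)[unfolded P_def direct_sum_carrier, simplified]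
      show ?case
      proof (cases "n < length xs \<and> c n f \<noteq> \<zero>\<^bsub>k\<^esub>")
        case False
        then have "{(n, f). n < length xs \<and> c n f \<noteq> \<zero>\<^bsub>k\<^esub>} \<subseteq> A"
          using insert.prems(2) p by auto
        then show ?thesis by (rule insert.IH[OF insert.prems(1)])
      next
        case True
        then have n: "n < length xs" and f: "f \<in> Hom C (xs ! n) y" using carr by auto
        define d where "d = (\<lambda>m \<in> {..<length xs}. \<lambda>g. if m = n \<and> g = f then \<zero>\<^bsub>k\<^esub> else c m g)"
        have "finite {g. d m g \<noteq> \<zero>\<^bsub>k\<^esub>}" if "m < length xs" for m
          by (rule finite_subset[of _ "{g. c m g \<noteq> \<zero>\<^bsub>k\<^esub>}"])
            (use that carr in \<open>auto simp: d_def split: if_splits\<close>)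
        moreover have "d \<in> extensional {..<length xs}" by (simp add: d_def)
        moreover have "d m g \<in> carrier k" "g \<notin> Hom C (xs ! m) y \<Longrightarrow> d m g = \<zero>\<^bsub>k\<^esub>"
          if "m < length xs" for m g using that carr by (auto simp: d_def)
        ultimately have d: "d \<in> carrier (At P y)" unfolding P_def direct_sum_carrier by blast
        have "{(n, f). n < length xs \<and> d n f \<noteq> \<zero>\<^bsub>k\<^esub>} \<subseteq> A"
          using insert.prems(2) p by (auto simp: d_def split: if_splits)
        then have "\<phi> y d \<in> generated k C M U y" by (rule insert.IH[OF d])
        moreover have "\<phi> y (e n f) \<in> generated k C M U y"
        proof -
          have "\<phi> y (e n f) = Act M f (\<phi> (xs ! n) (e n (Id C (xs ! n))))"
            using \<phi> e_Act[OF n f] e_Id[OF n] xs_Obj[OF n] y f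
            unfolding cat_module_hom_def P_def[symmetric] by metis
          moreover have "\<phi> (xs ! n) (e n (Id C (xs ! n))) \<in> generated k C M U (xs ! n)"
            by (rule in_generated[OF U]) (use n in \<open>auto simp: U_def\<close>)
          ultimately show ?thesis
            using G xs_Obj[OF n] y f unfolding cat_submodule_def by blast
        qed
        moreover have cnf: "c n f \<in> carrier k" using carr n by simp
        ultimately have "c n f \<odot>\<^bsub>At M y\<^esub> \<phi> y (e n f) \<oplus>\<^bsub>At M y\<^esub> \<phi> y d \<in> generated k C M U y"
          using My.submoduleE(4,5)[OF Gy] by blast
        moreover have "c = c n f \<odot>\<^bsub>At P y\<^esub> e n f \<oplus>\<^bsub>At P y\<^esub> d"
          unfolding P_def direct_sum_add direct_sum_smult
        proof (rule extensionalityI[of _ "{..<length xs}"])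
          show "c m = (\<lambda>n' \<in> {..<length xs}. \<lambda>g. (\<lambda>n' \<in> {..<length xs}. \<lambda>g. c n f \<otimes>\<^bsub>k\<^esub> e n f n' g) n' g \<oplus>\<^bsub>k\<^esub> d n' g) m"
            if "m \<in> {..<length xs}" for m
            using that carr cnf by (auto simp: e_def d_def fun_eq_iff)
        qed (use carr in auto)
        moreover have smult: "c n f \<odot>\<^bsub>At P y\<^esub> e n f \<in> carrier (At P y)"
        proof -
          have "{g. c n f \<otimes>\<^bsub>k\<^esub> e n f m g \<noteq> \<zero>\<^bsub>k\<^esub>} \<subseteq> {f}" if "m < length xs" for m
            using that cnf by (auto simp: e_def split: if_splits)
          then have "finite {g. c n f \<otimes>\<^bsub>k\<^esub> e n f m g \<noteq> \<zero>\<^bsub>k\<^esub>}" if "m < length xs" for m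
            using that finite_subset by blast
          then show ?thesis
            using e_closed[OF f] cnf
            by (simp add: P_def direct_sum_smult direct_sum_carrier)
        qed
        ultimately show ?thesis
          using l(2)[OF smult d] l(3)[OF cnf e_closed[OF f]] by simp
      qed
    qed
    moreover have "finite {(n, f). n < length xs \<and> c n f \<noteq> \<zero>\<^bsub>k\<^esub>}" if "c \<in> carrier (At P y)" for c
    proof -
      have "{(n, f). n < length xs \<and> c n f \<noteq> \<zero>\<^bsub>k\<^esub>} = (SIGMA n : {..<length xs}. {f. c n f \<noteq> \<zero>\<^bsub>k\<^esub>})"
        by auto
      then show ?thesis using that by (auto simp: P_def direct_sum_carrier)
    qed
    ultimately have "\<phi> y ` carrier (At P y) \<subseteq> generated k C M U y" by blast
    then show "generated k C M U y = carrier (At M y)"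
      using surj[OF y] My.submoduleE(1)[OF Gy] by (simp add: P_def)
  qed
qed

text \<open>The map sends a coefficient family to the corresponding combination of the translates
  \<open>Act M f u\<close>. Naturality is a regrouping: after composing with \<open>h\<close>,
  coefficients of pairs with the same composite are added, and in \<open>M\<close> the corresponding
  translates coincide.\<close>

lemma generated_imp_finitely_generated:
  assumes "finite U" and U: "U \<subseteq> (SIGMA x : Obj C. carrier (At M x))"
    and gen: "\<And>y. y \<in> Obj C \<Longrightarrow> generated k C M U y = carrier (At M y)"
  shows "finitely_generated k C M"
proof -
  obtain us where us: "set us = U" using finite_list[OF assms(1)] by blast
  define xs where "xs = map fst us"
  have len: "length us = length xs" by (simp add: xs_def)
  have us_nth: "snd (us ! n) \<in> carrier (At M (xs ! n))" if "n < length xs" for n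
  proof -
    have "us ! n \<in> (SIGMA x : Obj C. carrier (At M x))" using that us len U by (metis nth_mem subsetD)
    moreover have "xs ! n = fst (us ! n)" using that by (simp add: xs_def)
    ultimately show ?thesis by (cases "us ! n") simp
  qed
  define S where "S y = (SIGMA n : {..<length xs}. Hom C (xs ! n) y)" for y
  define v where "v = (\<lambda>(n, f). Act M f (snd (us ! n)))"
  define P where "P = direct_sum (map (principal_module k C) xs)"
  define \<phi> where "\<phi> y c = lin_comb k (At M y) (S y) v (case_prod c)" for y c
  have v: "v \<in> S y \<rightarrow> carrier (At M y)" for y
    using Act_closed[OF _ us_nth] by (auto simp: S_def v_def)
  have supp: "finite {s \<in> S y. case_prod c s \<noteq> \<zero>\<^bsub>k\<^esub>}" "case_prod c \<in> S y \<rightarrow> carrier k"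
    if "c \<in> carrier (At P y)" for c y
  proof -
    have "{s \<in> S y. case_prod c s \<noteq> \<zero>\<^bsub>k\<^esub>} \<subseteq> (SIGMA n : {..<length xs}. {f. c n f \<noteq> \<zero>\<^bsub>k\<^esub>})"
      by (auto simp: S_def)
    then show "finite {s \<in> S y. case_prod c s \<noteq> \<zero>\<^bsub>k\<^esub>}"
      by (rule finite_subset) (use that in \<open>auto simp: P_def direct_sum_carrier\<close>)
    show "case_prod c \<in> S y \<rightarrow> carrier k" using that by (auto simp: P_def direct_sum_carrier S_def)
  qed
  have cong: "lin_comb k (At M y) (S y) v c = lin_comb k (At M y) (S y) v d"
    if "y \<in> Obj C" "\<And>s. s \<in> S y \<Longrightarrow> c s = d s" "d \<in> S y \<rightarrow> carrier k" for y c d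
  proof -
    interpret My: module k "At M y" by (rule At_module[OF that(1)])
    show ?thesis unfolding lin_comb_def
      by (rule My.finsum_cong') (use that v[of y] in \<open>auto simp: Pi_iff\<close>)
  qed
  have lin: "\<phi> y \<in> linear_maps k (At P y) (At M y)" if y: "y \<in> Obj C" for y
  proof -
    interpret My: module k "At M y" by (rule At_module[OF y])
    show ?thesis unfolding linear_maps_def
    proof (intro CollectI conjI ballI funcsetI)
      show "\<phi> y c \<in> carrier (At M y)" if "c \<in> carrier (At P y)" for c
        unfolding \<phi>_def by (rule My.lin_comb_closed[OF v supp(2)[OF that]])
      fix c d assume c: "c \<in> carrier (At P y)" and d: "d \<in> carrier (At P y)"
      have "\<phi> y (c \<oplus>\<^bsub>At P y\<^esub> d) = lin_comb k (At M y) (S y) v (\<lambda>s. case_prod c s \<oplus>\<^bsub>k\<^esub> case_prod d s)"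
        unfolding \<phi>_def
        by (rule cong[OF y]) (use supp(2)[OF c] supp(2)[OF d] in
            \<open>auto simp: P_def direct_sum_add S_def Pi_iff\<close>)
      then show "\<phi> y (c \<oplus>\<^bsub>At P y\<^esub> d) = \<phi> y c \<oplus>\<^bsub>At M y\<^esub> \<phi> y d"
        using My.lin_comb_add[OF supp(1)[OF c] supp(1)[OF d] v supp(2)[OF c] supp(2)[OF d]]
        by (simp add: \<phi>_def)
    next
      fix a c assume a: "a \<in> carrier k" and c: "c \<in> carrier (At P y)"
      have "\<phi> y (a \<odot>\<^bsub>At P y\<^esub> c) = lin_comb k (At M y) (S y) v (\<lambda>s. a \<otimes>\<^bsub>k\<^esub> case_prod c s)"
        unfolding \<phi>_def
        by (rule cong[OF y]) (use a supp(2)[OF c] in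
            \<open>auto simp: P_def direct_sum_smult S_def Pi_iff\<close>)
      then show "\<phi> y (a \<odot>\<^bsub>At P y\<^esub> c) = a \<odot>\<^bsub>At M y\<^esub> \<phi> y c"
        using My.lin_comb_smult[OF supp(1)[OF c] v supp(2)[OF c] a] by (simp add: \<phi>_def)
    qed
  qed
  have nat: "\<phi> z (Act P h c) = Act M h (\<phi> y c)"
    if yz: "y \<in> Obj C" "z \<in> Obj C" and h: "h \<in> Hom C y z" and c: "c \<in> carrier (At P y)" for y z h c
  proof -
    interpret My: module k "At M y" by (rule At_module[OF yz(1)])
    interpret Mz: module k "At M z" by (rule At_module[OF yz(2)])
    define A where "A = {s \<in> S y. case_prod c s \<noteq> \<zero>\<^bsub>k\<^esub>}"
    define p where "p = (\<lambda>(n :: nat, f). (n, Comp C h f))"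
    have A: "finite A" "A \<subseteq> S y" using supp(1)[OF c] by (auto simp: A_def)
    have pA: "p ` A \<subseteq> S z" using A Comp_closed[OF _ h] by (auto simp: p_def S_def)
    have cA: "case_prod c s \<in> carrier k" if "s \<in> A" for s using supp(2)[OF c] A that by auto
    have vp: "v (p a) \<in> carrier (At M z)" if "a \<in> A" for a using that pA v by blast
    have va: "v a \<in> carrier (At M y)" if "a \<in> A" for a using that A v by blast
    have D: "Dom C h = y" using h by (simp add: Hom_def)
    have coeff: "case_prod (Act P h c) b = (\<Oplus>\<^bsub>k\<^esub>a\<in>{a \<in> A. p a = b}. case_prod c a)"
      if "b \<in> S z" for b
    proof -
      obtain n g where b: "b = (n, g)" by (cases b)
      then have n: "n < length xs" using that by (auto simp: S_def)
      let ?F = "{f \<in> Hom C (xs ! n) y. c n f \<noteq> \<zero>\<^bsub>k\<^esub> \<and> Comp C h f = g}"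
      have "{a \<in> A. p a = b} = Pair n ` ?F" using n by (auto simp: A_def p_def b S_def)
      moreover have "case_prod c \<in> Pair n ` ?F \<rightarrow> carrier k"
        using n c by (auto simp: P_def direct_sum_carrier)
      ultimately have "(\<Oplus>\<^bsub>k\<^esub>a\<in>{a \<in> A. p a = b}. case_prod c a) = (\<Oplus>\<^bsub>k\<^esub>f\<in>?F. c n f)"
        by (simp add: k.finsum_reindex inj_on_def)
      then show ?thesis using n by (simp add: b P_def direct_sum_Act D)
    qed
    have coeff_zero: "case_prod (Act P h c) b = \<zero>\<^bsub>k\<^esub>" if "b \<in> S z" "b \<notin> p ` A" for b
    proof -
      have "{a \<in> A. p a = b} = {}" using that by auto
      then show ?thesis using coeff[OF that(1)] by (simp only: k.finsum_empty)
    qed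
    have cl: "(\<Oplus>\<^bsub>k\<^esub>a\<in>{a \<in> A. p a = b}. case_prod c a) \<in> carrier k" for b
      by (rule k.finsum_closed) (use cA in auto)
    have "\<phi> z (Act P h c) = (\<Oplus>\<^bsub>At M z\<^esub>b\<in>p ` A. case_prod (Act P h c) b \<odot>\<^bsub>At M z\<^esub> v b)"
      unfolding \<phi>_def
    proof (rule Mz.lin_comb_eq[OF _ _ pA v])
      show "case_prod (Act P h c) \<in> S z \<rightarrow> carrier k" by (rule funcsetI) (simp only: coeff cl)
    qed (use A coeff_zero in auto)
    also have "\<dots> = (\<Oplus>\<^bsub>At M z\<^esub>b\<in>p ` A. \<Oplus>\<^bsub>At M z\<^esub>a\<in>{a \<in> A. p a = b}. case_prod c a \<odot>\<^bsub>At M z\<^esub> v (p a))"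
    proof (rule Mz.finsum_cong'[OF refl])
      show "(\<lambda>b. \<Oplus>\<^bsub>At M z\<^esub>a\<in>{a \<in> A. p a = b}. case_prod c a \<odot>\<^bsub>At M z\<^esub> v (p a)) \<in> p ` A \<rightarrow> carrier (At M z)"
        by (intro funcsetI Mz.finsum_closed) (use cA vp in auto)
      fix b assume b: "b \<in> p ` A"
      then have bS: "b \<in> S z" and vb: "v b \<in> carrier (At M z)" using pA v by auto
      have "case_prod (Act P h c) b \<odot>\<^bsub>At M z\<^esub> v b =
          (\<Oplus>\<^bsub>At M z\<^esub>a\<in>{a \<in> A. p a = b}. case_prod c a \<odot>\<^bsub>At M z\<^esub> v b)"
        unfolding coeff[OF bS] by (rule Mz.finsum_smult_rdistr) (use A cA vb in auto)
      also have "\<dots> = (\<Oplus>\<^bsub>At M z\<^esub>a\<in>{a \<in> A. p a = b}. case_prod c a \<odot>\<^bsub>At M z\<^esub> v (p a))"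
        by (rule Mz.finsum_cong') (use cA vp in auto)
      finally show "case_prod (Act P h c) b \<odot>\<^bsub>At M z\<^esub> v b =
        (\<Oplus>\<^bsub>At M z\<^esub>a\<in>{a \<in> A. p a = b}. case_prod c a \<odot>\<^bsub>At M z\<^esub> v (p a))" .
    qed
    also have "\<dots> = (\<Oplus>\<^bsub>At M z\<^esub>a\<in>A. case_prod c a \<odot>\<^bsub>At M z\<^esub> v (p a))"
      by (rule Mz.finsum_fibers[OF A(1)]) (use cA vp in auto)
    also have "\<dots> = (\<Oplus>\<^bsub>At M z\<^esub>a\<in>A. Act M h (case_prod c a \<odot>\<^bsub>At M y\<^esub> v a))"
    proof (rule Mz.finsum_cong'[OF refl])
      note l = linear_mapsD[OF Act_linear[OF h]]
      show "(\<lambda>a. Act M h (case_prod c a \<odot>\<^bsub>At M y\<^esub> v a)) \<in> A \<rightarrow> carrier (At M z)"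
        using va cA l(1) by auto
      fix a assume a: "a \<in> A"
      obtain n f where nf: "a = (n, f)" by (cases a)
      then have n: "n < length xs" and f: "f \<in> Hom C (xs ! n) y" using a A by (auto simp: S_def)
      have "v (p a) = Act M h (v a)"
        using Act_Comp[OF f h us_nth[OF n]] by (simp add: v_def p_def nf)
      then show "case_prod c a \<odot>\<^bsub>At M z\<^esub> v (p a) = Act M h (case_prod c a \<odot>\<^bsub>At M y\<^esub> v a)"
        using l(3)[OF cA[OF a] va[OF a]] by simp
    qed
    also have "\<dots> = Act M h (\<Oplus>\<^bsub>At M y\<^esub>a\<in>A. case_prod c a \<odot>\<^bsub>At M y\<^esub> v a)"
      by (rule linear_maps_finsum[symmetric, OF At_module[OF yz(1), THEN module_imp_left_module]
          At_module[OF yz(2), THEN module_imp_left_module] Act_linear[OF h] A(1)])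
        (use A va cA in auto)
    finally show ?thesis by (simp add: \<phi>_def lin_comb_def A_def)
  qed
  have surj: "\<phi> y ` carrier (At P y) = carrier (At M y)" if y: "y \<in> Obj C" for y
  proof
    show "\<phi> y ` carrier (At P y) \<subseteq> carrier (At M y)" using linear_mapsD(1)[OF lin[OF y]] by blast
    interpret My: module k "At M y" by (rule At_module[OF y])
    have T: "{Act M f u |x u f. (x, u) \<in> U \<and> f \<in> Hom C x y} \<subseteq> v ` S y"
    proof
      fix t assume "t \<in> {Act M f u |x u f. (x, u) \<in> U \<and> f \<in> Hom C x y}"
      then obtain x u f where t: "t = Act M f u" "(x, u) \<in> set us" "f \<in> Hom C x y" using us by blast
      then obtain n where n: "n < length us" "us ! n = (x, u)" by (auto simp: in_set_conv_nth)
      then have "(n, f) \<in> S y" "v (n, f) = t" using t by (auto simp: S_def v_def xs_def)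
      then show "t \<in> v ` S y" by blast
    qed
    show "carrier (At M y) \<subseteq> \<phi> y ` carrier (At P y)"
    proof
      fix w assume "w \<in> carrier (At M y)"
      then have "w \<in> lin_span k (At M y) (v ` S y)"
        using gen[OF y] lin_span_mono[OF T] unfolding generated_def by blast
      from My.lin_span_imp_lin_comb[OF v this] obtain c where c: "\<And>s. c s \<in> carrier k"
        "finite {s. c s \<noteq> \<zero>\<^bsub>k\<^esub>}" "\<And>s. s \<notin> S y \<Longrightarrow> c s = \<zero>\<^bsub>k\<^esub>" "w = lin_comb k (At M y) (S y) v c"
        by metis
      define d where "d = (\<lambda>n \<in> {..<length xs}. \<lambda>f. c (n, f))"
      have "finite {f. c (n, f) \<noteq> \<zero>\<^bsub>k\<^esub>}" for n
        using finite_vimageI[OF c(2), of "Pair n"] by (simp add: vimage_def inj_on_def)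
      then have "d \<in> carrier (At P y)"
        using c(1,3) by (auto simp: P_def direct_sum_carrier d_def S_def)
      moreover have "\<phi> y d = w"
        unfolding \<phi>_def c(4) by (rule cong[OF y]) (use c(1) in \<open>auto simp: d_def S_def\<close>)
      ultimately show "w \<in> \<phi> y ` carrier (At P y)" by blast
    qed
  qed
  have "is_quotient_of k C M P"
    unfolding is_quotient_of_def cat_module_hom_def
    by (intro exI[of _ \<phi>]) (use lin nat surj in auto)
  moreover have "set xs \<subseteq> Obj C" using U us by (auto simp: xs_def)
  ultimately show ?thesis unfolding finitely_generated_def P_def by blast
qed

text \<open>The Hilbert basis argument: were \<open>N\<close> not finitely generated, one could choose successively
  \<open>x\<^sub>n\<close> outside the submodule generated by \<open>x\<^sub>0, \<dots>, x\<^bsub>n-1\<^esub>\<close> with minimal leading term. If the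
  leading coefficient of \<open>x\<^sub>n\<close> lies in the ideal generated by those of the earlier \<open>x\<^sub>i\<close> whose
  leading term divides that of \<open>x\<^sub>n\<close>, then the leading term can be cancelled.\<close>

lemma submodule_generated_finite:
  assumes k: "noetherian_ring k"
    and noeth: "\<And>x. x \<in> Obj C \<Longrightarrow> noetherian_on (arrows_from C (Obj C) x) (arrow_le C)"
    and wf: "wf lt" and trans: "trans lt"
    and total: "\<And>x y. total_on (Hom C x y) lt"
    and compat: "\<And>f g h x y z. f \<in> Hom C x y \<Longrightarrow> g \<in> Hom C x y \<Longrightarrow> h \<in> Hom C y z \<Longrightarrow>
      (f, g) \<in> lt \<Longrightarrow> (Comp C h f, Comp C h g) \<in> lt"
    and "finite U" and U: "U \<subseteq> (SIGMA x : Obj C. carrier (At M x))"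
    and gen: "\<And>y. y \<in> Obj C \<Longrightarrow> generated k C M U y = carrier (At M y)"
    and N: "cat_submodule k C M N"
  obtains X where "finite X" "X \<subseteq> (SIGMA x : Obj C. N x)"
    "\<And>y. y \<in> Obj C \<Longrightarrow> generated k C M X y = N y"
proof (rule ccontr)
  assume "\<not> thesis"
  then have not_gen: "\<exists>y \<in> Obj C. generated k C M X y \<noteq> N y"
    if "finite X" "X \<subseteq> (SIGMA x : Obj C. N x)" for X
    using that \<open>finite X \<Longrightarrow> X \<subseteq> (SIGMA x : Obj C. N x) \<Longrightarrow>
      (\<And>y. y \<in> Obj C \<Longrightarrow> generated k C M X y = N y) \<Longrightarrow> thesis\<close> by blast
  obtain us where us: "set us = U" using finite_list[OF \<open>finite U\<close>] by blast
  \<comment> \<open>\<open>T y\<close> indexes the monomials at \<open>y\<close> by a generator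
    number and an arrow out of its object; \<open>ev\<close> evaluates them and \<open>L y t\<close>
    is spanned by those strictly below \<open>t\<close>. Since \<open>ev\<close> need not be
    injective, leading terms always refer to a chosen expression.\<close>
  define T where "T y = {(t, g). t < length us \<and> g \<in> Hom C (fst (us ! t)) y}" for y
  define r where "r = less_than <*lex*> lt"
  define ev where "ev = (\<lambda>(t, g). Act M g (snd (us ! t)))"
  define L where "L y t = lin_span k (At M y) (ev ` {s \<in> T y. (s, t) \<in> r})" for y t
  have us_nth: "fst (us ! t) \<in> Obj C" "snd (us ! t) \<in> carrier (At M (fst (us ! t)))"
    if "t < length us" for t
  proof -
    have "us ! t \<in> (SIGMA x : Obj C. carrier (At M x))" using that us U by (metis nth_mem subsetD)
    then show "fst (us ! t) \<in> Obj C" "snd (us ! t) \<in> carrier (At M (fst (us ! t)))"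
      by (cases "us ! t", simp)+
  qed
  have ev: "ev ` T y \<subseteq> carrier (At M y)" for y
    using Act_closed us_nth(2) by (auto simp: ev_def T_def)
  have evL: "ev ` {s \<in> T y. (s, t) \<in> r} \<subseteq> carrier (At M y)" for y t using ev by blast
  have wf_r: "wf r" unfolding r_def by (intro wf_lex_prod wf_less_than wf)
  have trans_r: "trans r" unfolding r_def by (intro trans_lex_prod trans_less_than trans)
  have total_r: "total_on (T y) r" for y
  proof (rule total_onI)
    fix s t assume st: "s \<in> T y" "t \<in> T y" "s \<noteq> t"
    obtain i f j g where ij: "s = (i, f)" "t = (j, g)" by (cases s, cases t)
    show "(s, t) \<in> r \<or> (t, s) \<in> r"
    proof (cases "i = j")
      case True
      then have "f \<in> Hom C (fst (us ! i)) y" "g \<in> Hom C (fst (us ! i)) y" "f \<noteq> g"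
        using st ij by (auto simp: T_def)
      then have "(f, g) \<in> lt \<or> (g, f) \<in> lt" using total unfolding total_on_def by blast
      then show ?thesis using True by (auto simp: ij r_def)
    next
      case False then show ?thesis by (auto simp: ij r_def)
    qed
  qed
  have span_T: "carrier (At M y) \<subseteq> lin_span k (At M y) (ev ` T y)" if y: "y \<in> Obj C" for y
  proof -
    have "{Act M f u |x u f. (x, u) \<in> U \<and> f \<in> Hom C x y} \<subseteq> ev ` T y"
    proof
      fix v assume "v \<in> {Act M f u |x u f. (x, u) \<in> U \<and> f \<in> Hom C x y}"
      then obtain x u f where v: "v = Act M f u" "(x, u) \<in> set us" "f \<in> Hom C x y" using us by blast
      then obtain n where n: "n < length us" "us ! n = (x, u)" by (auto simp: in_set_conv_nth)
      then have "(n, f) \<in> T y" "ev (n, f) = v" using v by (auto simp: T_def ev_def)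
      then show "v \<in> ev ` T y" by blast
    qed
    then show ?thesis using gen[OF y] lin_span_mono unfolding generated_def by blast
  qed
  \<comment> \<open>The data chosen at each stage: an object, an element of \<open>N\<close> not yet
    generated, its leading monomial and its leading coefficient. The last clause is minimality:
    elements of \<open>N y\<close> that need only smaller monomials are already generated.\<close>
  define R where "R X = (\<lambda>(y, x, t, a). y \<in> Obj C \<and> x \<in> N y \<and> x \<notin> generated k C M X y \<and> t \<in> T y \<and>
    a \<in> carrier k \<and> (\<exists>x' \<in> L y t. x = a \<odot>\<^bsub>At M y\<^esub> ev t \<oplus>\<^bsub>At M y\<^esub> x') \<and>
    (\<forall>z \<in> N y \<inter> L y t. z \<in> generated k C M X y))" for X
  have step: "\<exists>p. R X p" if X: "finite X" "X \<subseteq> (SIGMA x : Obj C. N x)" for X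
  proof -
    obtain y where y: "y \<in> Obj C" "generated k C M X y \<noteq> N y" using not_gen[OF X] by blast
    interpret My: module k "At M y" by (rule At_module[OF y(1)])
    have X': "X \<subseteq> (SIGMA x : Obj C. carrier (At M x))"
      using X(2) cat_submodule_carrier[OF N] by blast
    have Ny: "N y \<subseteq> carrier (At M y)" by (rule cat_submodule_carrier[OF N y(1)])
    have "submodule (generated k C M X y) k (At M y)"
      using cat_submodule_generated[OF X'] y(1) by (simp add: cat_submodule_def)
    note zero = My.submodule_zero[OF this]
    define B where "B t = ev ` {s \<in> T y. s = t \<or> (s, t) \<in> r}" for t
    have bounded: "\<exists>t \<in> A. x \<in> lin_span k (At M y) (B t)"
      if x: "x \<in> lin_span k (At M y) (ev ` A)" and A: "A \<subseteq> T y" and nz: "x \<noteq> \<zero>\<^bsub>At M y\<^esub>" for x A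
    proof -
      have "ev ` A \<subseteq> carrier (At M y)" using ev A by blast
      moreover have "total_on A r" using total_r A by (rule total_on_subset)
      ultimately obtain t where t: "t \<in> A" "x \<in> lin_span k (At M y) (ev ` {s \<in> A. s = t \<or> (s, t) \<in> r})"
        using My.lin_span_leading_term[OF _ trans_r _ x] nz by blast
      have "ev ` {s \<in> A. s = t \<or> (s, t) \<in> r} \<subseteq> B t" using A by (auto simp: B_def)
      then show ?thesis using lin_span_mono t by blast
    qed
    \<comment> \<open>The monomials that bound some element of \<open>N y\<close> not yet generated.
      A minimal one is the \<open>t\<close> of the new datum.\<close>
    define Q where "Q = {t \<in> T y. \<exists>x \<in> N y - generated k C M X y. x \<in> lin_span k (At M y) (B t)}"
    have "N y - generated k C M X y \<noteq> {}"
      using generated_least[OF N X(2) y(1)] y(2) by blast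
    then obtain x where x: "x \<in> N y - generated k C M X y" by blast
    then have "x \<in> lin_span k (At M y) (ev ` T y)" "x \<noteq> \<zero>\<^bsub>At M y\<^esub>"
      using span_T[OF y(1)] Ny zero by blast+
    from bounded[OF this(1) subset_refl this(2)] x have "Q \<noteq> {}" unfolding Q_def by blast
    then obtain t where t: "t \<in> Q" "\<And>s. (s, t) \<in> r \<Longrightarrow> s \<notin> Q"
      using wf_r unfolding wf_eq_minimal by blast
    then obtain w where w: "w \<in> N y - generated k C M X y" "w \<in> lin_span k (At M y) (B t)" "t \<in> T y"
      unfolding Q_def by blast
    have "B t = insert (ev t) (ev ` {s \<in> T y. (s, t) \<in> r})" using w(3) by (auto simp: B_def)
    then obtain a w' where a: "a \<in> carrier k" "w' \<in> L y t" "w = a \<odot>\<^bsub>At M y\<^esub> ev t \<oplus>\<^bsub>At M y\<^esub> w'"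
      using My.lin_span_insert[of "ev t" "ev ` {s \<in> T y. (s, t) \<in> r}" w] w(2,3) ev[of y]
      unfolding L_def by (metis (no_types, lifting) evL image_subset_iff insert_subset)
    have "z \<in> generated k C M X y" if z: "z \<in> N y" "z \<in> L y t" for z
    proof (rule ccontr)
      assume "z \<notin> generated k C M X y"
      then have "z \<noteq> \<zero>\<^bsub>At M y\<^esub>" using zero by blast
      then obtain s where s: "s \<in> T y" "(s, t) \<in> r" "z \<in> lin_span k (At M y) (B s)"
        using bounded[of z "{s \<in> T y. (s, t) \<in> r}"] z(2) unfolding L_def by blast
      then have "s \<in> Q" using s(1) z(1) \<open>z \<notin> generated k C M X y\<close> unfolding Q_def using s(3) by blast
      then show False using t(2) s(2) by simp
    qed
    then have "R X (y, w, t, a)" using y(1) w a unfolding R_def by blast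
    then show ?thesis by blast
  qed
  define X where "X f n = (\<lambda>i. (fst (f i), fst (snd (f i)))) ` {..<n}"
    for f :: "nat \<Rightarrow> 'o \<times> 'a \<times> (nat \<times> 'm) \<times> 'k" and n
  \<comment> \<open>The condition on each datum involves all earlier ones through
    \<open>X f n\<close>, hence a choice principle along the well-order of the naturals.\<close>
  have "\<exists>f. \<forall>n. R (X f n) (f n)"
  proof (rule dependent_wellorder_choice)
    fix p n and f g :: "nat \<Rightarrow> 'o \<times> 'a \<times> (nat \<times> 'm) \<times> 'k"
    assume "\<And>i. i < n \<Longrightarrow> f i = g i"
    then have "X f n = X g n" unfolding X_def by (intro image_cong) auto
    then show "R (X f n) p = R (X g n) p" by simp
  next
    fix n and f :: "nat \<Rightarrow> 'o \<times> 'a \<times> (nat \<times> 'm) \<times> 'k"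
    assume *: "\<And>i. i < n \<Longrightarrow> R (X f i) (f i)"
    have "(fst (f i), fst (snd (f i))) \<in> (SIGMA x : Obj C. N x)" if "i < n" for i
      using *[OF that] by (cases "f i") (auto simp: R_def)
    then have "X f n \<subseteq> (SIGMA x : Obj C. N x)" by (auto simp: X_def)
    then show "\<exists>p. R (X f n) p" by (intro step) (simp add: X_def)
  qed
  then obtain f where f: "\<And>n. R (X f n) (f n)" by blast
  define y where "y n = fst (f n)" for n
  define x where "x n = fst (snd (f n))" for n
  define t where "t n = fst (snd (snd (f n)))" for n
  define a where "a n = snd (snd (snd (f n)))" for n
  define Y where "Y n = (\<lambda>i. (y i, x i)) ` {..<n}" for n
  have "f n = (y n, x n, t n, a n)" "X f n = Y n" for n
    by (simp_all add: y_def x_def t_def a_def X_def Y_def)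
  with f have Rn: "R (Y n) (y n, x n, t n, a n)" for n by metis
  have y: "y n \<in> Obj C" and x: "x n \<in> N (y n)" "x n \<notin> generated k C M (Y n) (y n)" and t: "t n \<in> T (y n)"
    and a: "a n \<in> carrier k"
    and lead: "\<exists>x' \<in> L (y n) (t n). x n = a n \<odot>\<^bsub>At M (y n)\<^esub> ev (t n) \<oplus>\<^bsub>At M (y n)\<^esub> x'"
    and least: "\<And>z. z \<in> N (y n) \<Longrightarrow> z \<in> L (y n) (t n) \<Longrightarrow> z \<in> generated k C M (Y n) (y n)" for n
    using Rn[of n] by (auto simp: R_def)
  have YN: "Y n \<subseteq> (SIGMA x : Obj C. N x)" for n using x y by (auto simp: Y_def)
  then have Y: "Y n \<subseteq> (SIGMA x : Obj C. carrier (At M x))" for n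
    using cat_submodule_carrier[OF N] by blast
  \<comment> \<open>Monomials at all objects together, compared by divisibility: same generator
    number, and one arrow a left multiple of the other.\<close>
  define S where "S = {(t, g). t < length us \<and> g \<in> arrows_from C (Obj C) (fst (us ! t))}"
  define leq where "leq = (\<lambda>(t :: nat, g) (t', g'). t = t' \<and> arrow_le C g g')"
  have noeth_S: "noetherian_on S leq"
    unfolding noetherian_on_def
  proof (intro allI impI)
    fix s :: "nat \<Rightarrow> nat \<times> 'm" assume s: "range s \<subseteq> S"
    have sS: "fst (s i) < length us" "snd (s i) \<in> arrows_from C (Obj C) (fst (us ! fst (s i)))" for i
      using subsetD[OF s rangeI, of i] by (simp_all add: S_def split_beta)
    have "finite ((\<lambda>i. fst (s i)) ` UNIV)"
      by (rule finite_subset[of _ "{..<length us}"]) (use sS(1) in auto)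
    \<comment> \<open>One generator number occurs infinitely often, and along it the arrows have a
      common source, where \<open>noeth\<close> applies.\<close>
    from pigeonhole_infinite[OF infinite_UNIV_nat this] obtain j where
      inf: "infinite {i. fst (s i) = fst (s j)}" by auto
    define e where "e = enumerate {i. fst (s i) = fst (s j)}"
    have e: "fst (s (e i)) = fst (s j)" "strict_mono e" for i
      using enumerate_in_set[OF inf, of i] strict_mono_enumerate[OF inf] by (auto simp: e_def)
    let ?x = "fst (us ! fst (s j))"
    have "range (\<lambda>i. snd (s (e i))) \<subseteq> arrows_from C (Obj C) ?x"
      using sS(2) e(1) by (metis image_subsetI)
    then obtain i i' where "i < i'" "arrow_le C (snd (s (e i))) (snd (s (e i')))"
      using noeth[OF us_nth(1)[OF sS(1)]] unfolding noetherian_on_def by blast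
    then have "e i < e i'" "leq (s (e i)) (s (e i'))"
      using e by (simp_all add: strict_mono_less leq_def split_beta)
    then show "\<exists>i j. i < j \<and> leq (s i) (s j)" by blast
  qed
  have arrows: "f \<in> Hom C z (Cod C f)" if "f \<in> arrows_from C (Obj C) z" for f z
    using that by (auto simp: arrows_from_def Hom_def)
  have "transp_on S leq"
  proof (rule transp_onI)
    fix s1 s2 s3 assume S: "s1 \<in> S" "s2 \<in> S" "s3 \<in> S" and le: "leq s1 s2" "leq s2 s3"
    from le obtain h h' where h: "h \<in> Hom C (Cod C (snd s1)) (Cod C (snd s2))" "snd s2 = Comp C h (snd s1)"
      "h' \<in> Hom C (Cod C (snd s2)) (Cod C (snd s3))" "snd s3 = Comp C h' (snd s2)" "fst s1 = fst s3"
      by (auto simp: leq_def arrow_le_def split_beta)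
    have s1: "snd s1 \<in> Hom C (fst (us ! fst s1)) (Cod C (snd s1))"
      using S(1) arrows by (auto simp: S_def)
    have "snd s3 = Comp C (Comp C h' h) (snd s1)"
      using Comp_assoc[OF s1 h(1,3)] h(2,4) by simp
    moreover have "Comp C h' h \<in> Hom C (Cod C (snd s1)) (Cod C (snd s3))"
      by (rule Comp_closed[OF h(1,3)])
    ultimately show "leq s1 s3" using h(5) by (auto simp: leq_def arrow_le_def split_beta)
  qed
  moreover have "range t \<subseteq> S"
  proof (rule image_subsetI)
    show "t n \<in> S" for n
      using t[of n] y[of n] by (cases "t n") (auto simp: S_def T_def arrows_from_def)
  qed
  ultimately have stop: "\<exists>n. a n \<in> genideal k {a i |i. i < n \<and> leq (t i) (t n)}"
    using noetherian_on_ideal_stop[OF k noeth_S, of t a] a by metis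
  then obtain n where n: "a n \<in> genideal k {a i |i. i < n \<and> leq (t i) (t n)}" by blast
  let ?M = "At M (y n)" and ?G = "generated k C M (Y n) (y n)"
  interpret Mn: module k ?M by (rule At_module[OF y])
  have G: "submodule ?G k ?M"
    using cat_submodule_generated[OF Y] y by (simp add: cat_submodule_def)
  have Ln: "submodule (L (y n) (t n)) k ?M" unfolding L_def by (rule Mn.submodule_lin_span[OF evL])
  have Gc: "?G \<subseteq> carrier ?M" and Lc: "L (y n) (t n) \<subseteq> carrier ?M"
    using Mn.submoduleE(1)[OF G] Mn.submoduleE(1)[OF Ln] by auto
  have evt: "ev (t i) \<in> carrier (At M (y i))" for i using ev t by blast
  \<comment> \<open>The possible coefficients at \<open>t n\<close>, modulo lower monomials, of
    elements generated by the earlier choices. This is an ideal containing the relevant earlier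
    leading coefficients, hence also \<open>a n\<close>.\<close>
  define I where "I = {b \<in> carrier k. \<exists>z \<in> ?G. \<exists>z' \<in> L (y n) (t n). z = b \<odot>\<^bsub>?M\<^esub> ev (t n) \<oplus>\<^bsub>?M\<^esub> z'}"
  have I_I: "b \<in> I" if "b \<in> carrier k" "b \<odot>\<^bsub>?M\<^esub> ev (t n) \<oplus>\<^bsub>?M\<^esub> z' \<in> ?G" "z' \<in> L (y n) (t n)" for b z'
    using that unfolding I_def by blast
  have smult_I: "c \<otimes>\<^bsub>k\<^esub> b \<in> I" if c: "c \<in> carrier k" and "b \<in> I" for b c
  proof -
    from that obtain z' where b: "b \<in> carrier k" "b \<odot>\<^bsub>?M\<^esub> ev (t n) \<oplus>\<^bsub>?M\<^esub> z' \<in> ?G" "z' \<in> L (y n) (t n)"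
      unfolding I_def by blast
    have "(c \<otimes>\<^bsub>k\<^esub> b) \<odot>\<^bsub>?M\<^esub> ev (t n) \<oplus>\<^bsub>?M\<^esub> c \<odot>\<^bsub>?M\<^esub> z' = c \<odot>\<^bsub>?M\<^esub> (b \<odot>\<^bsub>?M\<^esub> ev (t n) \<oplus>\<^bsub>?M\<^esub> z')"
      using b c evt Lc by (simp add: Mn.smult_r_distr Mn.smult_assoc1 subset_iff)
    then show ?thesis
      using I_I[of "c \<otimes>\<^bsub>k\<^esub> b" "c \<odot>\<^bsub>?M\<^esub> z'"] b c Mn.submoduleE(4)[OF G] Mn.submoduleE(4)[OF Ln] by simp
  qed
  have "ideal I k"
  proof (rule idealI[OF k.ring_axioms])
    show "subgroup I (add_monoid k)"
    proof (rule k.add.subgroupI)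
      show "I \<subseteq> carrier k" by (auto simp: I_def)
      have "\<zero>\<^bsub>k\<^esub> \<in> I"
        by (rule I_I[of _ "\<zero>\<^bsub>?M\<^esub>"]) (use Mn.submodule_zero[OF G] Mn.submodule_zero[OF Ln] evt in auto)
      then show "I \<noteq> {}" by blast
      show "\<ominus>\<^bsub>k\<^esub> b \<in> I" if "b \<in> I" for b
      proof -
        have "b \<in> carrier k" using that by (simp add: I_def)
        then show ?thesis using smult_I[OF _ that, of "\<ominus>\<^bsub>k\<^esub> \<one>\<^bsub>k\<^esub>"] by (simp add: k.l_minus)
      qed
      show "b \<oplus>\<^bsub>k\<^esub> c \<in> I" if "b \<in> I" "c \<in> I" for b c
      proof -
        from that obtain z' w' where
          b: "b \<in> carrier k" "b \<odot>\<^bsub>?M\<^esub> ev (t n) \<oplus>\<^bsub>?M\<^esub> z' \<in> ?G" "z' \<in> L (y n) (t n)" and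
          c: "c \<in> carrier k" "c \<odot>\<^bsub>?M\<^esub> ev (t n) \<oplus>\<^bsub>?M\<^esub> w' \<in> ?G" "w' \<in> L (y n) (t n)"
          unfolding I_def by blast
        have zw: "z' \<in> carrier ?M" "w' \<in> carrier ?M" using b c Lc by auto
        have "(b \<oplus>\<^bsub>k\<^esub> c) \<odot>\<^bsub>?M\<^esub> ev (t n) \<oplus>\<^bsub>?M\<^esub> (z' \<oplus>\<^bsub>?M\<^esub> w') =
          (b \<odot>\<^bsub>?M\<^esub> ev (t n) \<oplus>\<^bsub>?M\<^esub> z') \<oplus>\<^bsub>?M\<^esub> (c \<odot>\<^bsub>?M\<^esub> ev (t n) \<oplus>\<^bsub>?M\<^esub> w')"
          using b(1) c(1) zw evt by (simp add: Mn.smult_l_distr Mn.M.a_ac)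
        then show ?thesis
          using I_I[of "b \<oplus>\<^bsub>k\<^esub> c" "z' \<oplus>\<^bsub>?M\<^esub> w'"] b c Mn.submoduleE(5)[OF G] Mn.submoduleE(5)[OF Ln] by simp
      qed
    qed
    show "b \<otimes>\<^bsub>k\<^esub> c \<in> I" "c \<otimes>\<^bsub>k\<^esub> b \<in> I" if "b \<in> I" "c \<in> carrier k" for b c
    proof -
      show "c \<otimes>\<^bsub>k\<^esub> b \<in> I" using smult_I that by blast
      moreover have "b \<in> carrier k" using that by (simp add: I_def)
      ultimately show "b \<otimes>\<^bsub>k\<^esub> c \<in> I" using k.m_comm that(2) by metis
    qed
  qed
  \<comment> \<open>The arrow \<open>h\<close> that carries the monomial \<open>t i\<close> to
    \<open>t n\<close> maps \<open>x i\<close> to an element with the same coefficient at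
    \<open>t n\<close>; \<open>compat\<close> keeps the images of the lower monomials below
    \<open>t n\<close>.\<close>
  moreover have "a i \<in> I" if "i < n" "leq (t i) (t n)" for i
  proof -
    obtain m g where ti: "t i = (m, g)" by (cases "t i")
    with that(2) obtain g' h where tn: "t n = (m, g')" and h: "h \<in> Hom C (Cod C g) (Cod C g')" "g' = Comp C h g"
      by (cases "t n") (auto simp: leq_def arrow_le_def)
    have g: "m < length us" "g \<in> Hom C (fst (us ! m)) (y i)" and g': "g' \<in> Hom C (fst (us ! m)) (y n)"
      using t[of i] t[of n] by (auto simp: T_def ti tn)
    then have hy: "h \<in> Hom C (y i) (y n)" using h(1) by (simp add: Hom_def)
    obtain x' where x': "x' \<in> L (y i) (t i)" "x i = a i \<odot>\<^bsub>At M (y i)\<^esub> ev (t i) \<oplus>\<^bsub>At M (y i)\<^esub> x'"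
      using lead[of i] by blast
    interpret Mi: module k "At M (y i)" by (rule At_module[OF y])
    have x'c: "x' \<in> carrier (At M (y i))" using x'(1) Mi.lin_span_closed[OF evL] by (simp add: L_def)
    note l = linear_mapsD[OF Act_linear[OF hy]]
    have "Act M h (x i) = a i \<odot>\<^bsub>?M\<^esub> Act M h (ev (t i)) \<oplus>\<^bsub>?M\<^esub> Act M h x'"
      using a evt x'c by (simp add: x'(2) l(2,3))
    also have "Act M h (ev (t i)) = ev (t n)"
      using Act_Comp[OF g(2) hy us_nth(2)[OF g(1)]] by (simp add: ev_def ti tn h(2))
    finally have "Act M h (x i) = a i \<odot>\<^bsub>?M\<^esub> ev (t n) \<oplus>\<^bsub>?M\<^esub> Act M h x'" .
    moreover have "Act M h x' \<in> L (y n) (t n)"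
      unfolding L_def
    proof (rule linear_maps_lin_span[OF At_module[OF y] At_module[OF y] Act_linear[OF hy] evL])
      show "x' \<in> lin_span k (At M (y i)) (ev ` {s \<in> T (y i). (s, t i) \<in> r})" using x'(1) by (simp add: L_def)
      show "Act M h ` ev ` {s \<in> T (y i). (s, t i) \<in> r} \<subseteq> ev ` {s \<in> T (y n). (s, t n) \<in> r}"
      proof clarify
        fix m' f assume s: "(m', f) \<in> T (y i)" "((m', f), t i) \<in> r"
        then have f: "m' < length us" "f \<in> Hom C (fst (us ! m')) (y i)" by (auto simp: T_def)
        have "Act M h (ev (m', f)) = ev (m', Comp C h f)"
          using Act_Comp[OF f(2) hy us_nth(2)[OF f(1)]] by (simp add: ev_def)
        moreover have "(m', Comp C h f) \<in> T (y n)" using f Comp_closed[OF f(2) hy] by (simp add: T_def)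
        moreover have "((m', Comp C h f), t n) \<in> r"
          using s(2) f compat[of f _ "y i" g h "y n"] g hy by (auto simp: r_def ti tn h(2))
        ultimately show "Act M h (ev (m', f)) \<in> ev ` {s \<in> T (y n). (s, t n) \<in> r}" by blast
      qed
    qed
    moreover have "Act M h (x i) \<in> ?G"
    proof -
      have "x i \<in> generated k C M (Y n) (y i)" by (rule in_generated[OF Y]) (use that in \<open>auto simp: Y_def\<close>)
      then show ?thesis using cat_submodule_generated[OF Y] y hy unfolding cat_submodule_def by blast
    qed
    ultimately show ?thesis using I_I[OF a] by simp
  qed
  then have "{a i |i. i < n \<and> leq (t i) (t n)} \<subseteq> I" by blast
  ultimately have "a n \<in> I" using n k.genideal_minimal by blast
  then obtain z z' where z: "z \<in> ?G" "z' \<in> L (y n) (t n)" "z = a n \<odot>\<^bsub>?M\<^esub> ev (t n) \<oplus>\<^bsub>?M\<^esub> z'"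
    unfolding I_def by blast
  obtain x' where x': "x' \<in> L (y n) (t n)" "x n = a n \<odot>\<^bsub>?M\<^esub> ev (t n) \<oplus>\<^bsub>?M\<^esub> x'"
    using lead[of n] by blast
  have c: "z \<in> carrier ?M" "z' \<in> carrier ?M" "x' \<in> carrier ?M" "x n \<in> carrier ?M"
    using z(1,2) x'(1) Gc Lc subsetD[OF cat_submodule_carrier[OF N y] x(1)] by blast+
  have Nn: "submodule (N (y n)) k ?M" using N y by (simp add: cat_submodule_def)
  \<comment> \<open>The leading terms cancel, so the difference lies in \<open>N\<close> and below
    \<open>t n\<close>. Minimality puts it, and with it \<open>x n\<close>, into the submodule
    generated by earlier choices.\<close>
  have "x n \<ominus>\<^bsub>?M\<^esub> z = x' \<ominus>\<^bsub>?M\<^esub> z'"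
    using a evt c by (simp add: x'(2) z(3) a_minus_def Mn.M.minus_add Mn.M.a_ac Mn.M.r_neg Mn.M.r_neg1 Mn.M.r_neg2)
  then have "x n \<ominus>\<^bsub>?M\<^esub> z \<in> L (y n) (t n)" using Mn.submodule_diff[OF Ln x'(1) z(2)] by simp
  moreover have "x n \<ominus>\<^bsub>?M\<^esub> z \<in> N (y n)"
    using Mn.submodule_diff[OF Nn x(1)] generated_least[OF N YN y] z(1) by blast
  ultimately have "x n \<ominus>\<^bsub>?M\<^esub> z \<in> ?G" by (rule least[rotated])
  then have "(x n \<ominus>\<^bsub>?M\<^esub> z) \<oplus>\<^bsub>?M\<^esub> z \<in> ?G" using Mn.submoduleE(5)[OF G] z(1) by blast
  moreover have "(x n \<ominus>\<^bsub>?M\<^esub> z) \<oplus>\<^bsub>?M\<^esub> z = x n"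
    using c by (simp add: a_minus_def Mn.M.a_assoc Mn.M.l_neg)
  ultimately show False using x(2) by simp
qed

end

section \<open>Transfer along functors with property (F)\<close>

definition pullback_module :: "('p \<Rightarrow> 'o) \<Rightarrow> ('n \<Rightarrow> 'm) \<Rightarrow> ('o, 'm, 'k, 'a) cat_module \<Rightarrow>
    ('p, 'n, 'k, 'a) cat_module" where
  "pullback_module FO FM M = \<lparr>At = (\<lambda>x. At M (FO x)), Act = (\<lambda>f. Act M (FM f))\<rparr>"

lemma pullback_module_simps [simp]:
  "At (pullback_module FO FM M) x = At M (FO x)" "Act (pullback_module FO FM M) f = Act M (FM f)"
  by (simp_all add: pullback_module_def)

context cat_functor
begin

lemma cat_module_pullback:
  assumes "cat_module k D M"
  shows "cat_module k C (pullback_module FO FM M)"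
proof -
  interpret M: cat_module k D M by fact
  show ?thesis
  proof (intro cat_module.intro source.category_axioms M.k.is_cring cat_module_axioms.intro)
    show "module k (At (pullback_module FO FM M) x)" if "x \<in> Obj C" for x
      using M.At_module FO_closed that by simp
    show "Act (pullback_module FO FM M) f
        \<in> linear_maps k (At (pullback_module FO FM M) x) (At (pullback_module FO FM M) y)"
      if "f \<in> Hom C x y" for f x y
      using M.Act_linear FM_closed that by simp
    show "Act (pullback_module FO FM M) (Id C x) u = u"
      if "x \<in> Obj C" "u \<in> carrier (At (pullback_module FO FM M) x)" for x u
      using M.Act_Id FO_closed FM_Id that by simp
    show "Act (pullback_module FO FM M) (Comp C g f) u =
        Act (pullback_module FO FM M) g (Act (pullback_module FO FM M) f u)"
      if "f \<in> Hom C x y" "g \<in> Hom C y z" "u \<in> carrier (At (pullback_module FO FM M) x)" for f g u x y z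
      using M.Act_Comp[OF FM_closed[OF that(1)] FM_closed[OF that(2)]] FM_Comp[OF that(1,2)] that(3) by simp
  qed
qed

lemma cat_submodule_pullback:
  assumes "cat_submodule k D M N"
  shows "cat_submodule k C (pullback_module FO FM M) (N \<circ> FO)"
  unfolding cat_submodule_def
proof (intro conjI ballI)
  fix x y f assume "x \<in> Obj C" "y \<in> Obj C" "f \<in> Hom C x y"
  then show "Act (pullback_module FO FM M) f ` (N \<circ> FO) x \<subseteq> (N \<circ> FO) y"
    using assms FO_closed FM_closed unfolding cat_submodule_def by simp
qed (use assms FO_closed in \<open>simp add: cat_submodule_def\<close>)

text \<open>An arrow from \<open>x\<close> to \<open>FO y\<close> factors by (F) as an arrow in the
  image of the functor after one of finitely many arrows chosen at \<open>x\<close>. Translating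
  \<open>u\<close> along those finitely many arrows therefore gives generators of the
  pullback.\<close>

lemma generated_pullback:
  assumes M: "cat_module k D M" and F: "property_F C D FO FM"
    and "finite U" and U: "U \<subseteq> (SIGMA x : Obj D. carrier (At M x))"
    and gen: "\<And>y. y \<in> Obj D \<Longrightarrow> generated k D M U y = carrier (At M y)"
  obtains V where "finite V" "V \<subseteq> (SIGMA x : Obj C. carrier (At M (FO x)))"
    "\<And>y. y \<in> Obj C \<Longrightarrow> generated k C (pullback_module FO FM M) V y = carrier (At M (FO y))"
proof -
  interpret M: cat_module k D M by fact
  interpret P: cat_module k C "pullback_module FO FM M" by (rule cat_module_pullback[OF M])
  from F have "\<forall>y \<in> Obj D. \<exists>S :: ('o \<times> 'n) set. finite S \<and>
      (\<forall>p \<in> S. fst p \<in> Obj C \<and> snd p \<in> Hom D y (FO (fst p))) \<and>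
      (\<forall>x \<in> Obj C. \<forall>f \<in> Hom D y (FO x). \<exists>p \<in> S. \<exists>g \<in> Hom C (fst p) x. f = Comp D (FM g) (snd p))"
    unfolding property_F_def .
  then obtain S where S: "\<And>y. y \<in> Obj D \<Longrightarrow> finite (S y)"
    "\<And>y p. y \<in> Obj D \<Longrightarrow> p \<in> S y \<Longrightarrow> fst p \<in> Obj C \<and> snd p \<in> Hom D y (FO (fst p))"
    "\<And>y x f. y \<in> Obj D \<Longrightarrow> x \<in> Obj C \<Longrightarrow> f \<in> Hom D y (FO x) \<Longrightarrow>
      \<exists>p \<in> S y. \<exists>g \<in> Hom C (fst p) x. f = Comp D (FM g) (snd p)"
    by metis
  define V where "V = (\<Union>(x, u) \<in> U. (\<lambda>p. (fst p, Act M (snd p) u)) ` S x)"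
  have V: "V \<subseteq> (SIGMA x : Obj C. carrier (At M (FO x)))"
  proof
    fix q assume "q \<in> V"
    then obtain x u p where q: "(x, u) \<in> U" "p \<in> S x" "q = (fst p, Act M (snd p) u)"
      by (auto simp: V_def)
    have "x \<in> Obj D" "u \<in> carrier (At M x)" using q(1) U by auto
    then show "q \<in> (SIGMA x : Obj C. carrier (At M (FO x)))"
      using S(2)[of x p] q M.Act_closed by auto
  qed
  show thesis
  proof (rule that[of V])
    show "finite V" unfolding V_def using \<open>finite U\<close> U S(1) by auto
    show "V \<subseteq> (SIGMA x : Obj C. carrier (At M (FO x)))" by (rule V)
    fix y assume y: "y \<in> Obj C"
    then have FOy: "FO y \<in> Obj D" by (rule FO_closed)
    interpret My: module k "At M (FO y)" by (rule M.At_module[OF FOy])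
    let ?G = "generated k C (pullback_module FO FM M) V"
    have sub: "cat_submodule k C (pullback_module FO FM M) ?G"
      by (rule P.cat_submodule_generated) (use V in simp)
    then have G: "submodule (?G y) k (At M (FO y))" using y by (simp add: cat_submodule_def)
    have "{Act M f u |x u f. (x, u) \<in> U \<and> f \<in> Hom D x (FO y)} \<subseteq> ?G y"
    proof
      fix v assume "v \<in> {Act M f u |x u f. (x, u) \<in> U \<and> f \<in> Hom D x (FO y)}"
      then obtain x u f where v: "v = Act M f u" "(x, u) \<in> U" "f \<in> Hom D x (FO y)" by blast
      then have x: "x \<in> Obj D" "u \<in> carrier (At M x)" using U by auto
      from S(3)[OF x(1) y v(3)] obtain p g where
        p: "p \<in> S x" "g \<in> Hom C (fst p) y" "f = Comp D (FM g) (snd p)" by blast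
      then have "snd p \<in> Hom D x (FO (fst p))" "fst p \<in> Obj C" using S(2)[OF x(1)] by blast+
      then have eq: "v = Act M (FM g) (Act M (snd p) u)"
        using M.Act_Comp[OF _ FM_closed[OF p(2)] x(2)] by (simp add: v(1) p(3))
      have "(fst p, Act M (snd p) u) \<in> V" using v(2) p(1) by (force simp: V_def)
      then have "Act M (snd p) u \<in> ?G (fst p)"
        by (rule P.in_generated[rotated]) (use V in simp)
      then have "Act M (FM g) (Act M (snd p) u) \<in> ?G y"
        using sub \<open>fst p \<in> Obj C\<close> y p(2) unfolding cat_submodule_def by fastforce
      then show "v \<in> ?G y" by (simp add: eq)
    qed
    then have "generated k D M U (FO y) \<subseteq> ?G y"
      using My.lin_span_least[OF G] unfolding generated_def by blast
    then show "?G y = carrier (At M (FO y))"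
      using gen[OF FOy] My.submoduleE(1)[OF G] by blast
  qed
qed

text \<open>Both \<open>M\<close> and \<open>N\<close> are pulled back to \<open>C\<close>, where
  the leading-term argument yields finitely many generators of the pulled back submodule. Viewed
  over \<open>D\<close> they generate \<open>N\<close> at all objects \<open>FO y\<close>, and
  isomorphisms extend this to every object.\<close>

theorem locally_noetherian_target:
  fixes k :: "('k, 'x) ring_scheme"
  assumes surj: "essentially_surjective C D FO" and F: "property_F C D FO FM"
    and k: "cring k" "\<one>\<^bsub>k\<^esub> \<noteq> \<zero>\<^bsub>k\<^esub>" "noetherian_ring k"
    and noeth: "\<And>x. x \<in> Obj C \<Longrightarrow> noetherian_on (arrows_from C (Obj C) x) (arrow_le C)"
    and wf: "wf lt" and trans: "trans lt"
    and total: "\<And>x y. total_on (Hom C x y) lt"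
    and compat: "\<And>f g h x y z. f \<in> Hom C x y \<Longrightarrow> g \<in> Hom C x y \<Longrightarrow> h \<in> Hom C y z \<Longrightarrow>
      (f, g) \<in> lt \<Longrightarrow> (Comp C h f, Comp C h g) \<in> lt"
  shows "locally_noetherian TYPE('u) k D"
  unfolding locally_noetherian_def
proof (intro allI impI)
  fix M :: "('p, 'n, 'k, 'u) cat_module" and N
  assume "cat_module k D M \<and> finitely_generated k D M" and N: "cat_submodule k D M N"
  then have M: "cat_module k D M" and fg: "finitely_generated k D M" by auto
  interpret M: cat_module k D M by fact
  interpret P: cat_module k C "pullback_module FO FM M" by (rule cat_module_pullback[OF M])
  from M.finitely_generated_imp_generated[OF fg k(2)] obtain U where
    "finite U" "U \<subseteq> (SIGMA x : Obj D. carrier (At M x))"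
    "\<And>y. y \<in> Obj D \<Longrightarrow> generated k D M U y = carrier (At M y)" by blast
  from generated_pullback[OF M F this] obtain V where
    V: "finite V" "V \<subseteq> (SIGMA x : Obj C. carrier (At M (FO x)))"
    "\<And>y. y \<in> Obj C \<Longrightarrow> generated k C (pullback_module FO FM M) V y = carrier (At M (FO y))" by blast
  have "\<exists>X. finite X \<and> X \<subseteq> (SIGMA x : Obj C. (N \<circ> FO) x) \<and>
    (\<forall>y \<in> Obj C. generated k C (pullback_module FO FM M) X y = (N \<circ> FO) y)"
  proof (rule P.submodule_generated_finite[OF k(3) noeth wf trans total compat V(1)])
    show "V \<subseteq> (SIGMA x : Obj C. carrier (At (pullback_module FO FM M) x))" using V(2) by simp
    show "generated k C (pullback_module FO FM M) V y = carrier (At (pullback_module FO FM M) y)"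
      if "y \<in> Obj C" for y using V(3)[OF that] by simp
    show "cat_submodule k C (pullback_module FO FM M) (N \<circ> FO)" by (rule cat_submodule_pullback[OF N])
  qed (assumption | blast)+
  then obtain X where X: "finite X" "X \<subseteq> (SIGMA x : Obj C. (N \<circ> FO) x)"
    "\<And>y. y \<in> Obj C \<Longrightarrow> generated k C (pullback_module FO FM M) X y = (N \<circ> FO) y" by blast
  define Y where "Y = (\<lambda>(x, u). (FO x, u)) ` X"
  have Y: "Y \<subseteq> (SIGMA x : Obj D. N x)" using X(2) FO_closed by (auto simp: Y_def)
  then have Y': "Y \<subseteq> (SIGMA x : Obj D. carrier (At M x))"
    using M.cat_submodule_carrier[OF N] by blast
  have FO_gen: "N (FO y) \<subseteq> generated k D M Y (FO y)" if "y \<in> Obj C" for y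
  proof -
    have "{Act (pullback_module FO FM M) f u |x u f. (x, u) \<in> X \<and> f \<in> Hom C x y} \<subseteq>
        {Act M f u |x u f. (x, u) \<in> Y \<and> f \<in> Hom D x (FO y)}"
      using FM_closed by (force simp: Y_def)
    then have "generated k C (pullback_module FO FM M) X y \<subseteq> generated k D M Y (FO y)"
      unfolding generated_def by (simp add: lin_span_mono)
    then show ?thesis using X(3)[OF that] by simp
  qed
  have gen_N: "generated k D M Y z = N z" if z: "z \<in> Obj D" for z
  proof
    show "generated k D M Y z \<subseteq> N z" by (rule M.generated_least[OF N Y z])
    from surj z obtain y where y: "y \<in> Obj C" "isomorphic D (FO y) z"
      unfolding essentially_surjective_def by blast
    then obtain f g where f: "f \<in> Hom D (FO y) z" and g: "g \<in> Hom D z (FO y)"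
      and fg: "Comp D f g = Id D z" unfolding isomorphic_def by blast
    show "N z \<subseteq> generated k D M Y z"
    proof
      fix u assume u: "u \<in> N z"
      then have uc: "u \<in> carrier (At M z)" using M.cat_submodule_carrier[OF N z] by blast
      \<comment> \<open>The element is carried to \<open>FO y\<close>, expressed by generators
        there, and carried back by the inverse isomorphism.\<close>
      have "Act M g u \<in> N (FO y)"
        using N u z FO_closed[OF y(1)] g unfolding cat_submodule_def by blast
      then have "Act M g u \<in> generated k D M Y (FO y)" using FO_gen[OF y(1)] by blast
      then have "Act M f (Act M g u) \<in> generated k D M Y z"
        using M.cat_submodule_generated[OF Y'] z FO_closed[OF y(1)] f unfolding cat_submodule_def by blast
      then show "u \<in> generated k D M Y z"
        using M.Act_Comp[OF g f uc] M.Act_Id[OF z uc] fg by simp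
    qed
  qed
  interpret N: cat_module k D "restrict_module M N" by (rule M.cat_module_restrict[OF N])
  show "finitely_generated k D (restrict_module M N)"
  proof (rule N.generated_imp_finitely_generated)
    show "finite Y" by (simp add: Y_def X(1))
    show "Y \<subseteq> (SIGMA x : Obj D. carrier (At (restrict_module M N) x))"
      using Y by (simp add: restrict_module_def)
    show "generated k D (restrict_module M N) Y y = carrier (At (restrict_module M N) y)"
      if "y \<in> Obj D" for y
      using gen_N[OF that] by (simp add: M.generated_restrict) (simp add: restrict_module_def)
  qed
qed

end

section \<open>Coordinates in based modules\<close>

context left_module
begin

lemma smult_zero_left: "x \<in> carrier M \<Longrightarrow> \<zero> \<odot>\<^bsub>M\<^esub> x = \<zero>\<^bsub>M\<^esub>"
  using smult_l_distr[of \<zero> \<zero> x] smult_closed[of \<zero> x] by simp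

lemma smult_zero_right: "a \<in> carrier R \<Longrightarrow> a \<odot>\<^bsub>M\<^esub> \<zero>\<^bsub>M\<^esub> = \<zero>\<^bsub>M\<^esub>"
  using smult_r_distr[of a "\<zero>\<^bsub>M\<^esub>" "\<zero>\<^bsub>M\<^esub>"] smult_closed[of a "\<zero>\<^bsub>M\<^esub>"] by simp

lemma finsum_smult:
  assumes "finite A" "a \<in> carrier R" "F \<in> A \<rightarrow> carrier M"
  shows "a \<odot>\<^bsub>M\<^esub> (\<Oplus>\<^bsub>M\<^esub>i\<in>A. F i) = (\<Oplus>\<^bsub>M\<^esub>i\<in>A. a \<odot>\<^bsub>M\<^esub> F i)"
  using assms
proof (induction A)
  case empty then show ?case by (simp add: smult_zero_right)
next
  case (insert b A)
  then have "F b \<in> carrier M" "F \<in> A \<rightarrow> carrier M" "(\<Oplus>\<^bsub>M\<^esub>i\<in>A. F i) \<in> carrier M" by auto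
  then show ?case using insert by (simp add: smult_r_distr smult_closed Pi_iff)
qed

end

lemma (in ring) finsum_delta:
  assumes "finite A" "c \<in> A \<rightarrow> carrier R" "l \<in> A"
  shows "(\<Oplus>i\<in>A. c i \<otimes> (if l = i then \<one> else \<zero>)) = c l"
proof -
  have c: "c i \<in> carrier R" if "i \<in> A" for i using assms(2) that by auto
  have "(\<Oplus>i\<in>A. c i \<otimes> (if l = i then \<one> else \<zero>)) = (\<Oplus>i\<in>A. if l = i then c i else \<zero>)"
    by (rule finsum_cong') (use c in auto)
  also have "\<dots> = c l" by (rule finsum_singleton[OF assms(3,1,2)])
  finally show ?thesis .
qed

locale based = left_module R V
  for R :: "('r, 'x) ring_scheme" (structure) and V :: "('r, 'v, 'i) based_module" (structure) +
  assumes linear_order: "linear_order_on (Idx V) (Ord V)"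
    and basis: "finite_basis R V (Idx V) (Bas V)"

lemma OVI_obj_iff: "V \<in> OVI_obj R \<longleftrightarrow> based R V"
  by (auto simp: OVI_obj_def based_def based_axioms_def)

definition vec :: "('r, 'v, 'i) based_module \<Rightarrow> ('i \<Rightarrow> 'r) \<Rightarrow> 'v" where
  "vec V c = (\<Oplus>\<^bsub>V\<^esub>i\<in>Idx V. c i \<odot>\<^bsub>V\<^esub> Bas V i)"

definition coord :: "('r, 'x) ring_scheme \<Rightarrow> ('r, 'v, 'i) based_module \<Rightarrow> 'v \<Rightarrow> 'i \<Rightarrow> 'r" where
  "coord R V x = (THE c. c \<in> Idx V \<rightarrow>\<^sub>E carrier R \<and> x = vec V c)"

context based
begin

lemma finite_Idx: "finite (Idx V)"
  using basis by (simp add: finite_basis_def)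

lemma Bas_closed: "i \<in> Idx V \<Longrightarrow> Bas V i \<in> carrier V"
  using basis by (auto simp: finite_basis_def)

lemma smult_Bas_closed: "i \<in> Idx V \<Longrightarrow> a \<in> carrier R \<Longrightarrow> a \<odot>\<^bsub>V\<^esub> Bas V i \<in> carrier V"
  by (simp add: smult_closed Bas_closed)

lemma vec_closed: "c \<in> Idx V \<rightarrow> carrier R \<Longrightarrow> vec V c \<in> carrier V"
  unfolding vec_def by (intro M.finsum_closed) (auto intro!: smult_Bas_closed)

lemma coord_unique: "x \<in> carrier V \<Longrightarrow> \<exists>!c. c \<in> Idx V \<rightarrow>\<^sub>E carrier R \<and> x = vec V c"
  using basis by (simp add: finite_basis_def vec_def)

lemma
  assumes "x \<in> carrier V"
  shows coord_PiE: "coord R V x \<in> Idx V \<rightarrow>\<^sub>E carrier R" and vec_coord: "vec V (coord R V x) = x"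
  using theI'[OF coord_unique[OF assms]] by (auto simp: coord_def)

lemma coord_closed: "x \<in> carrier V \<Longrightarrow> i \<in> Idx V \<Longrightarrow> coord R V x i \<in> carrier R"
  using coord_PiE by auto

lemma vec_cong: "(\<And>i. i \<in> Idx V \<Longrightarrow> c i = d i) \<Longrightarrow> d \<in> Idx V \<rightarrow> carrier R \<Longrightarrow> vec V c = vec V d"
  unfolding vec_def by (rule M.finsum_cong') (auto intro!: smult_Bas_closed)

lemma coord_vec:
  assumes c: "c \<in> Idx V \<rightarrow> carrier R" and i: "i \<in> Idx V"
  shows "coord R V (vec V c) i = c i"
proof -
  have r: "restrict c (Idx V) \<in> Idx V \<rightarrow>\<^sub>E carrier R" "vec V c = vec V (restrict c (Idx V))"
    using c by (auto intro!: vec_cong)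
  have "coord R V (vec V c) = restrict c (Idx V)"
    unfolding coord_def by (rule the1_equality[OF coord_unique[OF vec_closed[OF c]]]) (use r in simp)
  then show ?thesis using i by simp
qed

lemma coord_eqI:
  assumes "x \<in> carrier V" "y \<in> carrier V" "\<And>i. i \<in> Idx V \<Longrightarrow> coord R V x i = coord R V y i"
  shows "x = y"
proof -
  have "vec V (coord R V x) = vec V (coord R V y)"
    by (rule vec_cong) (use assms coord_closed in auto)
  then show ?thesis using vec_coord assms(1,2) by simp
qed

lemma coord_add:
  assumes x: "x \<in> carrier V" and y: "y \<in> carrier V" and i: "i \<in> Idx V"
  shows "coord R V (x \<oplus>\<^bsub>V\<^esub> y) i = coord R V x i \<oplus> coord R V y i"
proof -
  have "vec V (\<lambda>i. coord R V x i \<oplus> coord R V y i) =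
      (\<Oplus>\<^bsub>V\<^esub>i\<in>Idx V. coord R V x i \<odot>\<^bsub>V\<^esub> Bas V i \<oplus>\<^bsub>V\<^esub> coord R V y i \<odot>\<^bsub>V\<^esub> Bas V i)"
    unfolding vec_def
    by (rule M.finsum_cong') (auto intro!: smult_Bas_closed smult_l_distr coord_closed Bas_closed x y)
  also have "\<dots> = vec V (coord R V x) \<oplus>\<^bsub>V\<^esub> vec V (coord R V y)"
    unfolding vec_def by (rule M.finsum_addf) (auto intro!: smult_Bas_closed coord_closed x y)
  finally have "x \<oplus>\<^bsub>V\<^esub> y = vec V (\<lambda>i. coord R V x i \<oplus> coord R V y i)" by (simp add: vec_coord x y)
  then show ?thesis using i by (simp add: coord_vec coord_closed x y)
qed

lemma coord_smult:
  assumes a: "a \<in> carrier R" and x: "x \<in> carrier V" and i: "i \<in> Idx V"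
  shows "coord R V (a \<odot>\<^bsub>V\<^esub> x) i = a \<otimes> coord R V x i"
proof -
  have "vec V (\<lambda>i. a \<otimes> coord R V x i) = (\<Oplus>\<^bsub>V\<^esub>i\<in>Idx V. a \<odot>\<^bsub>V\<^esub> (coord R V x i \<odot>\<^bsub>V\<^esub> Bas V i))"
    unfolding vec_def
    by (rule M.finsum_cong') (auto intro!: smult_closed smult_Bas_closed smult_assoc1 coord_closed Bas_closed a x)
  also have "\<dots> = a \<odot>\<^bsub>V\<^esub> vec V (coord R V x)"
    unfolding vec_def
    by (rule finsum_smult[symmetric]) (auto intro!: finite_Idx a smult_Bas_closed coord_closed x)
  finally have "a \<odot>\<^bsub>V\<^esub> x = vec V (\<lambda>i. a \<otimes> coord R V x i)" by (simp add: vec_coord x)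
  then show ?thesis using i by (simp add: coord_vec coord_closed a x)
qed

lemma coord_sum_Bas:
  assumes A: "A \<subseteq> Idx V" and a: "a \<in> A \<rightarrow> carrier R" and l: "l \<in> Idx V"
  shows "coord R V (\<Oplus>\<^bsub>V\<^esub>j\<in>A. a j \<odot>\<^bsub>V\<^esub> Bas V j) l = (if l \<in> A then a l else \<zero>)"
proof -
  have "(\<Oplus>\<^bsub>V\<^esub>j\<in>A. a j \<odot>\<^bsub>V\<^esub> Bas V j) = vec V (\<lambda>j. if j \<in> A then a j else \<zero>)"
    unfolding vec_def
    by (rule M.add.finprod_mono_neutral_cong_left[OF finite_Idx A])
      (use a in \<open>auto intro!: smult_zero_left Bas_closed smult_Bas_closed\<close>)
  then show ?thesis using a l by (simp add: coord_vec Pi_iff)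
qed

lemma coord_Bas:
  assumes "i \<in> Idx V" "j \<in> Idx V"
  shows "coord R V (Bas V i) j = (if j = i then \<one> else \<zero>)"
  using coord_sum_Bas[of "{i}" "\<lambda>_. \<one>" j] assms by (simp add: Bas_closed smult_one)

lemma coord_finsum:
  assumes "finite A" "F \<in> A \<rightarrow> carrier V" and i: "i \<in> Idx V"
  shows "coord R V (\<Oplus>\<^bsub>V\<^esub>a\<in>A. F a) i = (\<Oplus>a\<in>A. coord R V (F a) i)"
  using assms(1,2)
proof (induction A)
  case empty
  show ?case using coord_smult[of \<zero> "\<zero>\<^bsub>V\<^esub>" i] i by (simp add: smult_zero_left coord_closed)
next
  case (insert b A)
  then have "F b \<in> carrier V" "F \<in> A \<rightarrow> carrier V" "(\<Oplus>\<^bsub>V\<^esub>a\<in>A. F a) \<in> carrier V" by auto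
  moreover from this have "(\<lambda>a. coord R V (F a) i) \<in> A \<rightarrow> carrier R" using coord_closed i by auto
  ultimately show ?case using insert.hyps insert.IH i by (simp add: coord_add coord_closed)
qed

lemma Ord_refl: "i \<in> Idx V \<Longrightarrow> (i, i) \<in> Ord V"
  using linear_order by (auto simp: linear_order_on_def partial_order_on_def preorder_on_def refl_on_def)

lemma Ord_antisym: "(i, j) \<in> Ord V \<Longrightarrow> (j, i) \<in> Ord V \<Longrightarrow> i = j"
  using linear_order by (auto simp: linear_order_on_def partial_order_on_def antisym_def)

lemma Ord_trans: "(i, j) \<in> Ord V \<Longrightarrow> (j, l) \<in> Ord V \<Longrightarrow> (i, l) \<in> Ord V"
  using linear_order by (auto simp: linear_order_on_def partial_order_on_def preorder_on_def dest: transD)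

lemma Ord_total: "i \<in> Idx V \<Longrightarrow> j \<in> Idx V \<Longrightarrow> (i, j) \<in> Ord V \<or> (j, i) \<in> Ord V"
  using linear_order Ord_refl unfolding linear_order_on_def total_on_def by metis

text \<open>The coefficients in such an expression can only be the coordinates of \<open>b\<close>,
  so the existential turns into equations: coordinate 1 at \<open>p\<close> and 0 at all places
  above \<open>p\<close>.\<close>

lemma unitriangular_iff:
  assumes b: "b \<in> carrier V" and p: "p \<in> Idx V"
  shows "(\<exists>a. let J = {j \<in> Idx V. (j, p) \<in> Ord V \<and> j \<noteq> p} in
      a \<in> J \<rightarrow> carrier R \<and> b = Bas V p \<oplus>\<^bsub>V\<^esub> (\<Oplus>\<^bsub>V\<^esub>j\<in>J. a j \<odot>\<^bsub>V\<^esub> Bas V j)) \<longleftrightarrow>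
    coord R V b p = \<one> \<and> (\<forall>j \<in> Idx V. (j, p) \<notin> Ord V \<longrightarrow> coord R V b j = \<zero>)"
proof -
  define J where "J = {j \<in> Idx V. (j, p) \<in> Ord V \<and> j \<noteq> p}"
  have J: "J \<subseteq> Idx V" "p \<notin> J" by (auto simp: J_def)
  have sum: "(\<Oplus>\<^bsub>V\<^esub>j\<in>J. a j \<odot>\<^bsub>V\<^esub> Bas V j) \<in> carrier V" if "a \<in> J \<rightarrow> carrier R" for a
    using that J by (intro M.finsum_closed) (auto intro!: smult_Bas_closed)
  have co: "coord R V (Bas V p \<oplus>\<^bsub>V\<^esub> (\<Oplus>\<^bsub>V\<^esub>j\<in>J. a j \<odot>\<^bsub>V\<^esub> Bas V j)) l =
      (if l = p then \<one> else if l \<in> J then a l else \<zero>)"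
    if a: "a \<in> J \<rightarrow> carrier R" and l: "l \<in> Idx V" for a l
  proof -
    have "a l \<in> carrier R" if "l \<in> J" using a that by auto
    then show ?thesis
      using J p sum[OF a] Bas_closed[OF p] l by (auto simp: coord_add coord_Bas coord_sum_Bas[OF J(1) a])
  qed
  show ?thesis
    unfolding Let_def J_def[symmetric]
  proof (intro iffI; elim exE conjE)
    fix a assume a: "a \<in> J \<rightarrow> carrier R" "b = Bas V p \<oplus>\<^bsub>V\<^esub> (\<Oplus>\<^bsub>V\<^esub>j\<in>J. a j \<odot>\<^bsub>V\<^esub> Bas V j)"
    show "coord R V b p = \<one> \<and> (\<forall>j \<in> Idx V. (j, p) \<notin> Ord V \<longrightarrow> coord R V b j = \<zero>)"
      unfolding a(2) using co[OF a(1)] p Ord_refl[OF p] by (auto simp: J_def)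
  next
    assume *: "coord R V b p = \<one>" "\<forall>j \<in> Idx V. (j, p) \<notin> Ord V \<longrightarrow> coord R V b j = \<zero>"
    have a: "coord R V b \<in> J \<rightarrow> carrier R" using coord_closed[OF b] J by auto
    have "b = Bas V p \<oplus>\<^bsub>V\<^esub> (\<Oplus>\<^bsub>V\<^esub>j\<in>J. coord R V b j \<odot>\<^bsub>V\<^esub> Bas V j)"
    proof (rule coord_eqI[OF b])
      show "Bas V p \<oplus>\<^bsub>V\<^esub> (\<Oplus>\<^bsub>V\<^esub>j\<in>J. coord R V b j \<odot>\<^bsub>V\<^esub> Bas V j) \<in> carrier V"
        using sum[OF a] Bas_closed[OF p] by simp
      show "coord R V b i = coord R V (Bas V p \<oplus>\<^bsub>V\<^esub> (\<Oplus>\<^bsub>V\<^esub>j\<in>J. coord R V b j \<odot>\<^bsub>V\<^esub> Bas V j)) i"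
        if "i \<in> Idx V" for i
        unfolding co[OF a that] using * that by (auto simp: J_def)
    qed
    with a show "\<exists>a. a \<in> J \<rightarrow> carrier R \<and> b = Bas V p \<oplus>\<^bsub>V\<^esub> (\<Oplus>\<^bsub>V\<^esub>j\<in>J. a j \<odot>\<^bsub>V\<^esub> Bas V j)" by blast
  qed
qed

end

section \<open>Morphisms as unitriangular matrices\<close>

lemma OVI_hom_iff:
  assumes "based R V" "based R W"
  shows "(f, f0) \<in> OVI_hom R V W \<longleftrightarrow>
    f \<in> linear_maps R V W \<and> f \<in> extensional (carrier V) \<and>
    f0 \<in> Idx V \<rightarrow>\<^sub>E Idx W \<and> inj_on f0 (Idx V) \<and>
    (\<forall>i \<in> Idx V. \<forall>i' \<in> Idx V. (i, i') \<in> Ord V \<longrightarrow> (f0 i, f0 i') \<in> Ord W) \<and>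
    (\<forall>i \<in> Idx V. coord R W (f (Bas V i)) (f0 i) = \<one>\<^bsub>R\<^esub> \<and>
      (\<forall>j \<in> Idx W. (j, f0 i) \<notin> Ord W \<longrightarrow> coord R W (f (Bas V i)) j = \<zero>\<^bsub>R\<^esub>))"
proof -
  interpret V: based R V by fact
  interpret W: based R W by fact
  have "(\<exists>a. let J = {j \<in> Idx W. (j, f0 i) \<in> Ord W \<and> j \<noteq> f0 i} in
        a \<in> J \<rightarrow> carrier R \<and>
        f (Bas V i) = Bas W (f0 i) \<oplus>\<^bsub>W\<^esub> (\<Oplus>\<^bsub>W\<^esub>j\<in>J. a j \<odot>\<^bsub>W\<^esub> Bas W j)) \<longleftrightarrow>
      coord R W (f (Bas V i)) (f0 i) = \<one>\<^bsub>R\<^esub> \<and>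
      (\<forall>j \<in> Idx W. (j, f0 i) \<notin> Ord W \<longrightarrow> coord R W (f (Bas V i)) j = \<zero>\<^bsub>R\<^esub>)"
    if "f \<in> linear_maps R V W" "f0 \<in> Idx V \<rightarrow>\<^sub>E Idx W" "i \<in> Idx V" for i
    by (rule W.unitriangular_iff) (use that V.Bas_closed in \<open>auto simp: linear_maps_def\<close>)
  then show ?thesis unfolding OVI_hom_def by blast
qed

text \<open>As \<open>1\<close> differs from \<open>0\<close>, \<open>f0 i\<close> is the last place
  where \<open>f (Bas V i)\<close> has a nonzero coordinate. Equality of arrows thus reduces to
  equality of linear maps.\<close>

lemma OVI_hom_index_unique:
  assumes "based R V" "based R W" "\<one>\<^bsub>R\<^esub> \<noteq> \<zero>\<^bsub>R\<^esub>"
    and "(f, f0) \<in> OVI_hom R V W" "(f, f0') \<in> OVI_hom R V W"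
  shows "f0 = f0'"
proof -
  interpret W: based R W by fact
  note f = assms(4)[unfolded OVI_hom_iff[OF assms(1,2)]] and f' = assms(5)[unfolded OVI_hom_iff[OF assms(1,2)]]
  have f0: "f0 \<in> Idx V \<rightarrow>\<^sub>E Idx W" and f0': "f0' \<in> Idx V \<rightarrow>\<^sub>E Idx W" using f f' by blast+
  show ?thesis
  proof (rule PiE_ext[OF f0 f0'])
    fix i assume i: "i \<in> Idx V"
    have "f0 i \<in> Idx W" "f0' i \<in> Idx W" using f0 f0' i by auto
    moreover have "(f0 i, f0' i) \<in> Ord W" "(f0' i, f0 i) \<in> Ord W"
      using f f' i calculation assms(3) by metis+
    ultimately show "f0 i = f0' i" using W.Ord_antisym by blast
  qed
qed

text \<open>The matrix formula. The ring need not be commutative, so the coordinates of the vector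
  stay on the left of the matrix entries.\<close>

lemma coord_linear_map:
  assumes "based R V" "based R W" and f: "f \<in> linear_maps R V W" and x: "x \<in> carrier V" and j: "j \<in> Idx W"
  shows "coord R W (f x) j = (\<Oplus>\<^bsub>R\<^esub>i\<in>Idx V. coord R V x i \<otimes>\<^bsub>R\<^esub> coord R W (f (Bas V i)) j)"
proof -
  interpret V: based R V by fact
  interpret W: based R W by fact
  note l = linear_mapsD[OF f]
  have "f x = f (\<Oplus>\<^bsub>V\<^esub>i\<in>Idx V. coord R V x i \<odot>\<^bsub>V\<^esub> Bas V i)"
    using V.vec_coord[OF x] by (simp add: vec_def)
  also have "\<dots> = (\<Oplus>\<^bsub>W\<^esub>i\<in>Idx V. f (coord R V x i \<odot>\<^bsub>V\<^esub> Bas V i))"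
    by (rule linear_maps_finsum[OF V.left_module_axioms W.left_module_axioms f V.finite_Idx])
      (auto intro!: V.smult_Bas_closed V.coord_closed x)
  also have "coord R W \<dots> j = (\<Oplus>\<^bsub>R\<^esub>i\<in>Idx V. coord R W (f (coord R V x i \<odot>\<^bsub>V\<^esub> Bas V i)) j)"
    by (rule W.coord_finsum[OF V.finite_Idx _ j]) (auto intro!: l(1) V.smult_Bas_closed V.coord_closed x)
  also have "\<dots> = (\<Oplus>\<^bsub>R\<^esub>i\<in>Idx V. coord R V x i \<otimes>\<^bsub>R\<^esub> coord R W (f (Bas V i)) j)"
  proof (rule V.R.finsum_cong'[OF refl])
    show "coord R W (f (coord R V x i \<odot>\<^bsub>V\<^esub> Bas V i)) j = coord R V x i \<otimes>\<^bsub>R\<^esub> coord R W (f (Bas V i)) j"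
      if "i \<in> Idx V" for i
      using that by (simp add: l(3) V.coord_closed x V.Bas_closed W.coord_smult l(1) j)
  qed (auto intro!: V.coord_closed W.coord_closed l(1) V.Bas_closed x j)
  finally show ?thesis .
qed

text \<open>In the pivot coordinate of a composite column only the summand with
  \<open>k = f0 i\<close> survives: larger \<open>k\<close> are killed by \<open>f\<close>, smaller
  ones by \<open>g\<close>, since \<open>g0 k\<close> then lies strictly below the new pivot. Above
  the new pivot every summand vanishes.\<close>

lemma OVI_hom_comp:
  assumes U: "based R U" and V: "based R V" and W: "based R W"
    and "(f, f0) \<in> OVI_hom R U V" "(g, g0) \<in> OVI_hom R V W"
  shows "(compose (carrier U) g f, compose (Idx U) g0 f0) \<in> OVI_hom R U W"
proof -
  interpret U: based R U by fact
  interpret V: based R V by fact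
  interpret W: based R W by fact
  note fh = assms(4)[unfolded OVI_hom_iff[OF U V]] and gh = assms(5)[unfolded OVI_hom_iff[OF V W]]
  have f: "f \<in> linear_maps R U V" and g: "g \<in> linear_maps R V W" using fh gh by blast+
  have f0: "f0 \<in> Idx U \<rightarrow>\<^sub>E Idx V" and g0: "g0 \<in> Idx V \<rightarrow>\<^sub>E Idx W" using fh gh by blast+
  have f0': "f0 i \<in> Idx V" if "i \<in> Idx U" for i using f0 that by auto
  have g0': "g0 i \<in> Idx W" if "i \<in> Idx V" for i using g0 that by auto
  have g_mono: "(g0 i, g0 i') \<in> Ord W" if "i \<in> Idx V" "i' \<in> Idx V" "(i, i') \<in> Ord V" for i i'
    using gh that by blast
  have "inj_on f0 (Idx U)" "inj_on g0 (Idx V)" using fh gh by blast+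
  note lf = linear_mapsD[OF f] and lg = linear_mapsD[OF g]
  have cf: "coord R V (f (Bas U i)) (f0 i) = \<one>\<^bsub>R\<^esub>"
    "\<And>k. k \<in> Idx V \<Longrightarrow> (k, f0 i) \<notin> Ord V \<Longrightarrow> coord R V (f (Bas U i)) k = \<zero>\<^bsub>R\<^esub>" if "i \<in> Idx U" for i
    using fh that by blast+
  have cg: "coord R W (g (Bas V k)) (g0 k) = \<one>\<^bsub>R\<^esub>"
    "\<And>j. j \<in> Idx W \<Longrightarrow> (j, g0 k) \<notin> Ord W \<Longrightarrow> coord R W (g (Bas V k)) j = \<zero>\<^bsub>R\<^esub>" if "k \<in> Idx V" for k
    using gh that by blast+
  show ?thesis
    unfolding OVI_hom_iff[OF U W]
  proof (intro conjI ballI impI)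
    show "compose (carrier U) g f \<in> linear_maps R U W"
      by (auto simp: linear_maps_def compose_def lf lg U.smult_closed)
    show "compose (Idx U) g0 f0 \<in> Idx U \<rightarrow>\<^sub>E Idx W"
      using f0' g0' by (auto simp: compose_def)
    show "inj_on (compose (Idx U) g0 f0) (Idx U)"
      using \<open>inj_on f0 (Idx U)\<close> \<open>inj_on g0 (Idx V)\<close> f0'
      by (auto simp: compose_def inj_on_def)
    show "(compose (Idx U) g0 f0 i, compose (Idx U) g0 f0 i') \<in> Ord W"
      if "i \<in> Idx U" "i' \<in> Idx U" "(i, i') \<in> Ord U" for i i'
      using fh g_mono[OF f0' f0'] that by (simp add: compose_def)
  next
    fix i assume i: "i \<in> Idx U"
    let ?b = "f (Bas U i)"
    have b: "?b \<in> carrier V" using lf(1) U.Bas_closed[OF i] by simp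
    have gf: "compose (carrier U) g f (Bas U i) = g ?b" by (simp add: compose_def U.Bas_closed i)
    have gi: "compose (Idx U) g0 f0 i = g0 (f0 i)" by (simp add: compose_def i)
    have term_closed: "coord R V ?b k \<otimes>\<^bsub>R\<^esub> coord R W (g (Bas V k)) j \<in> carrier R"
      if "k \<in> Idx V" "j \<in> Idx W" for k j
      using that by (simp add: V.coord_closed b W.coord_closed lg(1) V.Bas_closed)
    \<comment> \<open>A summand can be nonzero only if \<open>k\<close> is at most
      \<open>f0 i\<close> and \<open>j\<close> at most \<open>g0 k\<close>; both coordinate claims
      follow from this one criterion.\<close>
    have zero: "coord R V ?b k \<otimes>\<^bsub>R\<^esub> coord R W (g (Bas V k)) j = \<zero>\<^bsub>R\<^esub>"
      if k: "k \<in> Idx V" and j: "j \<in> Idx W" and "(k, f0 i) \<in> Ord V \<Longrightarrow> (j, g0 k) \<notin> Ord W" for k j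
    proof (cases "(k, f0 i) \<in> Ord V")
      case True
      then show ?thesis using cg(2)[OF k j] that(3) by (simp add: V.coord_closed b k)
    next
      case False
      then show ?thesis using cf(2)[OF i k] by (simp add: W.coord_closed lg(1) V.Bas_closed k j)
    qed
    show "coord R W (compose (carrier U) g f (Bas U i)) (compose (Idx U) g0 f0 i) = \<one>\<^bsub>R\<^esub>"
    proof -
      let ?p = "f0 i" and ?j = "g0 (f0 i)"
      have p: "?p \<in> Idx V" and j: "?j \<in> Idx W" using f0' g0' i by auto
      have "coord R W (g ?b) ?j = (\<Oplus>\<^bsub>R\<^esub>k\<in>Idx V. coord R V ?b k \<otimes>\<^bsub>R\<^esub> coord R W (g (Bas V k)) ?j)"
        by (rule coord_linear_map[OF V W g b j])
      also have "\<dots> = (\<Oplus>\<^bsub>R\<^esub>k\<in>{?p}. coord R V ?b k \<otimes>\<^bsub>R\<^esub> coord R W (g (Bas V k)) ?j)"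
      proof (rule U.R.add.finprod_mono_neutral_cong_right[OF V.finite_Idx])
        show "coord R V ?b k \<otimes>\<^bsub>R\<^esub> coord R W (g (Bas V k)) ?j = \<zero>\<^bsub>R\<^esub>" if "k \<in> Idx V - {?p}" for k
        proof (rule zero[OF _ j])
          assume "(k, ?p) \<in> Ord V"
          then have "(g0 k, ?j) \<in> Ord W" using g_mono that p by blast
          moreover have "g0 k \<noteq> ?j" using that p \<open>inj_on g0 (Idx V)\<close> by (auto dest: inj_onD)
          ultimately show "(?j, g0 k) \<notin> Ord W" using W.Ord_antisym by blast
        qed (use that in simp)
      qed (use p j term_closed in auto)
      also have "\<dots> = \<one>\<^bsub>R\<^esub>" using cf(1)[OF i] cg(1)[OF p] by simp
      finally show ?thesis by (simp only: gf gi)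
    qed
    show "coord R W (compose (carrier U) g f (Bas U i)) j = \<zero>\<^bsub>R\<^esub>"
      if j: "j \<in> Idx W" and "(j, compose (Idx U) g0 f0 i) \<notin> Ord W" for j
    proof -
      have nj: "(j, g0 (f0 i)) \<notin> Ord W" using that(2) by (simp only: gi not_False_eq_True)
      have "coord R V ?b k \<otimes>\<^bsub>R\<^esub> coord R W (g (Bas V k)) j = \<zero>\<^bsub>R\<^esub>" if k: "k \<in> Idx V" for k
        using zero[OF k j] g_mono[OF k f0'[OF i]] nj W.Ord_trans by blast
      then show ?thesis
        unfolding gf coord_linear_map[OF V W g b j] by (rule U.R.add.finprod_one_eqI)
    qed
  qed (simp add: compose_def)
qed

lemma OVI_hom_id:
  assumes "based R V"
  shows "(\<lambda>x \<in> carrier V. x, \<lambda>i \<in> Idx V. i) \<in> OVI_hom R V V"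
proof -
  interpret V: based R V by fact
  show ?thesis
    unfolding OVI_hom_iff[OF assms assms]
    using V.Ord_refl by (auto simp: linear_maps_def V.smult_closed V.coord_Bas V.Bas_closed)
qed

lemma Hom_OVI:
  "Hom (OVI R) V W = {(V, \<phi>, W) |\<phi>. based R V \<and> based R W \<and> \<phi> \<in> OVI_hom R V W}"
  by (auto simp: Hom_def OVI_def OVI_obj_iff)

lemma Obj_OVI: "Obj (OVI R) = {V. based R V}"
  by (auto simp: OVI_def OVI_obj_iff)

lemma Comp_OVI:
  "Comp (OVI R) (V', (g, g0), W) (U, (f, f0), V) = (U, (compose (carrier U) g f, compose (Idx U) g0 f0), W)"
  by (simp add: OVI_def)

lemma Id_OVI: "Id (OVI R) V = (V, (\<lambda>x \<in> carrier V. x, \<lambda>i \<in> Idx V. i), V)"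
  by (simp add: OVI_def)

lemma category_OVI: "category (OVI R)"
proof
  show "Dom (OVI R) F \<in> Obj (OVI R)" "Cod (OVI R) F \<in> Obj (OVI R)" if "F \<in> Arr (OVI R)" for F
    using that by (auto simp: OVI_def)
  show "Id (OVI R) V \<in> Hom (OVI R) V V" if "V \<in> Obj (OVI R)" for V
    using that OVI_hom_id by (auto simp: Obj_OVI Hom_OVI Id_OVI)
  show "Comp (OVI R) G F \<in> Hom (OVI R) U W" if "F \<in> Hom (OVI R) U V" "G \<in> Hom (OVI R) V W" for F G U V W
    using that OVI_hom_comp by (fastforce simp: Hom_OVI Comp_OVI)
  show "Comp (OVI R) F (Id (OVI R) V) = F" if "F \<in> Hom (OVI R) V W" for F V W
  proof -
    from that obtain f f0 where F: "F = (V, (f, f0), W)" "(f, f0) \<in> OVI_hom R V W" by (auto simp: Hom_OVI)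
    have "compose (carrier V) f (\<lambda>x \<in> carrier V. x) = f" "compose (Idx V) f0 (\<lambda>i \<in> Idx V. i) = f0"
      using F(2) by (auto simp: OVI_hom_def linear_maps_def PiE_def intro!: compose_Id)
    then show ?thesis by (simp add: F(1) Id_OVI Comp_OVI)
  qed
  show "Comp (OVI R) (Id (OVI R) W) F = F" if "F \<in> Hom (OVI R) V W" for F V W
  proof -
    from that obtain f f0 where F: "F = (V, (f, f0), W)" "(f, f0) \<in> OVI_hom R V W" by (auto simp: Hom_OVI)
    have "compose (carrier V) (\<lambda>x \<in> carrier W. x) f = f" "compose (Idx V) (\<lambda>i \<in> Idx W. i) f0 = f0"
      using F(2) by (auto simp: OVI_hom_def linear_maps_def PiE_def intro!: Id_compose)
    then show ?thesis by (simp add: F(1) Id_OVI Comp_OVI)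
  qed
  show "Comp (OVI R) H (Comp (OVI R) G F) = Comp (OVI R) (Comp (OVI R) H G) F"
    if "F \<in> Hom (OVI R) T U" "G \<in> Hom (OVI R) U V" "H \<in> Hom (OVI R) V W" for F G H T U V W
  proof -
    from that obtain f f0 g g0 h h0 where
      F: "F = (T, (f, f0), U)" "(f, f0) \<in> OVI_hom R T U" and
      G: "G = (U, (g, g0), V)" and H: "H = (V, (h, h0), W)" by (auto simp: Hom_OVI)
    have "f \<in> carrier T \<rightarrow> carrier U" "f0 \<in> Idx T \<rightarrow> Idx U"
      using F(2) by (auto simp: OVI_hom_def linear_maps_def)
    then show ?thesis
      by (simp add: F(1) G H Comp_OVI) (metis compose_assoc)
  qed
qed

section \<open>Maps given by rows of linear forms\<close>

text \<open>Stated apart from \<open>linear_maps\<close> because \<open>R\<close> is a ring record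
  and not a module record.\<close>

definition linear_form :: "('r, 'x) ring_scheme \<Rightarrow> ('r, 'v, 'y) module_scheme \<Rightarrow> ('v \<Rightarrow> 'r) \<Rightarrow> bool" where
  "linear_form R V p \<longleftrightarrow> p \<in> carrier V \<rightarrow> carrier R \<and>
    (\<forall>x \<in> carrier V. \<forall>y \<in> carrier V. p (x \<oplus>\<^bsub>V\<^esub> y) = p x \<oplus>\<^bsub>R\<^esub> p y) \<and>
    (\<forall>a \<in> carrier R. \<forall>x \<in> carrier V. p (a \<odot>\<^bsub>V\<^esub> x) = a \<otimes>\<^bsub>R\<^esub> p x)"

text \<open>The matrix with rows \<open>p j\<close>. Keeping rows as forms on \<open>V\<close>, not
  as lists of entries, turns deletion and repetition of rows into reindexing of
  \<open>p\<close>.\<close>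

definition row_map :: "('r, 'v, 'i) based_module \<Rightarrow> ('r, 'v, 'i) based_module \<Rightarrow> ('i \<Rightarrow> 'v \<Rightarrow> 'r) \<Rightarrow> 'v \<Rightarrow> 'v" where
  "row_map V W p = (\<lambda>x \<in> carrier V. vec W (\<lambda>j. p j x))"

lemma (in based) linear_form_coord: "i \<in> Idx V \<Longrightarrow> linear_form R V (\<lambda>x. coord R V x i)"
  by (simp add: linear_form_def coord_closed coord_add coord_smult)

context
  fixes R :: "('r, 'x) ring_scheme" and V W :: "('r, 'v, 'i) based_module" and p :: "'i \<Rightarrow> 'v \<Rightarrow> 'r"
  assumes V: "based R V" and W: "based R W" and p: "\<And>j. j \<in> Idx W \<Longrightarrow> linear_form R V (p j)"
begin

lemma form_closed: "x \<in> carrier V \<Longrightarrow> j \<in> Idx W \<Longrightarrow> p j x \<in> carrier R"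
  using p[of j] by (auto simp: linear_form_def)

lemma row_map_closed: "x \<in> carrier V \<Longrightarrow> row_map V W p x \<in> carrier W"
  by (auto simp: row_map_def form_closed intro!: based.vec_closed[OF W])

lemma coord_row_map: "x \<in> carrier V \<Longrightarrow> j \<in> Idx W \<Longrightarrow> coord R W (row_map V W p x) j = p j x"
  by (simp add: row_map_def based.coord_vec[OF W] form_closed)

lemma row_map_linear: "row_map V W p \<in> linear_maps R V W"
proof -
  interpret V: based R V by (rule V)
  interpret W: based R W by (rule W)
  show ?thesis
    unfolding linear_maps_def
  proof (intro CollectI conjI ballI funcsetI row_map_closed)
    show "row_map V W p (x \<oplus>\<^bsub>V\<^esub> y) = row_map V W p x \<oplus>\<^bsub>W\<^esub> row_map V W p y"
      if x: "x \<in> carrier V" and y: "y \<in> carrier V" for x y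
    proof (rule W.coord_eqI)
      show "coord R W (row_map V W p (x \<oplus>\<^bsub>V\<^esub> y)) j = coord R W (row_map V W p x \<oplus>\<^bsub>W\<^esub> row_map V W p y) j"
        if "j \<in> Idx W" for j
        using p[OF that] x y that by (simp add: coord_row_map W.coord_add row_map_closed linear_form_def)
    qed (simp_all add: row_map_closed x y)
    show "row_map V W p (a \<odot>\<^bsub>V\<^esub> x) = a \<odot>\<^bsub>W\<^esub> row_map V W p x"
      if a: "a \<in> carrier R" and x: "x \<in> carrier V" for a x
    proof (rule W.coord_eqI)
      show "coord R W (row_map V W p (a \<odot>\<^bsub>V\<^esub> x)) j = coord R W (a \<odot>\<^bsub>W\<^esub> row_map V W p x) j"
        if "j \<in> Idx W" for j
        using p[OF that] a x that
        by (simp add: coord_row_map W.coord_smult row_map_closed linear_form_def V.smult_closed)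
    qed (simp_all add: row_map_closed V.smult_closed W.smult_closed a x)
  qed
qed

lemma row_map_OVI_hom:
  assumes f0: "f0 \<in> Idx V \<rightarrow>\<^sub>E Idx W" "inj_on f0 (Idx V)"
    "\<And>i i'. i \<in> Idx V \<Longrightarrow> i' \<in> Idx V \<Longrightarrow> (i, i') \<in> Ord V \<Longrightarrow> (f0 i, f0 i') \<in> Ord W"
    and "\<And>i. i \<in> Idx V \<Longrightarrow> p (f0 i) (Bas V i) = \<one>\<^bsub>R\<^esub>"
    and "\<And>i j. i \<in> Idx V \<Longrightarrow> j \<in> Idx W \<Longrightarrow> (j, f0 i) \<notin> Ord W \<Longrightarrow> p j (Bas V i) = \<zero>\<^bsub>R\<^esub>"
  shows "(row_map V W p, f0) \<in> OVI_hom R V W"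
  unfolding OVI_hom_iff[OF V W]
proof (intro conjI ballI impI row_map_linear f0)
  show "row_map V W p \<in> extensional (carrier V)" by (simp add: row_map_def)
  fix i assume i: "i \<in> Idx V"
  then have b: "Bas V i \<in> carrier V" by (rule based.Bas_closed[OF V])
  show "coord R W (row_map V W p (Bas V i)) (f0 i) = \<one>\<^bsub>R\<^esub>"
    using assms i f0(1) by (subst coord_row_map[OF b]) auto
  show "coord R W (row_map V W p (Bas V i)) j = \<zero>\<^bsub>R\<^esub>" if "j \<in> Idx W" "(j, f0 i) \<notin> Ord W" for j
    using assms i that by (subst coord_row_map[OF b]) auto
qed

end

text \<open>The permutation matrix of an order isomorphism of index sets is unitriangular: column
  \<open>i\<close> is the basis vector at \<open>s i\<close>.\<close>

lemma reindex_OVI_hom: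
  assumes V: "based R V" and W: "based R W"
    and s: "\<And>i. i \<in> Idx V \<Longrightarrow> s i \<in> Idx W" and t: "\<And>j. j \<in> Idx W \<Longrightarrow> t j \<in> Idx V"
    and ts: "\<And>i. i \<in> Idx V \<Longrightarrow> t (s i) = i" and st: "\<And>j. j \<in> Idx W \<Longrightarrow> s (t j) = j"
    and mono: "\<And>i i'. i \<in> Idx V \<Longrightarrow> i' \<in> Idx V \<Longrightarrow> (i, i') \<in> Ord V \<Longrightarrow> (s i, s i') \<in> Ord W"
  shows "(row_map V W (\<lambda>j x. coord R V x (t j)), restrict s (Idx V)) \<in> OVI_hom R V W"
proof (rule row_map_OVI_hom[OF V W])
  interpret V: based R V by (rule V)
  interpret W: based R W by (rule W)
  show "linear_form R V (\<lambda>x. coord R V x (t j))" if "j \<in> Idx W" for j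
    by (rule V.linear_form_coord[OF t[OF that]])
  show "restrict s (Idx V) \<in> Idx V \<rightarrow>\<^sub>E Idx W" using s by simp
  show "inj_on (restrict s (Idx V)) (Idx V)" by (rule inj_on_inverseI[of _ t]) (simp add: ts)
  show "coord R V (Bas V i) (t (restrict s (Idx V) i)) = \<one>\<^bsub>R\<^esub>" if "i \<in> Idx V" for i
    using that by (simp add: ts V.coord_Bas)
  show "coord R V (Bas V i) (t j) = \<zero>\<^bsub>R\<^esub>"
    if "i \<in> Idx V" "j \<in> Idx W" "(j, restrict s (Idx V) i) \<notin> Ord W" for i j
  proof -
    have "t j \<noteq> i"
    proof
      assume "t j = i"
      then have "s i = j" using st[OF that(2)] by simp
      then show False using that W.Ord_refl by simp
    qed
    then show ?thesis using that(1) t[OF that(2)] by (simp add: V.coord_Bas)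
  qed
qed (use mono in simp)

lemma isomorphic_OVI:
  assumes V: "based R V" and W: "based R W"
    and s: "\<And>i. i \<in> Idx V \<Longrightarrow> s i \<in> Idx W" and t: "\<And>j. j \<in> Idx W \<Longrightarrow> t j \<in> Idx V"
    and ts: "\<And>i. i \<in> Idx V \<Longrightarrow> t (s i) = i" and st: "\<And>j. j \<in> Idx W \<Longrightarrow> s (t j) = j"
    and mono: "\<And>i i'. i \<in> Idx V \<Longrightarrow> i' \<in> Idx V \<Longrightarrow> (i, i') \<in> Ord V \<Longrightarrow> (s i, s i') \<in> Ord W"
      "\<And>j j'. j \<in> Idx W \<Longrightarrow> j' \<in> Idx W \<Longrightarrow> (j, j') \<in> Ord W \<Longrightarrow> (t j, t j') \<in> Ord V"
  shows "isomorphic (OVI R) V W"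
proof -
  define f where "f = row_map V W (\<lambda>j x. coord R V x (t j))"
  define g where "g = row_map W V (\<lambda>i x. coord R W x (s i))"
  have f: "(f, restrict s (Idx V)) \<in> OVI_hom R V W" unfolding f_def
    by (rule reindex_OVI_hom[OF V W]) (use s t ts st mono in auto)
  have g: "(g, restrict t (Idx W)) \<in> OVI_hom R W V" unfolding g_def
    by (rule reindex_OVI_hom[OF W V]) (use s t ts st mono in auto)
  note cf = coord_row_map[OF V W based.linear_form_coord[OF V t]]
  note cg = coord_row_map[OF W V based.linear_form_coord[OF W s]]
  have fc: "f x \<in> carrier W" if "x \<in> carrier V" for x
    using f that by (auto simp: OVI_hom_def linear_maps_def)
  have gc: "g x \<in> carrier V" if "x \<in> carrier W" for x
    using g that by (auto simp: OVI_hom_def linear_maps_def)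
  have "g (f x) = x" if x: "x \<in> carrier V" for x
    by (rule based.coord_eqI[OF V gc[OF fc[OF x]] x])
      (simp add: g_def cg fc[OF x] f_def[symmetric], simp add: f_def cf x s ts)
  moreover have "f (g x) = x" if x: "x \<in> carrier W" for x
    by (rule based.coord_eqI[OF W fc[OF gc[OF x]] x])
      (simp add: f_def cf gc[OF x] g_def[symmetric], simp add: g_def cg x t st)
  ultimately show ?thesis
    unfolding isomorphic_def Hom_OVI
    by (intro bexI[of _ "(V, (f, restrict s (Idx V)), W)"] bexI[of _ "(W, (g, restrict t (Idx W)), V)"])
      (use f g V W s t ts st in \<open>auto simp: Comp_OVI Id_OVI compose_def intro!: restrict_ext\<close>)
qed

section \<open>Ranks in finite orders and free modules in a prescribed type\<close>

lemma linear_order_rank: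
  assumes "finite I" and lin: "linear_order_on I r"
  obtains rank :: "'i \<Rightarrow> nat" where "bij_betw rank I {..<card I}"
    "\<And>i j. i \<in> I \<Longrightarrow> j \<in> I \<Longrightarrow> (i, j) \<in> r \<longleftrightarrow> rank i \<le> rank j"
proof -
  define rank where "rank i = card {j \<in> I. (j, i) \<in> r \<and> j \<noteq> i}" for i
  have refl: "\<And>i. i \<in> I \<Longrightarrow> (i, i) \<in> r" and trans: "trans r" and antisym: "antisym r"
    and total: "\<And>i j. i \<in> I \<Longrightarrow> j \<in> I \<Longrightarrow> i \<noteq> j \<Longrightarrow> (i, j) \<in> r \<or> (j, i) \<in> r"
    using lin by (auto simp: linear_order_on_def partial_order_on_def preorder_on_def refl_on_def total_on_def)
  have less: "rank i < rank j" if ij: "i \<in> I" "j \<in> I" "(i, j) \<in> r" "i \<noteq> j" for i j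
    unfolding rank_def
  proof (rule psubset_card_mono)
    show "finite {k \<in> I. (k, j) \<in> r \<and> k \<noteq> j}" using \<open>finite I\<close> by simp
    have "{k \<in> I. (k, i) \<in> r \<and> k \<noteq> i} \<subseteq> {k \<in> I. (k, j) \<in> r \<and> k \<noteq> j}"
      using ij transD[OF trans] antisymD[OF antisym] by blast
    moreover have "i \<in> {k \<in> I. (k, j) \<in> r \<and> k \<noteq> j} - {k \<in> I. (k, i) \<in> r \<and> k \<noteq> i}"
      using ij by simp
    ultimately show "{k \<in> I. (k, i) \<in> r \<and> k \<noteq> i} \<subset> {k \<in> I. (k, j) \<in> r \<and> k \<noteq> j}" by blast
  qed
  have iff: "(i, j) \<in> r \<longleftrightarrow> rank i \<le> rank j" if ij: "i \<in> I" "j \<in> I" for i j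
  proof (cases "i = j")
    case True then show ?thesis using refl ij by simp
  next
    case False
    then show ?thesis using less ij total antisymD[OF antisym] by (metis less_le_not_le order.strict_implies_order)
  qed
  have inj: "inj_on rank I"
    using less total by (metis inj_onI less_irrefl)
  have "rank i < card I" if "i \<in> I" for i
    unfolding rank_def by (rule psubset_card_mono) (use that \<open>finite I\<close> in auto)
  then have "rank ` I \<subseteq> {..<card I}" by blast
  then have "rank ` I = {..<card I}"
    using card_image[OF inj] by (intro card_subset_eq) auto
  then show thesis using that inj iff by (simp add: bij_betw_def)
qed

text \<open>The functions from \<open>I\<close> to \<open>R\<close> form the standard free module,
  but the carrier has to lie in \<open>'v\<close>. For finite \<open>R\<close> there are finitely
  many such functions, so they embed by \<open>e\<close> into the infinite type, and the structure
  is transported along \<open>e\<close> with decoding \<open>d\<close>.\<close>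

lemma exists_based:
  fixes R :: "('r, 'x) ring_scheme" and I :: "'i set"
  assumes "ring R" and finR: "finite (carrier R)" and "infinite (UNIV :: 'v set)"
    and finI: "finite I" and lin: "linear_order_on I r"
  obtains V :: "('r, 'v, 'i) based_module" where "based R V" "Idx V = I" "Ord V = r"
proof -
  interpret R: ring R by fact
  let ?E = "I \<rightarrow>\<^sub>E carrier R"
  have finE: "finite ?E" using finI finR by (simp add: finite_PiE)
  obtain B :: "'v set" where "finite B" "card B = card ?E"
    using infinite_arbitrarily_large[OF assms(3)] by blast
  then obtain e where e: "bij_betw e ?E B" using finite_same_card_bij[OF finE] by metis
  define d where "d = inv_into ?E e"
  have d_e: "d (e c) = c" if "c \<in> ?E" for c
    using e that by (simp add: d_def bij_betw_inv_into_left)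
  have dE: "d x \<in> ?E" and e_d: "e (d x) = x" if "x \<in> e ` ?E" for x
    using that d_e by auto
  define V :: "('r, 'v, 'i) based_module" where
    "V = \<lparr>carrier = e ` ?E, mult = undefined, one = undefined,
      zero = e (\<lambda>i \<in> I. \<zero>\<^bsub>R\<^esub>), add = (\<lambda>x y. e (\<lambda>i \<in> I. d x i \<oplus>\<^bsub>R\<^esub> d y i)),
      smult = (\<lambda>a x. e (\<lambda>i \<in> I. a \<otimes>\<^bsub>R\<^esub> d x i)),
      Idx = I, Ord = r, Bas = (\<lambda>k. e (\<lambda>i \<in> I. if i = k then \<one>\<^bsub>R\<^esub> else \<zero>\<^bsub>R\<^esub>))\<rparr>"
  have carrier_V: "carrier V = e ` ?E" and Idx_V: "Idx V = I" "Ord V = r" by (simp_all add: V_def)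
  have d_closed: "d x i \<in> carrier R" if "x \<in> carrier V" "i \<in> I" for x i
    using dE that by (auto simp: carrier_V)
  have e_closed: "e (restrict c I) \<in> carrier V" if "\<And>i. i \<in> I \<Longrightarrow> c i \<in> carrier R" for c
    using that by (auto simp: carrier_V)
  have d_restrict: "d (e (restrict c I)) i = c i" if "\<And>i. i \<in> I \<Longrightarrow> c i \<in> carrier R" "i \<in> I" for c i
    using that d_e[of "restrict c I"] by auto
  \<comment> \<open>Decoded coordinates determine an element, so each module law reduces to a law of
    \<open>R\<close> at every index.\<close>
  have eqI: "x = y" if xy: "x \<in> carrier V" "y \<in> carrier V" and eq: "\<And>i. i \<in> I \<Longrightarrow> d x i = d y i" for x y
  proof -
    have "d x = d y" using dE xy eq unfolding carrier_V by (intro PiE_ext[of _ I "\<lambda>_. carrier R"]) auto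
    then show ?thesis using e_d xy by (metis carrier_V)
  qed
  have add_closed: "x \<oplus>\<^bsub>V\<^esub> y \<in> carrier V" and d_add: "\<And>i. i \<in> I \<Longrightarrow> d (x \<oplus>\<^bsub>V\<^esub> y) i = d x i \<oplus>\<^bsub>R\<^esub> d y i"
    if "x \<in> carrier V" "y \<in> carrier V" for x y
    using that d_closed e_closed d_restrict[of "\<lambda>i. d x i \<oplus>\<^bsub>R\<^esub> d y i"] by (simp_all add: V_def)
  have smult_closed: "a \<odot>\<^bsub>V\<^esub> x \<in> carrier V" and d_smult: "\<And>i. i \<in> I \<Longrightarrow> d (a \<odot>\<^bsub>V\<^esub> x) i = a \<otimes>\<^bsub>R\<^esub> d x i"
    if "a \<in> carrier R" "x \<in> carrier V" for a x
    using that d_closed e_closed d_restrict[of "\<lambda>i. a \<otimes>\<^bsub>R\<^esub> d x i"] by (simp_all add: V_def)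
  have zero_closed: "\<zero>\<^bsub>V\<^esub> \<in> carrier V" and d_zero: "\<And>i. i \<in> I \<Longrightarrow> d \<zero>\<^bsub>V\<^esub> i = \<zero>\<^bsub>R\<^esub>"
    using e_closed d_restrict[of "\<lambda>_. \<zero>\<^bsub>R\<^esub>"] by (simp_all add: V_def)
  have Bas_closed: "Bas V k \<in> carrier V" and d_Bas: "\<And>i. i \<in> I \<Longrightarrow> d (Bas V k) i = (if i = k then \<one>\<^bsub>R\<^esub> else \<zero>\<^bsub>R\<^esub>)" for k
    using e_closed d_restrict[of "\<lambda>i. if i = k then \<one>\<^bsub>R\<^esub> else \<zero>\<^bsub>R\<^esub>"] by (simp_all add: V_def)
  note V_simps = add_closed d_add smult_closed d_smult zero_closed d_zero Bas_closed d_Bas d_closed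
  have "abelian_group V"
  proof (rule abelian_groupI)
    show "\<exists>y \<in> carrier V. y \<oplus>\<^bsub>V\<^esub> x = \<zero>\<^bsub>V\<^esub>" if x: "x \<in> carrier V" for x
    proof
      have m: "\<And>i. i \<in> I \<Longrightarrow> \<ominus>\<^bsub>R\<^esub> d x i \<in> carrier R" using d_closed[OF x] by simp
      show y: "e (\<lambda>i \<in> I. \<ominus>\<^bsub>R\<^esub> d x i) \<in> carrier V" by (rule e_closed[OF m])
      show "e (\<lambda>i \<in> I. \<ominus>\<^bsub>R\<^esub> d x i) \<oplus>\<^bsub>V\<^esub> x = \<zero>\<^bsub>V\<^esub>"
        by (rule eqI) (use x y d_restrict[OF m] in \<open>auto simp: V_simps R.l_neg\<close>)
    qed
    show "x \<oplus>\<^bsub>V\<^esub> y = y \<oplus>\<^bsub>V\<^esub> x" if "x \<in> carrier V" "y \<in> carrier V" for x y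
      by (rule eqI) (use that in \<open>auto simp: V_simps R.a_comm\<close>)
    show "x \<oplus>\<^bsub>V\<^esub> y \<oplus>\<^bsub>V\<^esub> z = x \<oplus>\<^bsub>V\<^esub> (y \<oplus>\<^bsub>V\<^esub> z)" if "x \<in> carrier V" "y \<in> carrier V" "z \<in> carrier V" for x y z
      by (rule eqI) (use that in \<open>auto simp: V_simps R.a_assoc\<close>)
    show "\<zero>\<^bsub>V\<^esub> \<oplus>\<^bsub>V\<^esub> x = x" if "x \<in> carrier V" for x
      by (rule eqI) (use that in \<open>auto simp: V_simps\<close>)
  qed (simp_all add: V_simps)
  then interpret V: left_module R V
  proof (intro left_module.intro left_module_axioms.intro R.ring_axioms)
    show "(a \<oplus>\<^bsub>R\<^esub> b) \<odot>\<^bsub>V\<^esub> x = a \<odot>\<^bsub>V\<^esub> x \<oplus>\<^bsub>V\<^esub> b \<odot>\<^bsub>V\<^esub> x"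
      if "a \<in> carrier R" "b \<in> carrier R" "x \<in> carrier V" for a b x
      by (rule eqI) (use that in \<open>auto simp: V_simps R.l_distr\<close>)
    show "a \<odot>\<^bsub>V\<^esub> (x \<oplus>\<^bsub>V\<^esub> y) = a \<odot>\<^bsub>V\<^esub> x \<oplus>\<^bsub>V\<^esub> a \<odot>\<^bsub>V\<^esub> y"
      if "a \<in> carrier R" "x \<in> carrier V" "y \<in> carrier V" for a x y
      by (rule eqI) (use that in \<open>auto simp: V_simps R.r_distr\<close>)
    show "a \<otimes>\<^bsub>R\<^esub> b \<odot>\<^bsub>V\<^esub> x = a \<odot>\<^bsub>V\<^esub> (b \<odot>\<^bsub>V\<^esub> x)"
      if "a \<in> carrier R" "b \<in> carrier R" "x \<in> carrier V" for a b x
      by (rule eqI) (use that in \<open>auto simp: V_simps R.m_assoc\<close>)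
    show "\<one>\<^bsub>R\<^esub> \<odot>\<^bsub>V\<^esub> x = x" if "x \<in> carrier V" for x
      by (rule eqI) (use that in \<open>auto simp: V_simps\<close>)
  qed (simp_all add: V_simps)
  have d_finsum: "d (\<Oplus>\<^bsub>V\<^esub>a\<in>A. F a) i = (\<Oplus>\<^bsub>R\<^esub>a\<in>A. d (F a) i)"
    if "finite A" "F \<in> A \<rightarrow> carrier V" "i \<in> I" for A and F :: "'i \<Rightarrow> 'v" and i
    using that
  proof (induction A)
    case empty then show ?case by (simp add: V_simps)
  next
    case (insert b A)
    then have "F b \<in> carrier V" "F \<in> A \<rightarrow> carrier V" "(\<Oplus>\<^bsub>V\<^esub>a\<in>A. F a) \<in> carrier V" by auto
    moreover from this have "(\<lambda>a. d (F a) i) \<in> A \<rightarrow> carrier R" using d_closed insert.prems by auto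
    ultimately show ?case using insert by (simp add: V_simps)
  qed
  have sum: "(\<Oplus>\<^bsub>V\<^esub>i\<in>I. c i \<odot>\<^bsub>V\<^esub> Bas V i) = e c" if c: "c \<in> ?E" for c
  proof -
    have c': "c i \<in> carrier R" if "i \<in> I" for i using c that by auto
    have cl: "(\<lambda>i. c i \<odot>\<^bsub>V\<^esub> Bas V i) \<in> I \<rightarrow> carrier V" using c' by (simp add: V_simps)
    show ?thesis
    proof (rule eqI)
      show "(\<Oplus>\<^bsub>V\<^esub>i\<in>I. c i \<odot>\<^bsub>V\<^esub> Bas V i) \<in> carrier V" by (rule V.M.finsum_closed[OF cl])
      show "e c \<in> carrier V" using c by (simp add: carrier_V)
      fix l assume l: "l \<in> I"
      have "d (\<Oplus>\<^bsub>V\<^esub>i\<in>I. c i \<odot>\<^bsub>V\<^esub> Bas V i) l = (\<Oplus>\<^bsub>R\<^esub>i\<in>I. d (c i \<odot>\<^bsub>V\<^esub> Bas V i) l)"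
        by (rule d_finsum[OF finI cl l])
      also have "\<dots> = (\<Oplus>\<^bsub>R\<^esub>i\<in>I. c i \<otimes>\<^bsub>R\<^esub> (if l = i then \<one>\<^bsub>R\<^esub> else \<zero>\<^bsub>R\<^esub>))"
        by (rule R.finsum_cong') (use c' l in \<open>auto simp: V_simps\<close>)
      also have "\<dots> = c l" by (rule R.finsum_delta[OF finI _ l]) (use c' in simp)
      finally show "d (\<Oplus>\<^bsub>V\<^esub>i\<in>I. c i \<odot>\<^bsub>V\<^esub> Bas V i) l = d (e c) l" by (simp add: d_e c)
    qed
  qed
  have "finite_basis R V I (Bas V)"
    unfolding finite_basis_def
  proof (intro conjI ballI)
    fix x assume x: "x \<in> carrier V"
    show "\<exists>!c. c \<in> ?E \<and> x = (\<Oplus>\<^bsub>V\<^esub>i\<in>I. c i \<odot>\<^bsub>V\<^esub> Bas V i)"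
    proof (rule ex1I[of _ "d x"])
      show "d x \<in> ?E \<and> x = (\<Oplus>\<^bsub>V\<^esub>i\<in>I. d x i \<odot>\<^bsub>V\<^esub> Bas V i)"
        using dE e_d sum x by (simp add: carrier_V)
    qed (use sum d_e in auto)
  qed (simp_all add: finI Bas_closed)
  then have "based R V" using lin by unfold_locales (simp_all add: Idx_V)
  then show thesis using that Idx_V by blast
qed

section \<open>From words to based modules\<close>

definition last_index :: "'a list \<Rightarrow> 'a \<Rightarrow> nat" where
  "last_index w a = Max {k. k < length w \<and> w ! k = a}"

lemma
  assumes "a \<in> set w"
  shows last_index_less: "last_index w a < length w" and nth_last_index: "w ! last_index w a = a"
proof -
  have "{k. k < length w \<and> w ! k = a} \<noteq> {}" using assms by (auto simp: in_set_conv_nth)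
  then have "last_index w a \<in> {k. k < length w \<and> w ! k = a}"
    unfolding last_index_def by (intro Max_in) auto
  then show "last_index w a < length w" "w ! last_index w a = a" by auto
qed

lemma le_last_index: "k < length w \<Longrightarrow> k \<le> last_index w (w ! k)"
  unfolding last_index_def by (intro Max_ge) auto

text \<open>The positional form of \<open>remdups_upt_later\<close>: everything to the right of a
  last occurrence is larger.\<close>

lemma ordered_word_last:
  assumes w: "ordered_word n w" and k: "k < k'" "k' < length w"
    and last: "\<And>l. k < l \<Longrightarrow> l < length w \<Longrightarrow> w ! l \<noteq> w ! k"
  shows "w ! k < w ! k'"
proof (rule remdups_upt_later)
  have "take k w @ w ! k # drop (Suc k) w = w" using k by (simp add: id_take_nth_drop[symmetric])
  then show "remdups (take k w @ w ! k # drop (Suc k) w) = [0..<n]" using w by (simp add: ordered_word_def)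
  show "w ! k \<notin> set (drop (Suc k) w)"
  proof
    assume "w ! k \<in> set (drop (Suc k) w)"
    then obtain i where "i < length w - Suc k" "w ! (Suc k + i) = w ! k" by (auto simp: in_set_conv_nth)
    moreover from this have "Suc k + i < length w" by simp
    ultimately show False using last[of "Suc k + i"] by simp
  qed
  have "drop (Suc k) w ! (k' - Suc k) = w ! k'" using k by simp
  then show "w ! k' \<in> set (drop (Suc k) w)" using k by (metis diff_less_mono length_drop less_eq_Suc_le nth_mem)
qed

text \<open>Were the last \<open>b\<close> to the left of the last \<open>a\<close>, everything to
  its right would exceed \<open>b\<close>, including \<open>a\<close>.\<close>

lemma last_index_strict_mono:
  assumes w: "ordered_word n w" and ab: "a < b" "b < n"
  shows "last_index w a < last_index w b"
proof (rule ccontr)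
  assume not_less: "\<not> last_index w a < last_index w b"
  have a: "a \<in> set w" and b: "b \<in> set w" using ordered_wordD(1)[OF w] ab by auto
  have "last_index w a \<noteq> last_index w b" using nth_last_index[OF a] nth_last_index[OF b] ab by auto
  then have "last_index w b < last_index w a" using not_less by simp
  then have "w ! last_index w b < w ! last_index w a"
  proof (rule ordered_word_last[OF w _ last_index_less[OF a]])
    show "w ! l \<noteq> w ! last_index w b" if "last_index w b < l" "l < length w" for l
      using le_last_index[OF that(2)] that(1) nth_last_index[OF b] by auto
  qed
  then show False using nth_last_index[OF a] nth_last_index[OF b] ab by simp
qed

lemma remdups_map_inj_on: "inj_on h (set xs) \<Longrightarrow> remdups (map h xs) = map h (remdups xs)"
  by (induction xs) (auto simp: inj_on_def)

text \<open>Each entry is replaced by its position in \<open>remdups xs\<close>. Positions there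
  follow the order of last occurrences, so the resulting word is ordered whatever \<open>xs\<close>
  is.\<close>

lemma factor_through_remdups:
  obtains v where "ordered_word (length (remdups xs)) v" "length v = length xs"
    "\<And>k. k < length xs \<Longrightarrow> remdups xs ! (v ! k) = xs ! k"
proof -
  let ?l = "length (remdups xs)"
  let ?h = "inv_into {..<?l} ((!) (remdups xs))"
  have "(!) ys ` {..<length ys} = set ys" for ys :: "'a list"
    unfolding set_conv_nth by blast
  then have im: "(!) (remdups xs) ` {..<?l} = set xs" by simp
  have inj: "inj_on ?h (set xs)" by (rule inj_on_inv_into) (simp add: im)
  have h: "remdups xs ! ?h x = x" if "x \<in> set xs" for x
    using f_inv_into_f[of x "(!) (remdups xs)" "{..<?l}"] im that by simp
  have "inj_on ((!) (remdups xs)) {..<?l}" by (simp add: inj_on_nth)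
  then have "map ?h (remdups xs) = [0..<?l]"
    by (intro nth_equalityI) (simp_all add: inv_into_f_f)
  then have "ordered_word ?l (map ?h xs)"
    unfolding ordered_word_def remdups_map_inj_on[OF inj] .
  then show thesis by (rule that) (simp_all add: h)
qed

text \<open>\<open>St n\<close> is a standard object of rank \<open>n\<close>, indexed by the first
  \<open>n\<close> values of \<open>iota\<close>. The maps \<open>eo\<close> and \<open>ea\<close>
  merely name words inside the types of the target category.\<close>

locale word_functor = word_category eo ea
  for eo :: "nat \<Rightarrow> ('r, 'v, 'i) based_module" and ea :: "nat list \<Rightarrow> ('r, 'v, 'i) OVI_arrow" +
  fixes R :: "('r, 'x) ring_scheme" and iota :: "nat \<Rightarrow> 'i" and St :: "nat \<Rightarrow> ('r, 'v, 'i) based_module"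
  assumes finite_R: "finite (carrier R)" and one_not_zero: "\<one>\<^bsub>R\<^esub> \<noteq> \<zero>\<^bsub>R\<^esub>" and inj_iota: "inj iota"
    and based_St: "based R (St n)"
    and Idx_St: "Idx (St n) = iota ` {..<n}"
    and Ord_St: "Ord (St n) = {(iota a, iota b) |a b. a \<le> b \<and> b < n}"
begin

abbreviation num :: "'i \<Rightarrow> nat" where "num \<equiv> inv_into UNIV iota"

lemma num_iota [simp]: "num (iota k) = k"
  by (rule inv_f_f[OF inj_iota])

lemma iota_eq [simp]: "iota a = iota b \<longleftrightarrow> a = b"
  by (rule inj_eq[OF inj_iota])

lemma Idx_St_cases:
  assumes "i \<in> Idx (St n)"
  obtains a where "i = iota a" "a < n"
  using assms by (auto simp: Idx_St)

lemma iota_in_Idx [simp]: "iota a \<in> Idx (St n) \<longleftrightarrow> a < n"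
  by (auto simp: Idx_St)

lemma iota_in_Ord [simp]: "(iota a, iota b) \<in> Ord (St n) \<longleftrightarrow> a \<le> b \<and> b < n"
  by (auto simp: Ord_St)

text \<open>Row \<open>k\<close> of this matrix is row \<open>w ! k\<close> of the identity matrix,
  so the map repeats coordinates as prescribed by \<open>w\<close>.\<close>

definition word_map :: "nat \<Rightarrow> nat list \<Rightarrow> 'v \<Rightarrow> 'v" where
  "word_map n w = row_map (St n) (St (length w)) (\<lambda>j x. coord R (St n) x (iota (w ! num j)))"

text \<open>Column \<open>a\<close> has entry 1 at all occurrences of \<open>a\<close> in
  \<open>w\<close>, so its pivot must be the last of them.\<close>

definition word_index :: "nat \<Rightarrow> nat list \<Rightarrow> 'i \<Rightarrow> 'i" where
  "word_index n w = (\<lambda>i \<in> Idx (St n). iota (last_index w (num i)))"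

lemma nth_less: "ordered_word n w \<Longrightarrow> k < length w \<Longrightarrow> w ! k < n"
  using ordered_wordD(1)[of n w] nth_mem[of k w] by auto

lemma word_form:
  assumes "ordered_word n w" "j \<in> Idx (St (length w))"
  shows "linear_form R (St n) (\<lambda>x. coord R (St n) x (iota (w ! num j)))"
  using assms(2) by (elim Idx_St_cases)
    (auto intro!: based.linear_form_coord[OF based_St] simp: nth_less[OF assms(1)])

lemma coord_word_map:
  assumes "ordered_word n w" "x \<in> carrier (St n)" "k < length w"
  shows "coord R (St (length w)) (word_map n w x) (iota k) = coord R (St n) x (iota (w ! k))"
  unfolding word_map_def
  using coord_row_map[OF based_St based_St word_form[OF assms(1)] assms(2), where j = "iota k"] assms(3)
  by simp

text \<open>Below the last occurrence of \<open>a\<close> no row equals row \<open>a\<close> of the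
  identity, so the column vanishes there; increasing last occurrences make the pivot map
  monotone.\<close>

lemma word_map_OVI_hom:
  assumes w: "ordered_word n w"
  shows "(word_map n w, word_index n w) \<in> OVI_hom R (St n) (St (length w))"
  unfolding word_map_def
proof (rule row_map_OVI_hom[OF based_St based_St word_form[OF w]])
  have in_set: "a \<in> set w" if "a < n" for a using ordered_wordD(1)[OF w] that by simp
  have wi: "word_index n w (iota a) = iota (last_index w a)" if "a < n" for a
    using that by (simp add: word_index_def)
  show "word_index n w \<in> Idx (St n) \<rightarrow>\<^sub>E Idx (St (length w))"
    using last_index_less[OF in_set] by (auto simp: word_index_def elim!: Idx_St_cases)
  show "inj_on (word_index n w) (Idx (St n))"
  proof (rule inj_onI)
    fix i j assume "i \<in> Idx (St n)" "j \<in> Idx (St n)" and eq: "word_index n w i = word_index n w j"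
    then obtain a b where ab: "i = iota a" "a < n" "j = iota b" "b < n" by (metis Idx_St_cases)
    then have "last_index w a = last_index w b" using eq by (simp add: wi)
    then show "i = j" using nth_last_index[OF in_set] ab by metis
  qed
  show "(word_index n w i, word_index n w i') \<in> Ord (St (length w))"
    if ii: "i \<in> Idx (St n)" "i' \<in> Idx (St n)" "(i, i') \<in> Ord (St n)" for i i'
  proof -
    from ii(1,2) obtain a b where ab: "i = iota a" "i' = iota b" "b < n" "a < n" by (metis Idx_St_cases)
    then have "a \<le> b" using ii(3) by simp
    then have "last_index w a \<le> last_index w b"
      using last_index_strict_mono[OF w, of a b] ab by (cases "a = b") auto
    then show ?thesis using ab last_index_less[OF in_set] by (simp add: wi)
  qed
  fix i assume "i \<in> Idx (St n)"
  then obtain a where a: "i = iota a" "a < n" by (rule Idx_St_cases)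
  show "coord R (St n) (Bas (St n) i) (iota (w ! num (word_index n w i))) = \<one>\<^bsub>R\<^esub>"
    using a by (simp add: wi nth_last_index[OF in_set] based.coord_Bas[OF based_St])
  show "coord R (St n) (Bas (St n) i) (iota (w ! num j)) = \<zero>\<^bsub>R\<^esub>"
    if j: "j \<in> Idx (St (length w))" "(j, word_index n w i) \<notin> Ord (St (length w))" for j
  proof -
    from j(1) obtain k where k: "j = iota k" "k < length w" by (rule Idx_St_cases)
    have "last_index w a < k"
      using j(2) a last_index_less[OF in_set] by (simp add: k(1) wi not_le)
    then have "w ! k \<noteq> a" using le_last_index[OF k(2)] by auto
    then show ?thesis using a k nth_less[OF w k(2)] by (simp add: based.coord_Bas[OF based_St])
  qed
qed

definition FO :: "('r, 'v, 'i) based_module \<Rightarrow> ('r, 'v, 'i) based_module" where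
  "FO x = St (inv_into UNIV eo x)"

definition FM :: "('r, 'v, 'i) OVI_arrow \<Rightarrow> ('r, 'v, 'i) OVI_arrow" where
  "FM f = (let w = inv_into UNIV ea f; n = length (remdups w)
    in (St n, (word_map n w, word_index n w), St (length w)))"

lemma FO_eo [simp]: "FO (eo n) = St n"
  by (simp add: FO_def)

lemma FM_ea: "ordered_word n w \<Longrightarrow> FM (ea w) = (St n, (word_map n w, word_index n w), St (length w))"
  by (simp add: FM_def Let_def ordered_wordD(2))

text \<open>The index map is determined by the linear map, so coordinates of images suffice to
  compare arrows.\<close>

lemma OVI_arrow_eqI:
  assumes "based R U" "based R V" "(f, f0) \<in> OVI_hom R U V" "(g, g0) \<in> OVI_hom R U V"
    and "\<And>x j. x \<in> carrier U \<Longrightarrow> j \<in> Idx V \<Longrightarrow> coord R V (f x) j = coord R V (g x) j"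
  shows "(U, (f, f0), V) = (U, (g, g0), V)"
proof -
  have f: "f \<in> extensional (carrier U)" "\<And>x. x \<in> carrier U \<Longrightarrow> f x \<in> carrier V"
    and g: "g \<in> extensional (carrier U)" "\<And>x. x \<in> carrier U \<Longrightarrow> g x \<in> carrier V"
    using assms(3,4) by (auto simp: OVI_hom_def linear_maps_def)
  have "f = g"
    by (rule extensionalityI[OF f(1) g(1)]) (rule based.coord_eqI[OF assms(2)], use f g assms(5) in auto)
  then show ?thesis using OVI_hom_index_unique[OF assms(1,2) one_not_zero] assms(3,4) by blast
qed

lemma word_map_closed: "ordered_word n w \<Longrightarrow> x \<in> carrier (St n) \<Longrightarrow> word_map n w x \<in> carrier (St (length w))"
  using word_map_OVI_hom[of n w] by (auto simp: OVI_hom_def linear_maps_def)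

text \<open>For composites, coordinate \<open>k\<close> of both sides is the coordinate of
  \<open>x\<close> at \<open>w ! (v ! k)\<close>.\<close>

lemma cat_functor_FM: "cat_functor W (OVI R) FO FM"
proof (intro cat_functor.intro cat_functor_axioms.intro category_W category_OVI)
  show "FO x \<in> Obj (OVI R)" if "x \<in> Obj W" for x
    by (simp add: Obj_OVI FO_def based_St)
  show "FM f \<in> Hom (OVI R) (FO x) (FO y)" if "f \<in> Hom W x y" for f x y
    using that
  proof (cases rule: Hom_W_cases)
    case (1 w)
    then show ?thesis
      using word_map_OVI_hom[OF 1(2)] FM_ea[OF 1(2)] based_St by (simp add: Hom_OVI FO_def)
  qed
  show "FM (Id W x) = Id (OVI R) (FO x)" if "x \<in> Obj W" for x
  proof -
    from that obtain n where x: "x = eo n" by (auto simp: Obj_W)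
    have h: "(word_map n [0..<n], word_index n [0..<n]) \<in> OVI_hom R (St n) (St n)"
      using word_map_OVI_hom[OF ordered_word_upt[of n]] by simp
    have "(St n, (word_map n [0..<n], word_index n [0..<n]), St n) =
        (St n, (\<lambda>x \<in> carrier (St n). x, \<lambda>i \<in> Idx (St n). i), St n)"
    proof (rule OVI_arrow_eqI[OF based_St based_St h OVI_hom_id[OF based_St]])
      fix x j assume x: "x \<in> carrier (St n)" and "j \<in> Idx (St n)"
      then obtain k where "j = iota k" "k < n" by (metis Idx_St_cases)
      then show "coord R (St n) (word_map n [0..<n] x) j = coord R (St n) ((\<lambda>x \<in> carrier (St n). x) x) j"
        using coord_word_map[OF ordered_word_upt[of n] x, of k] x by simp
    qed
    then show ?thesis using FM_ea[OF ordered_word_upt[of n]] by (simp add: x Id_OVI)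
  qed
  show "FM (Comp W g f) = Comp (OVI R) (FM g) (FM f)" if f: "f \<in> Hom W x y" and g: "g \<in> Hom W y z" for f g x y z
  proof -
    from f obtain w where w: "f = ea w" "ordered_word (inv_into UNIV eo x) w" "y = eo (length w)"
      by (rule Hom_W_cases)
    from g obtain v where v: "g = ea v" "ordered_word (length w) v"
      by (rule Hom_W_cases) (simp add: w(3))
    define n where "n = inv_into UNIV eo x"
    have wn: "ordered_word n w" using w(2) by (simp add: n_def)
    let ?u = "word_comp v w"
    have u: "ordered_word n ?u" by (rule ordered_word_comp[OF wn v(2)])
    have h: "(word_map n ?u, word_index n ?u) \<in> OVI_hom R (St n) (St (length v))"
      using word_map_OVI_hom[OF u] by simp
    have h': "(compose (carrier (St n)) (word_map (length w) v) (word_map n w),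
        compose (Idx (St n)) (word_index (length w) v) (word_index n w)) \<in> OVI_hom R (St n) (St (length v))"
      by (rule OVI_hom_comp[OF based_St based_St based_St word_map_OVI_hom[OF wn] word_map_OVI_hom[OF v(2)]])
    have "(St n, (word_map n ?u, word_index n ?u), St (length v)) =
      (St n, (compose (carrier (St n)) (word_map (length w) v) (word_map n w),
        compose (Idx (St n)) (word_index (length w) v) (word_index n w)), St (length v))"
    proof (rule OVI_arrow_eqI[OF based_St based_St h h'])
      fix x j assume x: "x \<in> carrier (St n)" and "j \<in> Idx (St (length v))"
      then obtain k where k: "j = iota k" "k < length v" by (metis Idx_St_cases)
      have "coord R (St (length v)) (word_map n ?u x) j = coord R (St n) x (iota (w ! (v ! k)))"
        using coord_word_map[OF u x, of k] k by (simp add: word_comp_def)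
      also have "\<dots> = coord R (St (length v)) (word_map (length w) v (word_map n w x)) j"
        using coord_word_map[OF v(2) word_map_closed[OF wn x] k(2)]
          coord_word_map[OF wn x nth_less[OF v(2) k(2)]] k(1) by simp
      finally show "coord R (St (length v)) (word_map n ?u x) j = coord R (St (length v))
          (compose (carrier (St n)) (word_map (length w) v) (word_map n w) x) j"
        using x by (simp add: compose_def)
    qed
    then show ?thesis
      using FM_ea[OF u] FM_ea[OF wn] FM_ea[OF v(2)] by (simp add: w(1) v(1) Comp_OVI)
  qed
qed

lemma essentially_surjective_FO: "essentially_surjective W (OVI R) FO"
  unfolding essentially_surjective_def
proof
  fix V :: "('r, 'v, 'i) based_module"
  assume "V \<in> Obj (OVI R)"
  then have V: "based R V" by (simp add: Obj_OVI)
  interpret V: based R V by (rule V)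
  define n where "n = card (Idx V)"
  obtain rank where rank: "bij_betw rank (Idx V) {..<n}"
    "\<And>i j. i \<in> Idx V \<Longrightarrow> j \<in> Idx V \<Longrightarrow> (i, j) \<in> Ord V \<longleftrightarrow> rank i \<le> rank j"
    using linear_order_rank[OF V.finite_Idx V.linear_order] unfolding n_def by metis
  define t where "t = inv_into (Idx V) rank"
  have t: "t k \<in> Idx V" "rank (t k) = k" if "k < n" for k
    using rank(1) that by (auto simp: t_def bij_betw_def inv_into_into f_inv_into_f)
  have tr: "t (rank i) = i" "rank i < n" if "i \<in> Idx V" for i
    using rank(1) that by (auto simp: t_def bij_betw_def)
  have "isomorphic (OVI R) (St n) V"
  proof (rule isomorphic_OVI[OF based_St V])
    show "t (num j) \<in> Idx V" if "j \<in> Idx (St n)" for j using that t by (auto elim!: Idx_St_cases)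
    show "iota (rank i) \<in> Idx (St n)" if "i \<in> Idx V" for i using that tr by simp
    show "iota (rank (t (num j))) = j" if "j \<in> Idx (St n)" for j using that t by (auto elim!: Idx_St_cases)
    show "t (num (iota (rank i))) = i" if "i \<in> Idx V" for i using that tr by simp
    show "(t (num j), t (num j')) \<in> Ord V"
      if "j \<in> Idx (St n)" "j' \<in> Idx (St n)" "(j, j') \<in> Ord (St n)" for j j'
      using that t rank(2) by (auto elim!: Idx_St_cases)
    show "(iota (rank i), iota (rank i')) \<in> Ord (St n)"
      if "i \<in> Idx V" "i' \<in> Idx V" "(i, i') \<in> Ord V" for i i'
      using that rank(2) tr(2) by simp
  qed
  then show "\<exists>x \<in> Obj W. isomorphic (OVI R) (FO x) V"
    by (intro bexI[of _ "eo n"]) (simp_all add: Obj_W)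
qed

section \<open>Finiteness of Hom sets and property (F)\<close>

lemma finite_carrier:
  assumes "based R V"
  shows "finite (carrier V)"
proof -
  interpret V: based R V by fact
  have "carrier V \<subseteq> vec V ` (Idx V \<rightarrow>\<^sub>E carrier R)"
  proof
    show "x \<in> vec V ` (Idx V \<rightarrow>\<^sub>E carrier R)" if "x \<in> carrier V" for x
      using V.coord_PiE[OF that] V.vec_coord[OF that] by (metis imageI)
  qed
  moreover have "finite (Idx V \<rightarrow>\<^sub>E carrier R)" by (rule finite_PiE) (simp_all add: finite_R V.finite_Idx)
  ultimately show ?thesis using finite_surj by blast
qed

lemma finite_Hom_OVI: "finite (Hom (OVI R) V U)"
proof (cases "based R V \<and> based R U")
  case True
  interpret V: based R V using True by simp
  interpret U: based R U using True by simp
  let ?F = "(carrier V \<rightarrow>\<^sub>E carrier U) \<times> (Idx V \<rightarrow>\<^sub>E Idx U)"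
  have "OVI_hom R V U \<subseteq> ?F" by (auto simp: OVI_hom_def linear_maps_def PiE_def)
  moreover have "finite ?F"
    using True finite_carrier V.finite_Idx U.finite_Idx by (intro finite_cartesian_product finite_PiE) auto
  ultimately have "finite ((\<lambda>\<phi>. (V, \<phi>, U)) ` OVI_hom R V U)" by (intro finite_imageI) (rule finite_subset)
  moreover have "Hom (OVI R) V U \<subseteq> (\<lambda>\<phi>. (V, \<phi>, U)) ` OVI_hom R V U" by (auto simp: Hom_OVI)
  ultimately show ?thesis by (rule finite_subset[rotated])
next
  case False
  then have "Hom (OVI R) V U = {}" by (auto simp: Hom_OVI)
  then show ?thesis by simp
qed

text \<open>A matrix over a finite ring has only finitely many distinct rows: keep the last occurrence of
  each row, and let a word record which row stands where.\<close>

lemma factor_OVI_hom: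
  assumes V: "based R V" and F: "F \<in> Hom (OVI R) V (St m)"
  obtains l G v where "l \<le> card (carrier V \<rightarrow>\<^sub>E carrier R)" "G \<in> Hom (OVI R) V (St l)"
    "ordered_word l v" "length v = m" "F = Comp (OVI R) (FM (ea v)) G"
proof -
  interpret V: based R V by (rule V)
  from F obtain g g0 where F_eq: "F = (V, (g, g0), St m)" and hom: "(g, g0) \<in> OVI_hom R V (St m)"
    by (auto simp: Hom_OVI)
  note h = hom[unfolded OVI_hom_iff[OF V based_St]]
  have g: "g \<in> linear_maps R V (St m)" and g0: "g0 \<in> Idx V \<rightarrow>\<^sub>E Idx (St m)" "inj_on g0 (Idx V)" using h by blast+
  note lg = linear_mapsD[OF g]
  define row where "row k = (\<lambda>x \<in> carrier V. coord R (St m) (g x) (iota k))" for k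
  have row_form: "linear_form R V (row k)" if "k < m" for k
    using that based.linear_form_coord[OF based_St, of "iota k" m] lg
    by (auto simp: linear_form_def row_def V.smult_closed)
  define rows where "rows = map row [0..<m]"
  define sig where "sig = remdups rows"
  define l where "l = length sig"
  from factor_through_remdups[of rows] obtain v where
    v: "ordered_word l v" "length v = m" and sig_v: "\<And>k. k < m \<Longrightarrow> sig ! (v ! k) = row k"
    unfolding l_def sig_def by (auto simp: rows_def)
  have set_v: "set v = {..<l}" by (rule ordered_wordD(1)[OF v(1)])
  have v_less: "v ! k < l" if "k < m" for k using nth_less[OF v(1)] v(2) that by simp
  have "row k \<in> carrier V \<rightarrow>\<^sub>E carrier R" if "k < m" for k
  proof
    show "row k x \<in> carrier R" if "x \<in> carrier V" for x
      using row_form[OF \<open>k < m\<close>] that by (auto simp: linear_form_def)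
  qed (simp add: row_def)
  then have "set sig \<subseteq> carrier V \<rightarrow>\<^sub>E carrier R"
    unfolding sig_def rows_def by (simp add: image_subset_iff)
  moreover have "l = card (set sig)" by (simp add: l_def sig_def length_remdups_card_conv)
  moreover have "finite (carrier V \<rightarrow>\<^sub>E carrier R)" by (rule finite_PiE) (simp_all add: finite_carrier V finite_R)
  ultimately have l: "l \<le> card (carrier V \<rightarrow>\<^sub>E carrier R)" by (simp add: card_mono)
  have sig_form: "linear_form R V (sig ! num j)" if "j \<in> Idx (St l)" for j
  proof -
    from that obtain a where a: "j = iota a" "a < l" by (rule Idx_St_cases)
    then obtain k where "k < m" "v ! k = a" using set_v v(2) by (metis in_set_conv_nth lessThan_iff)
    then show ?thesis using row_form sig_v a by (metis num_iota)
  qed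
  define f where "f = row_map V (St l) (\<lambda>j. sig ! num j)"
  \<comment> \<open>The pivot of column \<open>i\<close> in the reduced matrix is the number of the
    distinct row that stood at the old pivot.\<close>
  define f0 where "f0 = (\<lambda>i \<in> Idx V. iota (v ! num (g0 i)))"
  define pos where "pos i = num (g0 i)" for i
  have pos: "pos i < m" "g0 i = iota (pos i)" if "i \<in> Idx V" for i
  proof -
    have "g0 i \<in> Idx (St m)" using g0 that by auto
    then show "pos i < m" "g0 i = iota (pos i)" by (auto elim!: Idx_St_cases simp: pos_def)
  qed
  have row_pos: "row (pos i) (Bas V i) = \<one>\<^bsub>R\<^esub>" "\<And>k. pos i < k \<Longrightarrow> k < m \<Longrightarrow> row k (Bas V i) = \<zero>\<^bsub>R\<^esub>"
    if i: "i \<in> Idx V" for i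
  proof -
    have "coord R (St m) (g (Bas V i)) (g0 i) = \<one>\<^bsub>R\<^esub>" using h i by blast
    then show "row (pos i) (Bas V i) = \<one>\<^bsub>R\<^esub>" using i by (simp add: row_def V.Bas_closed pos(2))
    fix k assume k: "pos i < k" "k < m"
    then have "(iota k, g0 i) \<notin> Ord (St m)" "iota k \<in> Idx (St m)" using pos[OF i] by auto
    then have "coord R (St m) (g (Bas V i)) (iota k) = \<zero>\<^bsub>R\<^esub>" using h i by blast
    then show "row k (Bas V i) = \<zero>\<^bsub>R\<^esub>" using i by (simp add: row_def V.Bas_closed)
  qed
  \<comment> \<open>A later copy of the pivot row would have entry 1 at \<open>Bas V i\<close>,
    while rows below the pivot have entry 0 there.\<close>
  have last: "v ! k \<noteq> v ! pos i" if i: "i \<in> Idx V" and k: "pos i < k" "k < length v" for i k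
  proof
    assume "v ! k = v ! pos i"
    then have "row k = row (pos i)" using sig_v[of k] sig_v[OF pos(1)[OF i]] k v(2) by simp
    then show False using row_pos(1)[OF i] row_pos(2)[OF i k(1)] k(2) v(2) one_not_zero by simp
  qed
  have v_mono: "v ! pos i < v ! k" if "i \<in> Idx V" "pos i < k" "k < m" for i k
    using ordered_word_last[OF v(1) that(2) _ last[OF that(1)]] v(2) that(3) by simp
  have f0_eq: "f0 i = iota (v ! pos i)" if "i \<in> Idx V" for i using that by (simp add: f0_def pos_def)
  have pos_mono: "pos i < pos i'" if "i \<in> Idx V" "i' \<in> Idx V" "(i, i') \<in> Ord V" "i \<noteq> i'" for i i'
  proof -
    have "(g0 i, g0 i') \<in> Ord (St m)" using h that by blast
    then have "pos i \<le> pos i'" using pos that by simp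
    moreover have "pos i \<noteq> pos i'" using inj_onD[OF g0(2)] pos that by metis
    ultimately show ?thesis by simp
  qed
  have f_hom: "(f, f0) \<in> OVI_hom R V (St l)"
    unfolding f_def
  proof (rule row_map_OVI_hom[OF V based_St sig_form])
    show "f0 \<in> Idx V \<rightarrow>\<^sub>E Idx (St l)"
    proof
      show "f0 i \<in> Idx (St l)" if "i \<in> Idx V" for i
        using v_less[OF pos(1)[OF that]] by (simp add: f0_eq[OF that])
    qed (simp add: f0_def)
    show "inj_on f0 (Idx V)"
    proof (rule inj_onI, rule ccontr)
      fix i j assume ij: "i \<in> Idx V" "j \<in> Idx V" "f0 i = f0 j" "i \<noteq> j"
      then have "v ! pos i = v ! pos j" by (simp add: f0_eq)
      moreover have "pos i < pos j \<or> pos j < pos i" using V.Ord_total pos_mono ij by metis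
      ultimately show False using v_mono pos(1) ij by (metis less_irrefl)
    qed
    show "(f0 i, f0 i') \<in> Ord (St l)" if "i \<in> Idx V" "i' \<in> Idx V" "(i, i') \<in> Ord V" for i i'
    proof (cases "i = i'")
      case False
      then have "v ! pos i < v ! pos i'" using v_mono pos_mono pos(1) that by blast
      then show ?thesis using that v_less pos(1) by (simp add: f0_eq)
    next
      case True
      then show ?thesis using v_less[OF pos(1)[OF that(1)]] that(1) by (simp add: f0_eq)
    qed
    fix i assume i: "i \<in> Idx V"
    show "(sig ! num (f0 i)) (Bas V i) = \<one>\<^bsub>R\<^esub>" using i by (simp add: f0_eq sig_v pos(1) row_pos(1))
    show "(sig ! num j) (Bas V i) = \<zero>\<^bsub>R\<^esub>" if j: "j \<in> Idx (St l)" "(j, f0 i) \<notin> Ord (St l)" for j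
    proof -
      from j(1) obtain a where a: "j = iota a" "a < l" by (rule Idx_St_cases)
      have less: "v ! pos i < a" using j(2) a v_less[OF pos(1)[OF i]] by (simp add: f0_eq i not_le)
      let ?k = "last_index v a"
      have "a \<in> set v" using a set_v by simp
      then have k: "?k < m" "v ! ?k = a" using last_index_less nth_last_index v(2) by metis+
      \<comment> \<open>Reduced row \<open>a\<close> is represented by its last occurrence in
        \<open>v\<close>. If that lay before the old pivot, the order of last occurrences would give
        \<open>a < v ! pos i\<close>; so it lies below the pivot, where the entry is zero.\<close>
      have "pos i < ?k"
      proof (rule ccontr)
        assume "\<not> pos i < ?k"
        moreover have "?k \<noteq> pos i" using less k(2) by auto
        ultimately have "?k < pos i" by simp
        then have "v ! ?k < v ! pos i"
        proof (rule ordered_word_last[OF v(1)])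
          show "v ! b \<noteq> v ! ?k" if "?k < b" "b < length v" for b
            using le_last_index[OF that(2)] that(1) k(2) by auto
        qed (simp add: v(2) pos(1) i)
        then show False using less k(2) by simp
      qed
      then show ?thesis using row_pos(2)[OF i _ k(1)] sig_v[OF k(1)] k(2) a(1) by simp
    qed
  qed
  then have G: "(V, (f, f0), St l) \<in> Hom (OVI R) V (St l)" using V based_St by (simp add: Hom_OVI)
  have comp: "(compose (carrier V) (word_map l v) f, compose (Idx V) (word_index l v) f0) \<in> OVI_hom R V (St m)"
    using OVI_hom_comp[OF V based_St based_St f_hom word_map_OVI_hom[OF v(1)]] v(2) by simp
  have "(V, (g, g0), St m) = (V, (compose (carrier V) (word_map l v) f, compose (Idx V) (word_index l v) f0), St m)"
  proof (rule OVI_arrow_eqI[OF V based_St hom comp])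
    fix x j assume x: "x \<in> carrier V" and "j \<in> Idx (St m)"
    then obtain k where k: "j = iota k" "k < m" by (metis Idx_St_cases)
    have fx: "f x \<in> carrier (St l)" unfolding f_def by (rule row_map_closed[OF V based_St sig_form x])
    have "coord R (St m) (word_map l v (f x)) j = coord R (St l) (f x) (iota (v ! k))"
      using coord_word_map[OF v(1) fx, of k] k v(2) by simp
    also have "\<dots> = (sig ! (v ! k)) x"
      unfolding f_def using coord_row_map[OF V based_St sig_form x, where j = "iota (v ! k)"] v_less[OF k(2)] by simp
    also have "\<dots> = coord R (St m) (g x) j" using sig_v[OF k(2)] x k(1) by (simp add: row_def)
    finally show "coord R (St m) (g x) j = coord R (St m) (compose (carrier V) (word_map l v) f x) j"
      using x by (simp add: compose_def)
  qed
  then have "F = Comp (OVI R) (FM (ea v)) (V, (f, f0), St l)"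
    using FM_ea[OF v(1)] v(2) by (simp add: F_eq Comp_OVI)
  then show thesis using that l G v by blast
qed

lemma property_F_FM: "property_F W (OVI R) FO FM"
  unfolding property_F_def
proof
  fix V :: "('r, 'v, 'i) based_module"
  assume "V \<in> Obj (OVI R)"
  then have V: "based R V" by (simp add: Obj_OVI)
  \<comment> \<open>All arrows from \<open>V\<close> to standard objects of rank up to the number of
    possible rows: a finite set chosen from \<open>V\<close> alone.\<close>
  define S where "S = (\<Union>l \<le> card (carrier V \<rightarrow>\<^sub>E carrier R). {eo l} \<times> Hom (OVI R) V (St l))"
  have "finite S" unfolding S_def by (intro finite_UN_I) (simp_all add: finite_Hom_OVI)
  moreover have "\<forall>p \<in> S. fst p \<in> Obj W \<and> snd p \<in> Hom (OVI R) V (FO (fst p))"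
    by (auto simp: S_def Obj_W)
  moreover have "\<exists>p \<in> S. \<exists>g \<in> Hom W (fst p) x. F = Comp (OVI R) (FM g) (snd p)"
    if x: "x \<in> Obj W" and F: "F \<in> Hom (OVI R) V (FO x)" for x F
  proof -
    from x obtain m where m: "x = eo m" by (auto simp: Obj_W)
    from factor_OVI_hom[OF V F[unfolded m FO_eo]] obtain l G v where
      l: "l \<le> card (carrier V \<rightarrow>\<^sub>E carrier R)" "G \<in> Hom (OVI R) V (St l)"
      "ordered_word l v" "length v = m" "F = Comp (OVI R) (FM (ea v)) G" by blast
    have "(eo l, G) \<in> S" using l by (auto simp: S_def)
    moreover have "ea v \<in> Hom W (eo l) x" using l m by simp
    ultimately show ?thesis using l(5) by (intro bexI[of _ "(eo l, G)"] bexI[of _ "ea v"]) simp_all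
  qed
  ultimately show "\<exists>S :: (('r, 'v, 'i) based_module \<times> ('r, 'v, 'i) OVI_arrow) set. finite S \<and>
      (\<forall>p \<in> S. fst p \<in> Obj W \<and> snd p \<in> Hom (OVI R) V (FO (fst p))) \<and>
      (\<forall>x \<in> Obj W. \<forall>f \<in> Hom (OVI R) V (FO x).
        \<exists>p \<in> S. \<exists>g \<in> Hom W (fst p) x. f = Comp (OVI R) (FM g) (snd p))"
    by (intro exI[of _ S] conjI ballI) simp_all
qed

lemma quasi_groebner_OVI: "quasi_groebner (OVI R :: (('r, 'v, 'i) based_module, ('r, 'v, 'i) OVI_arrow) category)"
  unfolding quasi_groebner_def
  using groebner_W cat_functor_FM essentially_surjective_FO property_F_FM by blast

lemma locally_noetherian_OVI:
  assumes "cring k" "\<one>\<^bsub>k\<^esub> \<noteq> \<zero>\<^bsub>k\<^esub>" "noetherian_ring k"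
  shows "locally_noetherian TYPE('u) k (OVI R :: (('r, 'v, 'i) based_module, ('r, 'v, 'i) OVI_arrow) category)"
proof (rule cat_functor.locally_noetherian_target[OF cat_functor_FM essentially_surjective_FO property_F_FM assms
      noetherian_W wf_less_W trans_less_W])
  show "total_on (Hom W x y) less_W" for x y
    using total_less_W unfolding total_on_def by blast
qed (blast intro: less_W_Comp)+

end

theorem theorem4p3:
  fixes R :: "('r, 'x) ring_scheme"
  assumes "ring R" and "\<one>\<^bsub>R\<^esub> \<noteq> \<zero>\<^bsub>R\<^esub>" and "finite (carrier R)"
    and "infinite (UNIV :: 'v set)" and "infinite (UNIV :: 'i set)"
  shows "quasi_groebner (OVI R :: (('r, 'v, 'i) based_module, ('r, 'v, 'i) OVI_arrow) category) \<and>
    (\<forall>k :: ('k, 'y) ring_scheme. cring k \<and> \<one>\<^bsub>k\<^esub> \<noteq> \<zero>\<^bsub>k\<^esub> \<and> noetherian_ring k \<longrightarrow>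
      locally_noetherian TYPE('a) k
        (OVI R :: (('r, 'v, 'i) based_module, ('r, 'v, 'i) OVI_arrow) category))"
proof -
  obtain iota :: "nat \<Rightarrow> 'i" where iota: "inj iota"
    using infinite_countable_subset[OF assms(5)] by blast
  have "\<exists>V :: ('r, 'v, 'i) based_module. based R V \<and> Idx V = iota ` {..<n} \<and>
      Ord V = {(iota a, iota b) |a b. a \<le> b \<and> b < n}" for n
  proof -
    let ?r = "{(iota a, iota b) |a b. a \<le> b \<and> b < n}"
    have lin: "linear_order_on (iota ` {..<n}) ?r"
      using inj_eq[OF iota] unfolding linear_order_on_def partial_order_on_def preorder_on_def
      by (auto simp: refl_on_def trans_def antisym_def total_on_def)
    show ?thesis by (rule exists_based[OF assms(1,3,4) _ lin]) auto
  qed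
  then obtain St :: "nat \<Rightarrow> ('r, 'v, 'i) based_module" where St: "\<And>n. based R (St n)"
    "\<And>n. Idx (St n) = iota ` {..<n}" "\<And>n. Ord (St n) = {(iota a, iota b) |a b. a \<le> b \<and> b < n}"
    by metis
  have inj_St: "inj St"
  proof (rule injI)
    fix m n assume "St m = St n"
    then have "card (iota ` {..<m}) = card (iota ` {..<n})" using St(2) by metis
    then show "m = n" using iota by (simp add: card_image inj_on_subset)
  qed
  \<comment> \<open>Words only need pairwise distinct names. The number of the word is stored in the
    source component through the pairwise distinct objects \<open>St n\<close>, and the other
    components are irrelevant; \<open>St\<close> also names the objects.\<close>
  define ea :: "nat list \<Rightarrow> ('r, 'v, 'i) OVI_arrow" where
    "ea w = (St (list_encode w), undefined, undefined)" for w
  have "inj ea" using injD[OF inj_St] injD[OF inj_list_encode] by (auto simp: ea_def intro!: injI)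
  interpret word_functor St ea R iota St
    by (intro word_functor.intro word_category.intro word_functor_axioms.intro assms iota inj_St \<open>inj ea\<close> St)
  show ?thesis using quasi_groebner_OVI locally_noetherian_OVI by blast
qed

end
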